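(* Let $\rho>0$, let $\Omega\in(0,1)$ be a quadratic irrational number, and let $\lambda=\lambda(\Omega)$ and the functions $h_1(\varepsilon),h_2(\varepsilon)$ be as defined in the context (for $\varepsilon>0$ small enough). Put $J_1=\frac12\left(\sqrt\lambda+\frac1{\sqrt\lambda}\right)$, $J_2=\frac12\left(\lambda+\frac1\lambda\right)$. (a) If $\Omega$ is metallic, i.e. $\Omega=[\overline{a}]$ with $a\ge1$, the function $h_1(\varepsilon)$ has exactly $1$ corner $\check\varepsilon$ in each period, satisfies $\max h_1(\varepsilon)=h_1(\check\varepsilon)=J_1$, and the distance between consecutive corners (in the variable $\ln\varepsilon$) is exactly $4\ln\lambda$. (b) If $\Omega$ is golden-colored, i.e. $\Omega=[\overline{1,b}]$ with $b\ge2$, the function $h_2(\varepsilon)$ has at least $3$ corners in each period, and satisfies $\min h_2(\varepsilon)=J_1$, $\max h_2(\varepsilon)<J_2$. (c) If $\Omega$ is metallic-colored but not golden-colored, i.e. $\Omega=[\overline{a,b}]$ with $2\le a<b$, the function $h_1(\varepsilon)$ has at least $2$ corners in each period, and satisfies $\max h_1(\varepsilon)<J_1$.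
   Context: Notation: $\omega=(1,\Omega)$; $\langle\cdot,\cdot\rangle$ is the Euclidean scalar product. $[a_1,a_2,\ldots]=1/(a_1+1/(a_2+\cdots))$, a bar denoting the repeated period. A corner is a jump discontinuity of the derivative. The functions $h_1,h_2$ are the ones in the exponents of the asymptotic estimates, as $\varepsilon\to0$, for the maximal splitting distance and the transversality of the splitting of the whiskers of a torus with frequency vector $\omega/\sqrt\varepsilon$, for a pendulum-rotor Hamiltonian with a perturbation whose Fourier coefficients are $e^{-\rho|k|}$; they depend only on $\Omega$ and $\rho$, as follows. If $\Omega=[\overline{a_1,\ldots,a_m}]$, put $T=A_1\cdots A_m$ with $A_i=\begin{pmatrix}a_i&1\\1&0\end{pmatrix}$ and $\lambda=1/(x_0x_1\cdots x_{m-1})>1$, where $x_0=\Omega$ and $x_j$ is the fractional part of $1/x_{j-1}$. Then $T$ is unimodular and $T\omega=\lambda\omega$. (Here $m=1$ for $[\overline a]$ and $m=2$ for $[\overline{a,b}]$.) Write $T=\begin{pmatrix}t_1&t_2\\t_3&t_4\end{pmatrix}$, $\sigma=\det T=(-1)^m$, $U=\sigma(T^{-1})^\top=\begin{pmatrix}t_4&-t_3\\-t_2&t_1\end{pmatrix}$. For an integer $q\ge1$ let $p=p^0(q)$ be the closest integer to $q\Omega$ and $k^0(q)=(-p,q)$. Let $\mathcal A=\{k^0(q):q\ge1\}$ and $\mathcal A_0\subset\mathcal A$ those vectors (called essential) that are not a multiple of another integer vector. An integer $q\ge1$ is primitive if $k^0(q)\in\mathcal A$ but $U^{-1}k^0(q)\notin\mathcal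 A$ (equivalently $\frac1{2\lambda}<|\langle k^0(q),\omega\rangle|<\frac12$); $\mathcal P$ is the set of primitive integers. The resonant sequences $s(q,n)=U^nk^0(q)$, $q\in\mathcal P$, $n\ge0$, cover $\mathcal A$. For $q\in\mathcal P$ put $$r_q=q\Omega-p,\quad z_q=t_3q+t_2p\,\Omega,\quad K_q=\frac{|z_q|(1+\Omega)}{|t_3+t_2\Omega^2|},\quad \gamma^*_q=|r_q|K_q,\quad \gamma^*=\min_{q\in\mathcal P}\gamma^*_q>0,\quad \tilde\gamma^*_q=\gamma^*_q/\gamma^*.$$ Let $G(\varepsilon;X,Y)=\frac{Y^{1/2}}2\left[(\varepsilon/X)^{1/4}+(X/\varepsilon)^{1/4}\right]$ and $D_0=\left(\frac{\pi\gamma^*}{2\rho}\right)^2$. For $k=s(q,n)\in\mathcal A$ define $g^*_k(\varepsilon)=G(\varepsilon;\varepsilon^*_k,\tilde\gamma^*_q)$ with $\varepsilon^*_k=\dfrac{D_0(\tilde\gamma^*_q)^2}{K_q^4\lambda^{4n}}$. Define $h_1(\varepsilon)=\min_{k\in\mathcal A_0}g^*_k(\varepsilon)=g^*_{S_1}(\varepsilon)$ and $h_2(\varepsilon)=\min_{k\in\mathcal A_0\setminus\{S_1\}}g^*_k(\varepsilon)$, where $S_1=S_1(\varepsilon)$ is a vector at which the first minimum is reached. For $\varepsilon$ small enough, i.e. on some interval $(0,\varepsilon_0)$, these functions are $4\ln\lambda$-periodic in $\ln\varepsilon$; a period is an interval $(\varepsilon,\lambda^4\varepsilon]$ contained in $(0,\varepsilon_0)$,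 and minima and maxima are taken over a period. *)

theory Defs
  imports "HOL-Analysis.Analysis"
begin

definition quadratic_irrational :: "real \<Rightarrow> bool" where
  "quadratic_irrational x \<longleftrightarrow> x \<notin> \<rat> \<and>
     (\<exists>a b c :: int. a \<noteq> 0 \<and> of_int a * x\<^sup>2 + of_int b * x + of_int c = 0)"

fun cfrac :: "nat list \<Rightarrow> real" where
  "cfrac [] = 0"
| "cfrac (a # as) = 1 / (of_nat a + cfrac as)"

text \<open>\<open>has_periodic_cfrac \<Omega> as\<close>: the number \<open>\<Omega>\<close> is the value (limit of the convergents) of the
  infinite continued fraction with zero integer part and repeated period \<open>as\<close>.\<close>

definition has_periodic_cfrac :: "real \<Rightarrow> nat list \<Rightarrow> bool" where
  "has_periodic_cfrac \<Omega> as \<longleftrightarrow>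
     (\<lambda>n. cfrac (map (\<lambda>i. as ! (i mod length as)) [0..<n])) \<longlonglongrightarrow> \<Omega>"

text \<open>All quantities below are meant for a number \<open>\<Omega>\<close> with \<open>has_periodic_cfrac \<Omega> as\<close>, where the
  entries of \<open>as\<close> are positive.\<close>

context
  fixes \<Omega> :: real and as :: "nat list"
begin

definition lam :: real where
  "lam = 1 / (\<Prod>j<length as. ((\<lambda>x. frac (1 / x)) ^^ j) \<Omega>)"

definition T_mat :: "int^2^2" where
  "T_mat = foldr (\<lambda>a M. vector [vector [int a, 1], vector [1, 0]] ** M) as (mat 1)"

text \<open>As \<open>det T_mat = \<plusminus>1\<close>, this is \<open>det T_mat\<close> times the transposed inverse of \<open>T_mat\<close>.\<close>

definition U_mat :: "int^2^2" where
  "U_mat = vector [vector [  T_mat $ 2 $ 2, - T_mat $ 2 $ 1],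
                   vector [- T_mat $ 1 $ 2,   T_mat $ 1 $ 1]]"

text \<open>For irrational \<open>\<Omega>\<close> the closest integer to \<open>q\<Omega>\<close> is unique, so the tie-breaking convention
  of \<^const>\<open>round\<close> is irrelevant.\<close>

definition p0 :: "int \<Rightarrow> int" where
  "p0 q = round (of_int q * \<Omega>)"

definition k0 :: "int \<Rightarrow> int^2" where
  "k0 q = vector [- p0 q, q]"

definition quasi_resonances :: "(int^2) set" where
  "quasi_resonances = {k0 q |q. q \<ge> 1}"

text \<open>\<open>k\<close> is always \<open>-1\<close> times \<open>-k\<close>; only factors of absolute value different from \<open>1\<close>
  disqualify a vector from being essential.\<close>

definition essential_resonances :: "(int^2) set" where
  "essential_resonances =
     {k \<in> quasi_resonances. \<not> (\<exists>c v. \<bar>c\<bar> \<noteq> 1 \<and> k = c *s v)}"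

definition primitives :: "int set" where
  "primitives = {q. q \<ge> 1 \<and> matrix_inv U_mat *v k0 q \<notin> quasi_resonances}"

definition res_seq :: "int \<Rightarrow> nat \<Rightarrow> int^2" where
  "res_seq q n = ((\<lambda>k. U_mat *v k) ^^ n) (k0 q)"

definition r_fun :: "int \<Rightarrow> real" where
  "r_fun q = of_int q * \<Omega> - of_int (p0 q)"

definition z_fun :: "int \<Rightarrow> real" where
  "z_fun q = of_int (T_mat $ 2 $ 1) * of_int q + of_int (T_mat $ 1 $ 2) * of_int (p0 q) * \<Omega>"

definition K_fun :: "int \<Rightarrow> real" where
  "K_fun q = \<bar>z_fun q\<bar> * (1 + \<Omega>) / \<bar>of_int (T_mat $ 2 $ 1) + of_int (T_mat $ 1 $ 2) * \<Omega>\<^sup>2\<bar>"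

definition gam :: "int \<Rightarrow> real" where
  "gam q = \<bar>r_fun q\<bar> * K_fun q"

definition gam_min :: real where
  "gam_min = (INF q\<in>primitives. gam q)"

definition gam_rel :: "int \<Rightarrow> real" where
  "gam_rel q = gam q / gam_min"

definition D0 :: "real \<Rightarrow> real" where
  "D0 \<rho> = (pi * gam_min / (2 * \<rho>))\<^sup>2"

definition G_fun :: "real \<Rightarrow> real \<Rightarrow> real \<Rightarrow> real" where
  "G_fun \<epsilon> X Y = Y powr (1/2) / 2 * ((\<epsilon> / X) powr (1/4) + (X / \<epsilon>) powr (1/4))"

definition eps_center :: "real \<Rightarrow> int \<Rightarrow> nat \<Rightarrow> real" where
  "eps_center \<rho> q n = D0 \<rho> * (gam_rel q)\<^sup>2 / (K_fun q ^ 4 * lam ^ (4 * n))"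

text \<open>Every quasi-resonance is \<open>res_seq q n\<close> for exactly one \<open>q \<in> primitives\<close> and one \<open>n\<close>.\<close>

definition res_index :: "int^2 \<Rightarrow> int \<times> nat" where
  "res_index k = (THE (q, n). q \<in> primitives \<and> res_seq q n = k)"

definition g_star :: "real \<Rightarrow> int^2 \<Rightarrow> real \<Rightarrow> real" where
  "g_star \<rho> k \<epsilon> = (case res_index k of (q, n) \<Rightarrow> G_fun \<epsilon> (eps_center \<rho> q n) (gam_rel q))"

text \<open>If the first minimum is reached at several vectors, \<open>S1\<close> is one of them; the value of \<open>h2\<close>
  does not depend on the choice.\<close>

definition h1 :: "real \<Rightarrow> real \<Rightarrow> real" where
  "h1 \<rho> \<epsilon> = (INF k\<in>essential_resonances. g_star \<rho> k \<epsilon>)"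

definition S1 :: "real \<Rightarrow> real \<Rightarrow> int^2" where
  "S1 \<rho> \<epsilon> = arg_min_on (\<lambda>k. g_star \<rho> k \<epsilon>) essential_resonances"

definition h2 :: "real \<Rightarrow> real \<Rightarrow> real" where
  "h2 \<rho> \<epsilon> = (INF k\<in>essential_resonances - {S1 \<rho> \<epsilon>}. g_star \<rho> k \<epsilon>)"

end

text \<open>Jump discontinuity of the derivative: \<open>f\<close> is differentiable near \<open>x\<close> (except possibly at
  \<open>x\<close>), and the one-sided limits of the derivative exist and differ.\<close>

definition corner :: "(real \<Rightarrow> real) \<Rightarrow> real \<Rightarrow> bool" where
  "corner f x \<longleftrightarrow> (\<forall>\<^sub>F y in at x. f differentiable at y) \<and>
     (\<exists>a b. a \<noteq> b \<and> (deriv f \<longlongrightarrow> a) (at_left x) \<and> (deriv f \<longlongrightarrow> b) (at_right x))"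

text \<open>\<open>log_periodic_on f c \<epsilon>0\<close>: on \<open>(0, \<epsilon>0)\<close>, \<open>f \<epsilon>\<close> is periodic in \<open>ln \<epsilon>\<close> with period \<open>ln c\<close>.
  The periods of \<open>f\<close> are then the intervals in \<open>log_periods c \<epsilon>0\<close>.\<close>

definition log_periodic_on :: "(real \<Rightarrow> real) \<Rightarrow> real \<Rightarrow> real \<Rightarrow> bool" where
  "log_periodic_on f c \<epsilon>0 \<longleftrightarrow> (\<forall>\<epsilon>>0. c * \<epsilon> < \<epsilon>0 \<longrightarrow> f (c * \<epsilon>) = f \<epsilon>)"

definition log_periods :: "real \<Rightarrow> real \<Rightarrow> real set set" where
  "log_periods c \<epsilon>0 = {{\<epsilon><..c * \<epsilon>} |\<epsilon>. \<epsilon> > 0 \<and> c * \<epsilon> < \<epsilon>0}"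

definition maximum_on :: "(real \<Rightarrow> real) \<Rightarrow> real set \<Rightarrow> real \<Rightarrow> bool" where
  "maximum_on f I M \<longleftrightarrow> M \<in> f ` I \<and> (\<forall>x\<in>I. f x \<le> M)"

definition minimum_on :: "(real \<Rightarrow> real) \<Rightarrow> real set \<Rightarrow> real \<Rightarrow> bool" where
  "minimum_on f I m \<longleftrightarrow> m \<in> f ` I \<and> (\<forall>x\<in>I. m \<le> f x)"

definition J1 :: "real \<Rightarrow> real" where
  "J1 l = (sqrt l + 1 / sqrt l) / 2"

definition J2 :: "real \<Rightarrow> real" where
  "J2 l = (l + 1 / l) / 2"

end

theory Submission
  imports Defs
begin

text \<open>The theorem is a statement about the first two minima of a weighted \<open>l\<^sup>1\<close> norm on the lattice of
  integer vectors. Let \<open>u(k) = \<langle>k, \<omega>\<rangle>\<close>, and let \<open>v\<close> be the linear form \<open>t\<^sub>3 k\<^sub>2 - t\<^sub>2 \<Omega> k\<^sub>1\<close>, whose value at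
  \<open>k\<^sup>0(q)\<close> is \<open>z\<^sub>q\<close>. The map \<open>U\<close> multiplies \<open>u\<close> by \<open>\<plusminus>1/\<lambda>\<close> and \<open>v\<close> by \<open>\<lambda>\<close>, so along a resonant sequence the
  product \<open>u v\<close> is constant up to sign and \<open>K\<^sub>q \<lambda>\<^sup>n\<close> is a fixed multiple of \<open>|v|\<close>. Inserting this into the
  definitions, the dependence on \<open>q\<close> and \<open>n\<close> separately disappears, and
  \<open>g\<^sup>*\<^sub>k(\<epsilon>) = (|v(k)| t + |u(k)| / t) / 2\<close> with \<open>t\<close> a constant multiple of \<open>\<epsilon>\<^sup>1\<^sup>/\<^sup>4\<close>, once \<open>u\<close> and \<open>v\<close> are
  normalised so that the smallest value of \<open>|u v|\<close> is \<open>1\<close> (\<open>g_star_eq\<close>, \<open>g_star_level\<close>). Replacing \<open>\<epsilon>\<close> by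
  \<open>\<lambda>\<^sup>4\<epsilon>\<close> multiplies \<open>t\<close> by \<open>\<lambda>\<close>, which has the same effect as applying \<open>U\<close> to \<open>k\<close>. Hence everything reduces to the window \<open>1 \<le> t \<le> \<lambda>\<close>.
  The restrictions \<open>q \<ge> 1\<close>, \<open>|u(k)| < 1/2\<close> and essentiality do not disturb this for small \<open>\<epsilon>\<close>: the lower
  bounds hold for all nonzero lattice vectors (for the second minimum, for all vectors that are not multiples of
  the first minimiser), and the vectors that attain them enter the set of essential
  resonances after finitely many applications of \<open>U\<close>.

  In the window, multiplication by \<open>2t\<close> turns each competitor into \<open>|v(k)| s + |u(k)|\<close>, which is affine in
  \<open>s = t\<^sup>2\<close>. A proposed minimum of two explicit affine functions is therefore confirmed by comparing values at
  the two ends and at the crossing point, where the claim becomes an inequality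
  \<open>|A| + |B| \<ge> max (|A + B|) (|A - B|)\<close> for two integer combinations \<open>A\<close>, \<open>B\<close>
  (\<open>lower_bound_metallic\<close>, \<open>second_bound_golden\<close>, \<open>lower_bound_metallic_colored\<close>). With \<open>k\<^sub>n = U\<^sup>n k\<^sub>0\<close> the
  orbit of minimal \<open>|u v|\<close>, the outcome is as follows.

  For \<open>\<Omega> = [a, a, \<dots>]\<close> only two neighbours \<open>k\<^sub>n\<close>, \<open>k\<^sub>n\<^sub>-\<^sub>1\<close> compete for \<open>h\<^sub>1\<close>; they cross halfway between their
  centers, at \<open>t = \<surd>\<lambda>\<close>, at height \<open>J\<^sub>1\<close>. For period \<open>(a, b)\<close> there is a second orbit, that of
  \<open>(k\<^sub>n - k\<^sub>n\<^sub>-\<^sub>1) / a\<close>, centered halfway between \<open>k\<^sub>n\<close> and \<open>k\<^sub>n\<^sub>-\<^sub>1\<close> and of height \<open>\<surd>(b/a)\<close>. If \<open>2 \<le> a < b\<close> it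
  undercuts \<open>J\<^sub>1\<close> there, so it replaces the corner at \<open>\<surd>\<lambda>\<close> by two lower ones. If \<open>a = 1\<close> it is too high to
  affect \<open>h\<^sub>1\<close>, but it enters \<open>h\<^sub>2\<close>: near the center of \<open>k\<^sub>n\<close>, where \<open>k\<^sub>n\<^sub>-\<^sub>1\<close> and \<open>k\<^sub>n\<^sub>+\<^sub>1\<close> have height \<open>J\<^sub>2\<close>, it
  is lower than both, and \<open>h\<^sub>2\<close> has corners where it meets \<open>k\<^sub>n\<^sub>-\<^sub>1\<close> and \<open>k\<^sub>n\<close> and at \<open>\<surd>\<lambda>\<close>, where \<open>k\<^sub>n\<close> and
  \<open>k\<^sub>n\<^sub>-\<^sub>1\<close> exchange their roles as first and second minimum.\<close>

section \<open>Functions of hyperbolic-cosine type and their corners\<close>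

text \<open>With \<open>t = e\<^sup>x\<close> and \<open>V, W > 0\<close> this is \<open>\<surd>(V W) cosh (x - x\<^sub>0)\<close>, centered at \<open>t\<^sup>2 = W / V\<close>.\<close>

definition hyp_arc :: "real \<Rightarrow> real \<Rightarrow> real \<Rightarrow> real" where
  "hyp_arc V W t = (V * t + W / t) / 2"

lemma hyp_arc_rescale: "c > 0 \<Longrightarrow> hyp_arc (V * c) (W / c) t = hyp_arc V W (c * t)"
  by (simp add: hyp_arc_def field_simps)

lemma hyp_arc_eq_fraction: "t > 0 \<Longrightarrow> hyp_arc V W t = (V * t\<^sup>2 + W) / (2 * t)"
  by (simp add: hyp_arc_def power2_eq_square field_simps)

text \<open>The reason for working with \<open>s = t\<^sup>2\<close>: comparing two of these functions is comparing two affine functions.\<close>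

lemma hyp_arc_le_iff: "t > 0 \<Longrightarrow> hyp_arc V W t \<le> hyp_arc V' W' t \<longleftrightarrow> V * t\<^sup>2 + W \<le> V' * t\<^sup>2 + W'"
  by (simp add: hyp_arc_eq_fraction divide_le_cancel)

lemma hyp_arc_eq_iff: "t > 0 \<Longrightarrow> hyp_arc V W t = hyp_arc V' W' t \<longleftrightarrow> V * t\<^sup>2 + W = V' * t\<^sup>2 + W'"
  by (simp add: hyp_arc_eq_fraction)

text \<open>One-sided agreement suffices on both sides, because a corner only concerns the derivative in a punctured
  neighbourhood.\<close>

lemma cornerI:
  assumes left: "\<forall>\<^sub>F y in at_left x. f y = \<phi>1 y"
    and right: "\<forall>\<^sub>F y in at_right x. f y = \<phi>2 y"
    and d1: "\<And>y. y > 0 \<Longrightarrow> (\<phi>1 has_real_derivative d1 y) (at y)"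
    and d2: "\<And>y. y > 0 \<Longrightarrow> (\<phi>2 has_real_derivative d2 y) (at y)"
    and cont: "isCont d1 x" "isCont d2 x"
    and ne: "d1 x \<noteq> d2 x" and x: "(x::real) > 0"
  shows "corner f x"
proof -
  obtain a where a: "a < x" "\<And>y. a < y \<Longrightarrow> y < x \<Longrightarrow> f y = \<phi>1 y"
    using left unfolding eventually_at_left_field by blast
  obtain b where b: "b > x" "\<And>y. y < b \<Longrightarrow> x < y \<Longrightarrow> f y = \<phi>2 y"
    using right unfolding eventually_at_right_field by blast
  have D1: "(f has_real_derivative d1 y) (at y)" if "max a 0 < y" "y < x" for y
    by (rule has_field_derivative_transform_within_open[OF d1, of y "{max a 0<..<x}"])
       (use that a in auto)
  have D2: "(f has_real_derivative d2 y) (at y)" if "x < y" "y < b" for y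
    by (rule has_field_derivative_transform_within_open[OF d2, of y "{x<..<b}"])
       (use that x b in auto)
  have e1: "\<forall>\<^sub>F y in at_left x. y \<in> {max a 0<..<x}"
    by (rule eventually_at_leftI[of "max a 0"]) (use a x in auto)
  have e2: "\<forall>\<^sub>F y in at_right x. y \<in> {x<..<b}"
    by (rule eventually_at_rightI[of _ b]) (use b in auto)
  have "(deriv f \<longlongrightarrow> d1 x) (at_left x)"
  proof (rule Lim_transform_eventually)
    show "(d1 \<longlongrightarrow> d1 x) (at_left x)"
      using cont(1) unfolding isCont_def by (rule filterlim_mono) (auto simp: at_within_le_at)
    show "\<forall>\<^sub>F y in at_left x. d1 y = deriv f y"
      using e1 by eventually_elim (use DERIV_imp_deriv[OF D1] in auto)
  qed
  moreover have "(deriv f \<longlongrightarrow> d2 x) (at_right x)"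
  proof (rule Lim_transform_eventually)
    show "(d2 \<longlongrightarrow> d2 x) (at_right x)"
      using cont(2) unfolding isCont_def by (rule filterlim_mono) (auto simp: at_within_le_at)
    show "\<forall>\<^sub>F y in at_right x. d2 y = deriv f y"
      using e2 by eventually_elim (use DERIV_imp_deriv[OF D2] in auto)
  qed
  moreover have "\<forall>\<^sub>F y in at x. f differentiable at y"
    unfolding eventually_at_split
  proof
    show "\<forall>\<^sub>F y in at_left x. f differentiable at y"
      using e1 by eventually_elim (use D1 real_differentiable_def in auto)
    show "\<forall>\<^sub>F y in at_right x. f differentiable at y"
      using e2 by eventually_elim (use D2 real_differentiable_def in auto)
  qed
  ultimately show ?thesis
    unfolding corner_def using ne by blast
qed

lemma not_cornerI:
  assumes eq: "\<forall>\<^sub>F y in nhds x. f y = \<phi> y"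
    and d: "\<And>y. y > 0 \<Longrightarrow> (\<phi> has_real_derivative d y) (at y)"
    and cont: "isCont d x" and x: "(x::real) > 0"
  shows "\<not> corner f x"
proof
  assume "corner f x"
  then obtain a b where ab: "a \<noteq> b" "(deriv f \<longlongrightarrow> a) (at_left x)" "(deriv f \<longlongrightarrow> b) (at_right x)"
    unfolding corner_def by blast
  obtain S where S: "open S" "x \<in> S" "\<And>y. y \<in> S \<Longrightarrow> f y = \<phi> y"
    using eq unfolding eventually_nhds by blast
  have D: "(f has_real_derivative d y) (at y)" if "y \<in> S \<inter> {0<..}" for y
    by (rule has_field_derivative_transform_within_open[OF d, of y "S \<inter> {0<..}"])
       (use that S in auto)
  have "\<forall>\<^sub>F y in at x. y \<in> S \<inter> {0<..}"
    using S x by (intro eventually_at_in_open') auto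
  then have ev: "\<forall>\<^sub>F y in at x. d y = deriv f y"
    by eventually_elim (use DERIV_imp_deriv[OF D] in auto)
  have lim: "(deriv f \<longlongrightarrow> d x) (at x)"
    using cont unfolding isCont_def by (rule Lim_transform_eventually) (use ev in simp)
  then have "(deriv f \<longlongrightarrow> d x) (at_left x)" "(deriv f \<longlongrightarrow> d x) (at_right x)"
    by (auto intro: filterlim_mono[OF _ order_refl] simp: at_within_le_at)
  then have "a = d x" "b = d x"
    using ab tendsto_unique[OF trivial_limit_at_left_real] tendsto_unique[OF trivial_limit_at_right_real]
    by blast+
  then show False using ab by simp
qed

lemma hyp_arc_diff:
  assumes "0 < t" "0 < t'"
  shows "hyp_arc V W t' - hyp_arc V W t = (t' - t) * (V * (t * t') - W) / (2 * (t * t'))"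
  using assms by (simp add: hyp_arc_def field_simps)

lemma hyp_arc_increasing:
  assumes "0 < t" "t \<le> t'" "W \<le> V * (t * t')"
  shows "hyp_arc V W t \<le> hyp_arc V W t'"
proof -
  have "0 \<le> (t' - t) * (V * (t * t') - W) / (2 * (t * t'))" using assms by simp
  then show ?thesis unfolding hyp_arc_diff[symmetric, OF assms(1) less_le_trans[OF assms(1,2)]] by simp
qed

lemma hyp_arc_decreasing:
  assumes "0 < t" "t \<le> t'" "V * (t * t') \<le> W"
  shows "hyp_arc V W t' \<le> hyp_arc V W t"
proof -
  have "(t' - t) * (V * (t * t') - W) / (2 * (t * t')) \<le> 0"
    using assms by (intro divide_nonpos_pos mult_nonneg_nonpos mult_pos_pos) auto
  then show ?thesis unfolding hyp_arc_diff[symmetric, OF assms(1) less_le_trans[OF assms(1,2)]] by simp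
qed

text \<open>The reflection \<open>t \<mapsto> l / t\<close> of the window \<open>[1, l]\<close> exchanges the roles of the two coordinates.\<close>

lemma hyp_arc_reflect: "t > 0 \<Longrightarrow> l > 0 \<Longrightarrow> hyp_arc V W (l / t) = hyp_arc (W / l) (V * l) t"
  by (simp add: hyp_arc_def)

lemma J1_eq: "J1 l = hyp_arc 1 1 (sqrt l)"
  by (simp add: J1_def hyp_arc_def)

lemma J1_eq': "l > 1 \<Longrightarrow> J1 l = hyp_arc (1 / l) l (sqrt l)"
  by (simp add: J1_def hyp_arc_def real_div_sqrt sqrt_divide_self_eq inverse_eq_divide)

lemma sqrt_bounds: "l > (1::real) \<Longrightarrow> 1 < sqrt l \<and> sqrt l < l"
  using real_sqrt_less_iff[of 1 l] real_sqrt_less_iff[of l "l * l"] by simp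

section \<open>Functions that are periodic in the logarithm\<close>

text \<open>The function \<open>h\<close> is given through the phase \<open>t = C \<epsilon>\<^sup>1\<^sup>/\<^sup>4 l\<^sup>n\<close>, reduced to \<open>[1, l]\<close> by the choice of \<open>n\<close>, and a
  profile \<open>F\<close> on that window. At the ends of the window two choices of \<open>n\<close> are possible, and both must
  give the value of \<open>h\<close>. The bound on \<open>\<epsilon>0\<close> guarantees that the level \<open>n\<close> is a positive natural number.\<close>

locale log_scaling =
  fixes C l \<epsilon>0 :: real and h F :: "real \<Rightarrow> real"
  assumes C: "C > 0" and l: "l > 1" and pos0: "\<epsilon>0 > 0"
    and small: "C * \<epsilon>0 powr (1/4) \<le> 1"
    and rep: "\<And>\<epsilon> n. 0 < \<epsilon> \<Longrightarrow> \<epsilon> < \<epsilon>0 \<Longrightarrow> 1 \<le> C * \<epsilon> powr (1/4) * l ^ n \<Longrightarrow>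
        C * \<epsilon> powr (1/4) * l ^ n \<le> l \<Longrightarrow> h \<epsilon> = F (C * \<epsilon> powr (1/4) * l ^ n)"
begin

definition sc :: "real \<Rightarrow> real" where "sc \<epsilon> = C * \<epsilon> powr (1/4)"

lemma sc_pos: "\<epsilon> > 0 \<Longrightarrow> sc \<epsilon> > 0"
  using C by (simp add: sc_def)

lemma sc_less: "0 < x \<Longrightarrow> x < y \<Longrightarrow> sc x < sc y"
  using C by (simp add: sc_def powr_less_mono2)

lemma sc_less_iff: "0 < x \<Longrightarrow> 0 < y \<Longrightarrow> sc x < sc y \<longleftrightarrow> x < y"
  using sc_less[of x y] sc_less[of y x] by (cases x y rule: linorder_cases) auto

lemma sc_eq_iff: "0 < x \<Longrightarrow> 0 < y \<Longrightarrow> sc x = sc y \<longleftrightarrow> x = y"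
  using sc_less[of x y] sc_less[of y x] by (cases x y rule: linorder_cases) auto

lemma sc_le_iff: "0 < x \<Longrightarrow> 0 < y \<Longrightarrow> sc x \<le> sc y \<longleftrightarrow> x \<le> y"
  using sc_less_iff[of y x] by linarith

lemma sc_shift: "\<epsilon> > 0 \<Longrightarrow> sc (l ^ 4 * \<epsilon>) = l * sc \<epsilon>"
proof -
  assume "\<epsilon> > 0"
  have "(l ^ 4) powr (1/4) = l"
    using l powr_powr[of l 4 "1/4"] by simp
  then show ?thesis using \<open>\<epsilon> > 0\<close> l by (simp add: sc_def powr_mult)
qed

lemma sc_onto: "y > 0 \<Longrightarrow> \<exists>\<epsilon>>0. sc \<epsilon> = y"
proof (intro exI conjI)
  assume "y > 0"
  then show "sc ((y / C) powr 4) = y" "(y / C) powr 4 > 0"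
    using C by (auto simp: sc_def powr_powr simp del: powr_numeral)
qed

lemma sc_lt_1: "0 < \<epsilon> \<Longrightarrow> \<epsilon> < \<epsilon>0 \<Longrightarrow> sc \<epsilon> < 1"
  using sc_less[of \<epsilon> \<epsilon>0] small by (simp add: sc_def)

lemma repr: "0 < \<epsilon> \<Longrightarrow> \<epsilon> < \<epsilon>0 \<Longrightarrow> 1 \<le> sc \<epsilon> * l ^ n \<Longrightarrow> sc \<epsilon> * l ^ n \<le> l \<Longrightarrow> h \<epsilon> = F (sc \<epsilon> * l ^ n)"
  using rep by (simp add: sc_def)

lemma level_exists:
  assumes "e > 0" "e \<le> b"
  shows "\<exists>n::nat. b \<le> e * l ^ n \<and> e * l ^ n < l * b"
proof -
  have "\<exists>n. b \<le> e * l ^ n"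
    using real_arch_pow[OF l, of "b / e"] assms by (auto simp: field_simps intro: less_imp_le)
  define n where "n = (LEAST n. b \<le> e * l ^ n)"
  have n: "b \<le> e * l ^ n" unfolding n_def by (rule LeastI_ex) fact
  have "e * l ^ n < l * b"
  proof (cases n)
    case 0
    then have "b < l * b" using assms l by simp
    moreover have "e * l ^ n = e" using 0 by simp
    ultimately show ?thesis using assms by linarith
  next
    case (Suc m)
    then have "\<not> b \<le> e * l ^ m" unfolding n_def using not_less_Least[of m "\<lambda>n. b \<le> e * l ^ n"] by simp
    then show ?thesis using Suc l by simp
  qed
  then show ?thesis using n by blast
qed

lemma level:
  assumes "0 < \<epsilon>" "\<epsilon> < \<epsilon>0"
  obtains n where "1 \<le> sc \<epsilon> * l ^ Suc n" "sc \<epsilon> * l ^ Suc n \<le> l"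
proof -
  obtain n where n: "1 \<le> sc \<epsilon> * l ^ n" "sc \<epsilon> * l ^ n < l * 1"
    using level_exists[of "sc \<epsilon>" 1] sc_pos sc_lt_1 assms by (auto intro: less_imp_le)
  moreover from n have "n \<noteq> 0" using sc_lt_1[OF assms] by (cases n) auto
  ultimately show ?thesis using that by (cases n) (auto simp del: power_Suc)
qed

lemma log_periodic: "log_periodic_on h (l ^ 4) \<epsilon>0"
  unfolding log_periodic_on_def
proof (intro allI impI)
  fix \<epsilon> assume e: "\<epsilon> > 0" "l ^ 4 * \<epsilon> < \<epsilon>0"
  have "\<epsilon> \<le> l ^ 4 * \<epsilon>" using e l by simp
  then have e': "\<epsilon> < \<epsilon>0" "l ^ 4 * \<epsilon> > 0" using e by linarith+
  obtain n where n: "1 \<le> sc (l ^ 4 * \<epsilon>) * l ^ Suc n" "sc (l ^ 4 * \<epsilon>) * l ^ Suc n \<le> l"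
    using level e e' by metis
  have eq: "sc (l ^ 4 * \<epsilon>) * l ^ Suc n = sc \<epsilon> * l ^ Suc (Suc n)"
    using sc_shift[OF e(1)] by simp
  show "h (l ^ 4 * \<epsilon>) = h \<epsilon>"
    using repr[OF e'(2) e(2) n] repr[OF e(1) e'(1), of "Suc (Suc n)", folded eq, OF n] by simp
qed

lemma period_bounds:
  assumes "I \<in> log_periods (l ^ 4) \<epsilon>0"
  obtains \<epsilon> where "\<epsilon> > 0" "l ^ 4 * \<epsilon> < \<epsilon>0" "I = {\<epsilon><..l ^ 4 * \<epsilon>}" "I \<subseteq> {0<..<\<epsilon>0}"
proof -
  obtain \<epsilon> where e: "\<epsilon> > 0" "l ^ 4 * \<epsilon> < \<epsilon>0" "I = {\<epsilon><..l ^ 4 * \<epsilon>}"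
    using assms unfolding log_periods_def by blast
  then show ?thesis using that by fastforce
qed

lemma period_subset:
  assumes "I \<in> log_periods (l ^ 4) \<epsilon>0"
  shows "I \<subseteq> {0<..<\<epsilon>0}"
  using period_bounds[OF assms] .

text \<open>A period covers a half-open interval \<open>(e, l e]\<close> of values of \<open>sc\<close>, which contains exactly one point of the
  geometric progression \<open>b l\<^sup>-\<^sup>n\<close>. These values are below \<open>1 \<le> b\<close>, so the exponent \<open>n\<close> is a natural number.\<close>

lemma period_phase_unique:
  assumes I: "I \<in> log_periods (l ^ 4) \<epsilon>0" and b: "1 \<le> b" "b < l"
  shows "\<exists>!x. x \<in> I \<and> (\<exists>n. sc x * l ^ n = b)"
proof -
  obtain \<epsilon> where e: "\<epsilon> > 0" "l ^ 4 * \<epsilon> < \<epsilon>0" and Ieq: "I = {\<epsilon><..l ^ 4 * \<epsilon>}" 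
    using period_bounds[OF I] by metis
  have inI: "x \<in> I \<longleftrightarrow> x > 0 \<and> sc \<epsilon> < sc x \<and> sc x \<le> l * sc \<epsilon>" for x
  proof (cases "x > 0")
    case True
    have "0 < l ^ 4 * \<epsilon>" using e l by simp
    then have "x \<le> l ^ 4 * \<epsilon> \<longleftrightarrow> sc x \<le> l * sc \<epsilon>"
      using sc_le_iff[OF True, of "l ^ 4 * \<epsilon>"] sc_shift[OF e(1)] by simp
    then show ?thesis using True sc_less_iff[OF e(1) True] by (simp add: Ieq)
  qed (use e Ieq in auto)
  have "sc \<epsilon> < 1" 
    by (rule sc_lt_1) (use e l in \<open>auto intro: le_less_trans[of _ "l ^ 4 * \<epsilon>"]\<close>)
  then have eb: "sc \<epsilon> < b" using b by simp
  obtain n where n: "b \<le> l * sc \<epsilon> * l ^ n" "l * sc \<epsilon> * l ^ n < l * b"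
  proof (cases "l * sc \<epsilon> \<le> b")
    case True
    then show ?thesis using that level_exists[of "l * sc \<epsilon>" b] sc_pos[OF e(1)] l by auto
  next
    case False
    then show ?thesis using that[of 0] eb l by auto
  qed
  obtain x where x: "x > 0" "sc x = b / l ^ n"
    using sc_onto[of "b / l ^ n"] b l by auto
  have xI: "x \<in> I" unfolding inI using x n l by (simp add: pos_less_divide_eq pos_divide_le_eq)
  show ?thesis
  proof (rule ex1I[of _ x])
    show "x \<in> I \<and> (\<exists>n. sc x * l ^ n = b)" using xI x l by (auto intro!: exI[of _ n])
    fix y assume y: "y \<in> I \<and> (\<exists>n. sc y * l ^ n = b)"
    then obtain m where m: "sc y = b / l ^ m" "y > 0" using l inI by (auto simp: field_simps)
    have *: "j \<le> i" if "b / l ^ i \<le> l * sc \<epsilon>" "sc \<epsilon> < b / l ^ j" for i j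
    proof (rule ccontr)
      assume "\<not> j \<le> i"
      then have "l ^ Suc i \<le> l ^ j" using l by (intro power_increasing) auto
      then have "b / l ^ j \<le> b / l ^ Suc i" using l b by (intro divide_left_mono) auto
      then have "l * (b / l ^ j) \<le> b / l ^ i" using l by (simp add: field_simps)
      moreover have "l * sc \<epsilon> < l * (b / l ^ j)"
        using that(2) l by (intro mult_strict_left_mono) auto
      ultimately show False using that(1) by linarith
    qed
    have "m = n" using *[of m n] *[of n m] y xI x m by (auto simp: inI intro: antisym)
    then show "y = x" using x m sc_eq_iff by metis
  qed
qed

lemma phase_level_unique:
  assumes "1 \<le> e * l ^ n" "e * l ^ n < l" "1 \<le> e * l ^ m" "e * l ^ m < l"
  shows "n = m"
proof -
  have *: "i \<le> j" if "1 \<le> e * l ^ j" "e * l ^ i < l" for i j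
  proof (rule ccontr)
    assume "\<not> i \<le> j"
    then have "l ^ Suc j \<le> l ^ i" using l by (intro power_increasing) auto
    moreover have "e > 0" using that(1) l by (smt (verit) mult_nonpos_nonneg zero_le_power)
    ultimately have "e * l ^ Suc j \<le> e * l ^ i" by simp
    moreover have "l * 1 \<le> l * (e * l ^ j)" using that(1) l by (intro mult_left_mono) auto
    ultimately show False using that(2) by (simp add: algebra_simps)
  qed
  show ?thesis using *[of n m] *[of m n] assms by auto
qed

lemma sc_deriv:
  assumes "y > 0"
  shows "(sc has_real_derivative sc y / (4 * y)) (at y)"
proof -
  have "y powr (1/4 - 1) = y powr (1/4) / y" using assms by (subst powr_diff) auto
  moreover have "((\<lambda>y. C * y powr (1/4)) has_real_derivative C * ((1/4) * y powr (1/4 - 1))) (at y)"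
    by (intro DERIV_cmult has_real_derivative_powr assms)
  ultimately show ?thesis by (simp add: sc_def[abs_def])
qed

lemma hyp_arc_sc_deriv:
  assumes "y > 0"
  shows "((\<lambda>y. hyp_arc V W (sc y * l ^ n)) has_real_derivative
     (V * (sc y * l ^ n) - W / (sc y * l ^ n)) / (8 * y)) (at y)"
proof -
  define t where "t = sc y * l ^ n"
  have t: "t > 0" using sc_pos[OF assms] l by (simp add: t_def)
  have "(hyp_arc V W has_real_derivative (V - W / t\<^sup>2) / 2) (at t)"
    unfolding hyp_arc_def[abs_def] using t
    by (auto intro!: derivative_eq_intros simp: power2_eq_square)
  then have "((\<lambda>y. hyp_arc V W (sc y * l ^ n)) has_real_derivative
      (V - W / t\<^sup>2) / 2 * (sc y / (4 * y) * l ^ n)) (at y)"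
    unfolding t_def by (intro DERIV_chain2[where f = "hyp_arc V W"] DERIV_cmult_right sc_deriv assms)
  moreover have "(V - W / t\<^sup>2) / 2 * (sc y / (4 * y) * l ^ n) = (V - W / t\<^sup>2) / 2 * (t / (4 * y))"
    by (simp add: t_def)
  moreover have "\<dots> = (V * t - W / t) / (8 * y)"
    using t assms by (simp add: field_simps power2_eq_square)
  ultimately show ?thesis by (simp only: t_def)
qed

lemma isCont_sc: "y > 0 \<Longrightarrow> isCont sc y"
  using sc_deriv DERIV_isCont by blast

lemma isCont_hyp_arc_sc_deriv:
  assumes "y > 0"
  shows "isCont (\<lambda>y. (V * (sc y * l ^ n) - W / (sc y * l ^ n)) / (8 * y)) y"
  using assms sc_pos[OF assms] l by (intro continuous_intros isCont_sc) auto

lemma eventually_phase_between: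
  assumes "\<epsilon> > 0" "\<alpha> < sc \<epsilon> * l ^ n" "sc \<epsilon> * l ^ n < \<gamma>" "\<epsilon> < \<epsilon>0"
  shows "\<forall>\<^sub>F y in nhds \<epsilon>. 0 < y \<and> y < \<epsilon>0 \<and> \<alpha> < sc y * l ^ n \<and> sc y * l ^ n < \<gamma>"
proof -
  have "isCont (\<lambda>y. sc y * l ^ n) \<epsilon>" by (intro continuous_intros isCont_sc assms)
  then have lim: "((\<lambda>y. sc y * l ^ n) \<longlongrightarrow> sc \<epsilon> * l ^ n) (nhds \<epsilon>)"
    unfolding isCont_def tendsto_at_iff_tendsto_nhds[of "\<lambda>y. sc y * l ^ n"] .
  show ?thesis
    using order_tendstoD[OF lim] order_tendstoD[OF tendsto_ident_at[of \<epsilon> UNIV, folded tendsto_at_iff_tendsto_nhds[of "\<lambda>x. x"]]]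
      eventually_nhds_in_open[of "{0<..<\<epsilon>0}" \<epsilon>] assms
    by (auto simp: eventually_conj_iff)
qed

text \<open>The values of the two pieces agree at the crossing. If their derivatives agreed as well, both \<open>V t + W / t\<close>
  and \<open>V t - W / t\<close> would be the same for the two pieces, hence also \<open>V\<close>.\<close>

lemma corner_at_phase:
  assumes e: "0 < \<epsilon>" "\<epsilon> < \<epsilon>0" and b: "sc \<epsilon> * l ^ n = \<beta>"
    and ord: "1 \<le> \<alpha>" "\<alpha> < \<beta>" "\<beta> < \<gamma>" "\<gamma> \<le> l"
    and F1: "\<And>t. \<alpha> < t \<Longrightarrow> t < \<beta> \<Longrightarrow> F t = hyp_arc V1 W1 t"
    and F2: "\<And>t. \<beta> < t \<Longrightarrow> t < \<gamma> \<Longrightarrow> F t = hyp_arc V2 W2 t"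
    and cross: "V1 * \<beta>\<^sup>2 + W1 = V2 * \<beta>\<^sup>2 + W2" and ne: "V1 \<noteq> V2"
  shows "corner h \<epsilon>"
proof -
  have ln: "l ^ n > 0" using l by simp
  have ev: "\<forall>\<^sub>F y in nhds \<epsilon>. 0 < y \<and> y < \<epsilon>0 \<and> \<alpha> < sc y * l ^ n \<and> sc y * l ^ n < \<gamma>"
    by (rule eventually_phase_between) (use assms in auto)
  have lt: "sc y * l ^ n < \<beta>" if "0 < y" "y < \<epsilon>" for y
    using sc_less[OF that] ln unfolding b[symmetric] by simp
  have gt: "\<beta> < sc y * l ^ n" if "\<epsilon> < y" for y
    using sc_less[OF e(1) that] ln unfolding b[symmetric] by simp
  have hF: "h y = F (sc y * l ^ n)"
    if "0 < y \<and> y < \<epsilon>0 \<and> \<alpha> < sc y * l ^ n \<and> sc y * l ^ n < \<gamma>" for y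
    using that ord by (intro repr) auto
  have eL: "\<forall>\<^sub>F y in at_left \<epsilon>. h y = hyp_arc V1 W1 (sc y * l ^ n)"
    unfolding eventually_at_filter using ev by eventually_elim (use hF F1 lt in auto)
  have eR: "\<forall>\<^sub>F y in at_right \<epsilon>. h y = hyp_arc V2 W2 (sc y * l ^ n)"
    unfolding eventually_at_filter using ev by eventually_elim (use hF F2 gt in auto)
  have "V1 * \<beta> - W1 / \<beta> \<noteq> V2 * \<beta> - W2 / \<beta>"
  proof
    have "\<beta> > 0" using ord by simp
    assume "V1 * \<beta> - W1 / \<beta> = V2 * \<beta> - W2 / \<beta>"
    then have "V1 * \<beta>\<^sup>2 - W1 = V2 * \<beta>\<^sup>2 - W2" using \<open>\<beta> > 0\<close> by (simp add: field_simps power2_eq_square)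
    then have "V1 * \<beta>\<^sup>2 = V2 * \<beta>\<^sup>2" using cross by linarith
    then show False using ne \<open>\<beta> > 0\<close> by simp
  qed
  then show ?thesis
    by (intro cornerI[OF eL eR hyp_arc_sc_deriv hyp_arc_sc_deriv isCont_hyp_arc_sc_deriv[OF e(1)] isCont_hyp_arc_sc_deriv[OF e(1)] _ e(1)])
       (use e b in auto)
qed

lemma no_corner_inside_arc:
  assumes e: "0 < \<epsilon>" "\<epsilon> < \<epsilon>0" and ord: "\<alpha> < sc \<epsilon> * l ^ n" "sc \<epsilon> * l ^ n < \<gamma>"
    and eq: "\<And>y. 0 < y \<Longrightarrow> y < \<epsilon>0 \<Longrightarrow> \<alpha> < sc y * l ^ n \<Longrightarrow> sc y * l ^ n < \<gamma> \<Longrightarrow> h y = hyp_arc V W (sc y * l ^ n)"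
  shows "\<not> corner h \<epsilon>"
proof (rule not_cornerI[OF _ hyp_arc_sc_deriv isCont_hyp_arc_sc_deriv[OF e(1)] e(1)])
  show "\<forall>\<^sub>F y in nhds \<epsilon>. h y = hyp_arc V W (sc y * l ^ n)"
    using eventually_phase_between[OF e(1) ord e(2)] by eventually_elim (use eq in auto)
qed

text \<open>Different phases in the open window cannot belong to the same \<open>\<epsilon>\<close>, so every phase contributes its own corner.\<close>

lemma corners_per_period:
  assumes I: "I \<in> log_periods (l ^ 4) \<epsilon>0" and B: "finite B" "B \<subseteq> {1<..<l}"
    and corner: "\<And>\<beta> \<epsilon> n. \<beta> \<in> B \<Longrightarrow> 0 < \<epsilon> \<Longrightarrow> \<epsilon> < \<epsilon>0 \<Longrightarrow> sc \<epsilon> * l ^ n = \<beta> \<Longrightarrow> corner h \<epsilon>"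
  shows "\<exists>C\<subseteq>{\<epsilon>\<in>I. corner h \<epsilon>}. card C = card B"
proof -
  have I0: "I \<subseteq> {0<..<\<epsilon>0}" by (rule period_subset[OF I])
  have "\<forall>\<beta>\<in>B. \<exists>x. x \<in> I \<and> (\<exists>n. sc x * l ^ n = \<beta>)"
    using period_phase_unique[OF I] B by (meson greaterThanLessThan_iff less_imp_le subsetD)
  then obtain x where x: "\<And>\<beta>. \<beta> \<in> B \<Longrightarrow> x \<beta> \<in> I \<and> (\<exists>n. sc (x \<beta>) * l ^ n = \<beta>)" by metis
  have "inj_on x B"
  proof (rule inj_onI)
    fix \<beta> \<beta>' assume *: "\<beta> \<in> B" "\<beta>' \<in> B" "x \<beta> = x \<beta>'"
    obtain n m where nm: "sc (x \<beta>) * l ^ n = \<beta>" "sc (x \<beta>) * l ^ m = \<beta>'" using x * by metis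
    have "1 < \<beta>" "\<beta> < l" "1 < \<beta>'" "\<beta>' < l" using * B(2) by auto
    then have "n = m" by (intro phase_level_unique[of "sc (x \<beta>)"]) (use nm in auto)
    then show "\<beta> = \<beta>'" using nm by simp
  qed
  then have "card (x ` B) = card B" by (rule card_image)
  moreover have "corner h (x \<beta>)" if "\<beta> \<in> B" for \<beta>
    using x[OF that] corner[OF that] I0 by auto
  then have "x ` B \<subseteq> {\<epsilon>\<in>I. corner h \<epsilon>}" using x by auto
  ultimately show ?thesis by blast
qed

lemma phase_in_period:
  assumes I: "I \<in> log_periods (l ^ 4) \<epsilon>0" and x: "x \<in> I"
  shows "\<exists>t. 1 \<le> t \<and> t \<le> l \<and> h x = F t"
proof -
  have x0: "0 < x" "x < \<epsilon>0" using period_subset[OF I] x by auto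
  obtain n where "1 \<le> sc x * l ^ Suc n" "sc x * l ^ Suc n \<le> l" using level[OF x0] by blast
  then show ?thesis using repr[OF x0] by blast
qed

lemma value_at_phase:
  assumes I: "I \<in> log_periods (l ^ 4) \<epsilon>0" and b: "1 \<le> b" "b < l"
  shows "F b \<in> h ` I"
proof -
  obtain x n where x: "x \<in> I" "sc x * l ^ n = b" using period_phase_unique[OF I b] by blast
  have "0 < x" "x < \<epsilon>0" using period_subset[OF I] x by auto
  then have "h x = F b" using repr[of x n] x b by simp
  then show ?thesis using x by (metis imageI)
qed

lemma maximum_at_phase:
  assumes I: "I \<in> log_periods (l ^ 4) \<epsilon>0" and b: "1 \<le> b" "b < l"
    and le: "\<And>t. 1 \<le> t \<Longrightarrow> t \<le> l \<Longrightarrow> F t \<le> F b"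
  shows "maximum_on h I (F b)"
  unfolding maximum_on_def
proof (intro conjI ballI)
  show "F b \<in> h ` I" by (rule value_at_phase[OF I b])
  show "h x \<le> F b" if "x \<in> I" for x using phase_in_period[OF I that] le by auto
qed

lemma minimum_at_phase:
  assumes I: "I \<in> log_periods (l ^ 4) \<epsilon>0" and b: "1 \<le> b" "b < l"
    and le: "\<And>t. 1 \<le> t \<Longrightarrow> t \<le> l \<Longrightarrow> F b \<le> F t"
  shows "minimum_on h I (F b)"
  unfolding minimum_on_def
proof (intro conjI ballI)
  show "F b \<in> h ` I" by (rule value_at_phase[OF I b])
  show "F b \<le> h x" if "x \<in> I" for x using phase_in_period[OF I that] le by auto
qed

end

context log_scaling
begin

text \<open>The window \<open>[1, l]\<close> is cut at \<open>\<surd>l\<close>. The end points of the window are not corners: the piece to the right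
  of \<open>\<surd>l\<close> and the piece to the left of \<open>\<surd>l\<close> one level below are the same function of \<open>\<epsilon>\<close>.\<close>

lemma metallic_corners:
  assumes F: "\<And>t. 1 \<le> t \<Longrightarrow> t \<le> l \<Longrightarrow> F t = (if t \<le> sqrt l then hyp_arc 1 1 t else hyp_arc (1 / l) l t)"
    and e: "0 < \<epsilon>" "\<epsilon> < \<epsilon>0"
  shows "corner h \<epsilon> \<longleftrightarrow> (\<exists>n. sc \<epsilon> * l ^ n = sqrt l)"
proof
  note sq = sqrt_bounds[OF l]
  have smooth: "\<not> corner h \<epsilon>" if t: "1 / sqrt l < sc \<epsilon> * l ^ n" "sc \<epsilon> * l ^ n < sqrt l" for n
  proof (rule no_corner_inside_arc[OF e t])
    fix y assume y: "0 < y" "y < \<epsilon>0" and ty: "1 / sqrt l < sc y * l ^ n" "sc y * l ^ n < sqrt l"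
    show "h y = hyp_arc 1 1 (sc y * l ^ n)"
    proof (cases "1 \<le> sc y * l ^ n")
      case True
      then show ?thesis using repr[OF y True] F[of "sc y * l ^ n"] sq ty by auto
    next
      case False
      have "l * (1 / sqrt l) < l * (sc y * l ^ n)" using ty l by (intro mult_strict_left_mono) auto
      then have gt: "sqrt l < l * (sc y * l ^ n)" using l by (simp add: real_div_sqrt)
      have "l * (sc y * l ^ n) \<le> l * 1" using False l by (intro mult_left_mono) auto
      moreover have eq: "sc y * l ^ Suc n = l * (sc y * l ^ n)" by simp
      ultimately have "h y = hyp_arc (1 / l) l (l * (sc y * l ^ n))"
        using repr[OF y, of "Suc n"] F[of "l * (sc y * l ^ n)"] gt sq unfolding eq by auto
      then show ?thesis using l by (simp add: hyp_arc_def)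
    qed
  qed
  assume c: "corner h \<epsilon>"
  obtain n where n: "1 \<le> sc \<epsilon> * l ^ Suc n" "sc \<epsilon> * l ^ Suc n \<le> l" using level[OF e] by blast
  show "\<exists>n. sc \<epsilon> * l ^ n = sqrt l"
  proof (rule ccontr)
    assume none: "\<nexists>n. sc \<epsilon> * l ^ n = sqrt l"
    then consider "sc \<epsilon> * l ^ Suc n < sqrt l" | "sc \<epsilon> * l ^ Suc n > sqrt l" by (meson linorder_neqE)
    then show False
    proof cases
      case 1
      have "1 / sqrt l < 1" using sq by simp
      then have "1 / sqrt l < sc \<epsilon> * l ^ Suc n" using n(1) by linarith
      then show False using smooth[of "Suc n"] 1 c by simp
    next
      case 2
      then have "sqrt l / l < sc \<epsilon> * l ^ n" using l by (simp add: field_simps)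
      then have "1 / sqrt l < sc \<epsilon> * l ^ n" using l by (simp add: sqrt_divide_self_eq inverse_eq_divide)
      moreover have "sc \<epsilon> * l ^ n \<le> 1" using n(2) l by simp
      ultimately show False using smooth[of n] sq c by simp
    qed
  qed
next
  note sq = sqrt_bounds[OF l]
  assume "\<exists>n. sc \<epsilon> * l ^ n = sqrt l"
  then obtain n where n: "sc \<epsilon> * l ^ n = sqrt l" by blast
  show "corner h \<epsilon>"
  proof (rule corner_at_phase[OF e n])
    show "F t = hyp_arc 1 1 t" if "1 < t" "t < sqrt l" for t
      using F[of t] that sq by simp
    show "F t = hyp_arc (1 / l) l t" if "sqrt l < t" "t < l" for t
    proof -
      have "1 \<le> t" using that sq by linarith
      then show ?thesis using F[of t] that by simp
    qed
  qed (use sq l in auto)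
qed

lemma metallic_profile:
  assumes F: "\<And>t. 1 \<le> t \<Longrightarrow> t \<le> l \<Longrightarrow> F t = (if t \<le> sqrt l then hyp_arc 1 1 t else hyp_arc (1 / l) l t)"
  shows "(\<forall>I\<in>log_periods (l ^ 4) \<epsilon>0. \<exists>\<epsilon>c. {\<epsilon>\<in>I. corner h \<epsilon>} = {\<epsilon>c} \<and> h \<epsilon>c = J1 l \<and> maximum_on h I (J1 l)) \<and>
    (\<forall>x y. 0 < x \<and> x < y \<and> y < \<epsilon>0 \<and> corner h x \<and> corner h y \<and> \<not> (\<exists>w\<in>{x<..<y}. corner h w) \<longrightarrow> ln y - ln x = 4 * ln l)"
proof -
  have mc: "corner h \<epsilon> \<longleftrightarrow> (\<exists>n. sc \<epsilon> * l ^ n = sqrt l)" if "0 < \<epsilon>" "\<epsilon> < \<epsilon>0" for \<epsilon>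
    by (rule metallic_corners[OF _ that]) (rule F)
  show ?thesis
  proof (intro conjI ballI allI impI)
    note sq = sqrt_bounds[OF l]
    have FJ: "F (sqrt l) = J1 l" using F[of "sqrt l"] sq by (simp add: J1_eq)
    fix I assume I: "I \<in> log_periods (l ^ 4) \<epsilon>0"
    obtain x where x: "x \<in> I" "\<exists>n. sc x * l ^ n = sqrt l"
        and uniq: "\<And>y. y \<in> I \<Longrightarrow> \<exists>n. sc y * l ^ n = sqrt l \<Longrightarrow> y = x"
      using period_phase_unique[OF I, of "sqrt l"] sq by auto
    have "{\<epsilon>\<in>I. corner h \<epsilon>} = {x}"
    proof -
      have "corner h y \<longleftrightarrow> y = x" if "y \<in> I" for y
      proof -
        have y: "0 < y" "y < \<epsilon>0" using period_subset[OF I] that by auto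
        show ?thesis using mc[OF y] uniq[OF that] x(2) by blast
      qed
      then show ?thesis using x(1) by auto
    qed
    moreover have "h x = J1 l"
    proof -
      obtain n where "sc x * l ^ n = sqrt l" using x by blast
      then show ?thesis using repr[of x n] x period_subset[OF I] sq FJ by auto
    qed
    moreover have "maximum_on h I (F (sqrt l))"
    proof (rule maximum_at_phase[OF I])
      fix t assume t: "1 \<le> t" "t \<le> l"
      show "F t \<le> F (sqrt l)"
      proof (cases "t \<le> sqrt l")
        case True
        have "1 * 1 \<le> t * sqrt l" using t sq by (intro mult_mono) auto
        then show ?thesis unfolding FJ using True F t by (auto simp: J1_eq intro!: hyp_arc_increasing)
      next
        case False
        have "sqrt l * t \<le> l * l" using t sq by (intro mult_mono) auto
        then have "1 / l * (sqrt l * t) \<le> l" using l by (simp add: field_simps)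
        then have "hyp_arc (1 / l) l t \<le> hyp_arc (1 / l) l (sqrt l)"
          using False l by (intro hyp_arc_decreasing) auto
        then show ?thesis unfolding FJ J1_eq'[OF l] using False F[OF t] by simp
      qed
    qed (use sq in auto)
    ultimately show "\<exists>\<epsilon>c. {\<epsilon>\<in>I. corner h \<epsilon>} = {\<epsilon>c} \<and> h \<epsilon>c = J1 l \<and> maximum_on h I (J1 l)" using FJ by auto
  next
    fix x y assume *: "0 < x \<and> x < y \<and> y < \<epsilon>0 \<and> corner h x \<and> corner h y \<and> \<not> (\<exists>w\<in>{x<..<y}. corner h w)"
    then have pos: "0 < x" "x < \<epsilon>0" "0 < y" "y < \<epsilon>0" by auto
    obtain i j where i: "sc x * l ^ i = sqrt l" and j: "sc y * l ^ j = sqrt l"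
      using * mc[OF pos(1,2)] mc[OF pos(3,4)] by blast
    have "j < i"
    proof (rule ccontr)
      assume "\<not> j < i"
      then have "l ^ i \<le> l ^ j" using l by (intro power_increasing) auto
      then have "sc x * l ^ i \<le> sc x * l ^ j" using sc_pos[OF pos(1)] by simp
      also have "\<dots> < sc y * l ^ j" using sc_less[of x y] * l by simp
      finally show False using i j by simp
    qed
    then obtain i' where i': "i = Suc i'" "j \<le> i'" by (cases i) auto
    define w where "w = l ^ 4 * x"
    have w: "w > 0" "x < w" using pos l by (auto simp: w_def)
    have sw: "sc w * l ^ i' = sqrt l" using i sc_shift[OF pos(1)] by (simp add: w_def i' mult_ac)
    have "w \<le> y"
    proof -
      have "sc w * l ^ i' = sc y * l ^ j" using sw j by simp
      also have "\<dots> \<le> sc y * l ^ i'" using i'(2) l sc_pos[OF pos(3)] by (simp add: power_increasing)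
      finally have "sc w \<le> sc y" using l by simp
      then show ?thesis using sc_le_iff w pos by simp
    qed
    moreover have "\<not> w < y"
    proof
      assume "w < y"
      then have "corner h w" using mc[OF w(1)] sw pos by auto
      then show False using * w \<open>w < y\<close> by auto
    qed
    ultimately have "y = l ^ 4 * x" by (simp add: w_def)
    then show "ln y - ln x = 4 * ln l" using pos l by (simp add: ln_mult ln_realpow)
  qed
qed

text \<open>The profile is symmetric under \<open>t \<mapsto> l / t\<close>, decreasing on \<open>[1, \<surd>l]\<close> and increasing on \<open>[\<surd>l, l]\<close>. So its minimum
  is the value \<open>J1 l\<close> at \<open>\<surd>l\<close> and its maximum is the value \<open>(l - 1 / l) / 2\<close> at the ends. The three corners
  used here are the breakpoints inside the window.\<close>

lemma golden_colored_profile: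
  fixes b1 c d :: real
  assumes l3: "l > 3" and c: "c = 1 - 1 / l" and d: "d = l - 1" and b1: "b1 = sqrt (l / (l - 2))"
    and F: "\<And>t. 1 \<le> t \<Longrightarrow> t \<le> l \<Longrightarrow> F t = (if t \<le> b1 then hyp_arc c d t
        else if t \<le> sqrt l then hyp_arc (1 / l) l t else if t \<le> l / b1 then hyp_arc 1 1 t else hyp_arc c d t)"
    and I: "I \<in> log_periods (l ^ 4) \<epsilon>0"
  shows "(\<exists>C \<subseteq> {\<epsilon>\<in>I. corner h \<epsilon>}. card C = 3) \<and>
             minimum_on h I (J1 l) \<and> (\<exists>M. maximum_on h I M \<and> M < J2 l)"
proof -
  note sq = sqrt_bounds[OF l]
  have s0: "1 < l / (l - 2)" "l / (l - 2) < l" using l3 by (auto simp: field_simps)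
  have b1sq: "b1 * b1 = l / (l - 2)" "b1\<^sup>2 = l / (l - 2)" using l3 by (simp_all add: b1)
  have b1lt: "1 < b1" "b1 < sqrt l" using s0 by (simp_all add: b1)
  have ll: "sqrt l * sqrt l = l" using l by simp
  have b3: "sqrt l < l / b1" "l / b1 < l"
  proof -
    have "sqrt l * b1 < sqrt l * sqrt l" using b1lt l by (intro mult_strict_left_mono) auto
    then show "sqrt l < l / b1" using b1lt ll by (simp add: field_simps)
    show "l / b1 < l" using b1lt l by (simp add: field_simps)
  qed
  have b3sq: "(l / b1)\<^sup>2 = l * (l - 2)" using b1sq l3 by (simp add: power_divide power2_eq_square)
  have cl: "c * l = d" using l by (simp add: c d field_simps)
  have cpos: "c > 0" using l by (simp add: c)
  have cross1: "c * b1\<^sup>2 + d = 1 / l * b1\<^sup>2 + l" unfolding b1sq c d using l3 by (simp add: field_simps)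
  have cross3: "1 * (l / b1)\<^sup>2 + 1 = c * (l / b1)\<^sup>2 + d" unfolding b3sq c d using l3 by (simp add: field_simps)
  have ne: "c \<noteq> 1 / l" "1 / l \<noteq> 1" "1 \<noteq> c" using l3 by (auto simp: c field_simps)
  have eq1: "hyp_arc c d b1 = hyp_arc (1 / l) l b1" using cross1 b1lt by (subst hyp_arc_eq_iff) auto
  have eq3: "hyp_arc 1 1 (l / b1) = hyp_arc c d (l / b1)" using cross3 b1lt l by (subst hyp_arc_eq_iff) auto
  have eq2: "hyp_arc (1 / l) l (sqrt l) = J1 l" using J1_eq' l by simp
  have eq4: "hyp_arc c d l = hyp_arc c d 1" using hyp_arc_reflect[of 1 l c d] l by (simp flip: cl)
  have lp: "l > 0" "b1 > 0" "sqrt l > 0" using l b1lt by auto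
  have pr: "x * y \<le> l" if "0 \<le> x" "0 \<le> y" "x \<le> sqrt l" "y \<le> sqrt l" for x y
    using mult_mono[OF that(3,4)] that ll lp by simp
  have pr': "l \<le> x * y" if "sqrt l \<le> x" "sqrt l \<le> y" for x y
    using mult_mono[OF that] that lp ll by simp
  have dec: "hyp_arc c d t' \<le> hyp_arc c d t" if "1 \<le> t" "t \<le> t'" "t' \<le> b1" for t t'
    using that pr[of t t'] b1lt cpos cl by (intro hyp_arc_decreasing) (auto intro!: order_trans[OF mult_left_mono[of "t * t'" l c]])
  have inc: "hyp_arc c d t \<le> hyp_arc c d t'" if "l / b1 \<le> t" "t \<le> t'" for t t'
  proof (rule hyp_arc_increasing)
    show "0 < t" using that(1) b3(1) lp(3) by linarith
    have "c * l \<le> c * (t * t')" using that b3(1) cpos by (intro mult_left_mono pr') auto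
    then show "d \<le> c * (t * t')" using cl by simp
  qed (rule that)
  have dec2: "hyp_arc (1 / l) l t' \<le> hyp_arc (1 / l) l t" if "1 \<le> t" "t \<le> t'" "t' \<le> sqrt l" for t t'
  proof (rule hyp_arc_decreasing)
    have "t * t' \<le> l" using pr[of t t'] that by auto
    also have "l * 1 \<le> l * l" using l by (intro mult_left_mono) auto
    finally show "1 / l * (t * t') \<le> l" using l by (simp add: field_simps)
  qed (use that in auto)
  have inc2: "hyp_arc 1 1 t \<le> hyp_arc 1 1 t'" if "sqrt l \<le> t" "t \<le> t'" for t t'
  proof (rule hyp_arc_increasing)
    show "0 < t" using that(1) lp(3) by linarith
    show "1 \<le> 1 * (t * t')" using that pr'[of t t'] l by simp
  qed (rule that)
  have F1: "F 1 = hyp_arc c d 1" using F[of 1] b1lt l by simp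
  have FJ: "F (sqrt l) = J1 l" using F[of "sqrt l"] b1lt sq eq2 by simp
  have bounds: "J1 l \<le> F t \<and> F t \<le> F 1" if t: "1 \<le> t" "t \<le> l" for t
  proof -
    have J1_b1: "J1 l \<le> hyp_arc c d b1" "J1 l \<le> hyp_arc c d (l / b1)"
      using dec2[of b1 "sqrt l"] inc2[of "sqrt l" "l / b1"] b1lt b3 eq1 eq2 eq3 by (simp_all add: J1_eq)
    have b1_1: "hyp_arc c d b1 \<le> hyp_arc c d 1" "hyp_arc c d (l / b1) \<le> hyp_arc c d 1"
      using dec[of 1 b1] inc[of "l / b1" l] eq4 b1lt b3 by simp_all
    consider "t \<le> b1" | "b1 < t" "t \<le> sqrt l" | "sqrt l < t" "t \<le> l / b1" | "l / b1 < t" by linarith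
    then show ?thesis
    proof cases
      case 1
      then have "F t = hyp_arc c d t" using F t by simp
      then show ?thesis using dec[of t b1] dec[of 1 t] 1 t J1_b1 F1 by simp
    next
      case 2
      then have "F t = hyp_arc (1 / l) l t" using F t by simp
      then show ?thesis using dec2[of b1 t] dec2[of t "sqrt l"] 2 t b1_1 F1 eq1 eq2 b1lt by simp
    next
      case 3
      then have "F t = hyp_arc 1 1 t" using F t b1lt by simp
      then show ?thesis using inc2[of "sqrt l" t] inc2[of t "l / b1"] 3 t b1_1 F1 eq3 by (simp add: J1_eq)
    next
      case 4
      then have "F t = hyp_arc c d t" using F t b1lt b3 by simp
      then show ?thesis using inc[of "l / b1" t] inc[of t l] 4 t J1_b1 F1 eq4 by simp
    qed
  qed
  have corners: "corner h \<epsilon>" if e: "0 < \<epsilon>" "\<epsilon> < \<epsilon>0" and n: "sc \<epsilon> * l ^ n = \<beta>" and \<beta>: "\<beta> \<in> {b1, sqrt l, l / b1}" for \<beta> \<epsilon> n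
  proof -
    consider "\<beta> = b1" | "\<beta> = sqrt l" | "\<beta> = l / b1" using \<beta> by blast
    then show ?thesis
    proof cases
      case 1
      show ?thesis
        by (rule corner_at_phase[OF e n, of 1 "sqrt l" c d "1 / l" l]) (use 1 b1lt sq cross1 ne F in auto)
    next
      case 2
      show ?thesis
        by (rule corner_at_phase[OF e n, of b1 "l / b1" "1 / l" l 1 1]) (use 2 b1lt b3 lp ne F in auto)
    next
      case 3
      show ?thesis
        by (rule corner_at_phase[OF e n, of "sqrt l" l 1 1 c d]) (use 3 b1lt b3 sq cross3 ne F in auto)
    qed
  qed
  have "\<exists>C\<subseteq>{\<epsilon>\<in>I. corner h \<epsilon>}. card C = card {b1, sqrt l, l / b1}"
    by (rule corners_per_period[OF I]) (use b1lt b3 sq corners in auto)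
  moreover have "card {b1, sqrt l, l / b1} = 3" using b1lt b3 by simp
  moreover have "minimum_on h I (F (sqrt l))"
    by (rule minimum_at_phase[OF I]) (use sq bounds FJ in auto)
  moreover have "maximum_on h I (F 1)"
    by (rule maximum_at_phase[OF I]) (use l bounds in auto)
  moreover have "F 1 < J2 l"
  proof -
    have "F 1 = (l - 1 / l) / 2" by (simp add: F1 hyp_arc_def c d)
    moreover have "1 / l > 0" using l by simp
    ultimately show ?thesis unfolding J2_def by argo
  qed
  ultimately show ?thesis using FJ by metis
qed

text \<open>The middle piece is convex in \<open>ln t\<close> and symmetric about \<open>\<surd>l\<close>, and the outer pieces increase towards the
  breakpoints. Hence the maximum is attained at both breakpoints, and it is smaller than \<open>J1 l\<close> because the
  first piece would reach that value only at \<open>\<surd>l\<close>.\<close>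

lemma metallic_colored_profile:
  fixes b1 c d :: real
  assumes c: "0 < c" "c \<le> 1/2" and d: "d = l * c" "c + d > 2" "2 * d < l + 1" and b1: "b1 = sqrt ((d - 1) / (1 - c))"
    and F: "\<And>t. 1 \<le> t \<Longrightarrow> t \<le> l \<Longrightarrow> F t = (if t \<le> b1 then hyp_arc 1 1 t
        else if t \<le> l / b1 then hyp_arc c d t else hyp_arc (1 / l) l t)"
    and I: "I \<in> log_periods (l ^ 4) \<epsilon>0"
  shows "(\<exists>C \<subseteq> {\<epsilon>\<in>I. corner h \<epsilon>}. card C = 2) \<and> (\<exists>M. maximum_on h I M \<and> M < J1 l)"
proof -
  note sq = sqrt_bounds[OF l]
  define s1 where "s1 = (d - 1) / (1 - c)"
  have s1: "1 < s1" "s1 < l" using c d by (auto simp: s1_def field_simps)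
  have b1sq: "b1 * b1 = s1" "b1\<^sup>2 = s1" using s1 unfolding b1 s1_def[symmetric] by simp_all
  have b1lt: "1 < b1" "b1 < sqrt l" using s1 unfolding b1 s1_def[symmetric] by simp_all
  have ll: "sqrt l * sqrt l = l" using l by simp
  have b2: "sqrt l < l / b1" "l / b1 < l"
  proof -
    have "sqrt l * b1 < sqrt l * sqrt l" using b1lt l by (intro mult_strict_left_mono) auto
    then show "sqrt l < l / b1" using b1lt ll by (simp add: field_simps)
    show "l / b1 < l" using b1lt l by (simp add: field_simps)
  qed
  have lp: "l > 0" "b1 > 0" "sqrt l > 0" using l b1lt by auto
  have eq: "s1 + 1 = c * s1 + d" using c by (simp add: s1_def field_simps)
  have cross1: "1 * b1\<^sup>2 + 1 = c * b1\<^sup>2 + d" unfolding b1sq using eq by simp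
  have eq1: "hyp_arc 1 1 b1 = hyp_arc c d b1" using cross1 lp by (subst hyp_arc_eq_iff) auto
  have eq2: "hyp_arc c d (l / b1) = hyp_arc c d b1" using hyp_arc_reflect[of b1 l c d] lp d by (simp add: mult.commute)
  have eq3: "hyp_arc (1 / l) l (l / b1) = hyp_arc 1 1 b1" using hyp_arc_reflect[of b1 l "1 / l" l] lp by simp
  have cross2: "c * (l / b1)\<^sup>2 + d = 1 / l * (l / b1)\<^sup>2 + l"
    using eq1 eq2 eq3 lp by (subst hyp_arc_eq_iff[symmetric]) auto
  have ne: "1 \<noteq> c" "c \<noteq> 1 / l"
  proof -
    show "1 \<noteq> c" using c by auto
    show "c \<noteq> 1 / l"
    proof
      assume "c = 1 / l"
      then have "d = 1" using d(1) lp by simp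
      then show False using c(2) d(2) by linarith
    qed
  qed
  have Fb: "F b1 = hyp_arc 1 1 b1" using F[of b1] b1lt sq by simp
  have le: "F t \<le> F b1" if t: "1 \<le> t" "t \<le> l" for t
  proof -
    consider "t \<le> b1" | "b1 < t" "t \<le> sqrt l" | "sqrt l < t" "t \<le> l / b1" | "l / b1 < t" by linarith
    then show ?thesis
    proof cases
      case 1
      have "1 * 1 \<le> t * b1" using t b1lt by (intro mult_mono) auto
      then show ?thesis using F t 1 Fb by (auto intro!: hyp_arc_increasing)
    next
      case 2
      then have "F t = hyp_arc c d t" using F t b2 by simp
      moreover have "b1 * t \<le> sqrt l * sqrt l" using 2 b1lt lp by (intro mult_mono) auto
      then have "c * (b1 * t) \<le> c * l" unfolding ll using c by (intro mult_left_mono) auto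
      then have "hyp_arc c d t \<le> hyp_arc c d b1" using 2 lp d by (intro hyp_arc_decreasing) (auto simp: mult.commute)
      ultimately show ?thesis using Fb eq1 by simp
    next
      case 3
      then have "F t = hyp_arc c d t" using F t b1lt by simp
      moreover have "sqrt l * sqrt l \<le> t * (l / b1)" using 3 b2 lp t by (intro mult_mono) auto
      then have "c * l \<le> c * (t * (l / b1))" unfolding ll using c by (intro mult_left_mono) auto
      then have "hyp_arc c d t \<le> hyp_arc c d (l / b1)" using 3 lp d t by (intro hyp_arc_increasing) (auto simp: mult.commute)
      ultimately show ?thesis using Fb eq1 eq2 by simp
    next
      case 4
      then have "F t = hyp_arc (1 / l) l t" using F t b1lt b2 by simp
      moreover have "l / b1 * t \<le> l * l" using t b2 lp by (intro mult_mono) auto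
      then have "hyp_arc (1 / l) l t \<le> hyp_arc (1 / l) l (l / b1)"
        using 4 lp by (intro hyp_arc_decreasing) (auto simp: field_simps)
      ultimately show ?thesis using Fb eq3 by simp
    qed
  qed
  have corners: "corner h \<epsilon>" if e: "0 < \<epsilon>" "\<epsilon> < \<epsilon>0" and n: "sc \<epsilon> * l ^ n = \<beta>" and \<beta>: "\<beta> \<in> {b1, l / b1}" for \<beta> \<epsilon> n
  proof -
    consider "\<beta> = b1" | "\<beta> = l / b1" using \<beta> by blast
    then show ?thesis
    proof cases
      case 1
      show ?thesis
        by (rule corner_at_phase[OF e n, of 1 "l / b1" 1 1 c d]) (use 1 b1lt b2 cross1 ne F in auto)
    next
      case 2
      show ?thesis
        by (rule corner_at_phase[OF e n, of b1 l c d "1 / l" l]) (use 2 b1lt b2 cross2 ne F in auto)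
    qed
  qed
  have "\<exists>C\<subseteq>{\<epsilon>\<in>I. corner h \<epsilon>}. card C = card {b1, l / b1}"
    by (rule corners_per_period[OF I]) (use b1lt b2 sq corners in auto)
  moreover have "card {b1, l / b1} = 2" using b1lt b2 by simp
  moreover have "maximum_on h I (F b1)"
    by (rule maximum_at_phase[OF I]) (use b1lt sq le in auto)
  moreover have "F b1 < J1 l"
  proof -
    have "1 * 1 < b1 * sqrt l" using b1lt sq by (intro mult_strict_mono) auto
    then have "0 < (sqrt l - b1) * (1 * (b1 * sqrt l) - 1) / (2 * (b1 * sqrt l))"
      using b1lt lp by (intro divide_pos_pos mult_pos_pos) auto
    then show ?thesis unfolding Fb J1_eq using hyp_arc_diff[of b1 "sqrt l" 1 1] lp by simp
  qed
  ultimately show ?thesis by metis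
qed

end

section \<open>Lower bounds for weighted norms on the lattice\<close>

text \<open>In the following bounds one side is affine in \<open>s\<close> and the other side is a minimum of two affine functions, so
  it is enough to compare at the end points and at the breakpoint of the minimum.\<close>

lemma affine_le_between:
  fixes s :: real
  assumes "p \<le> s" "s \<le> q" "A * p + B \<le> A' * p + B'" "A * q + B \<le> A' * q + B'"
  shows "A * s + B \<le> A' * s + B'"
proof (cases "A \<le> A'")
  case True
  then have "(A' - A) * p \<le> (A' - A) * s" using assms by (intro mult_left_mono) auto
  then show ?thesis using assms by (simp add: algebra_simps)
next
  case False
  then have "(A - A') * s \<le> (A - A') * q" using assms by (intro mult_left_mono) auto
  then show ?thesis using assms by (simp add: algebra_simps)
qed

lemma abs_scale: "0 \<le> c \<Longrightarrow> z * c = w \<Longrightarrow> \<bar>z\<bar> * c = \<bar>w :: real\<bar>"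
  by (auto simp: abs_mult)

lemma abs_int_ge_1: "x \<noteq> 0 \<Longrightarrow> 1 \<le> \<bar>real_of_int x\<bar>"
  by linarith

lemma abs_mult_int_ge:
  assumes "x \<noteq> 0" "0 \<le> c"
  shows "c \<le> \<bar>real_of_int x * c\<bar>"
  using mult_right_mono[OF abs_int_ge_1[OF assms(1)] assms(2)] assms(2) by (simp add: abs_mult)

lemma abs_add_ge_add: "\<bar>A + B\<bar> \<le> \<bar>A\<bar> + \<bar>B\<bar>" and abs_add_ge_diff: "\<bar>A - B\<bar> \<le> \<bar>A\<bar> + \<bar>B :: real\<bar>"
  by linarith+

lemma abs_same_sign:
  fixes x y :: int and p q :: real
  assumes "0 \<le> x * y" "0 \<le> p" "0 \<le> q"
  shows "\<bar>x * p + y * q\<bar> = \<bar>x\<bar> * p + \<bar>y\<bar> * q"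
proof -
  consider "0 \<le> x" "0 \<le> y" | "x \<le> 0" "y \<le> 0" using assms by (auto simp: zero_le_mult_iff)
  then show ?thesis
  proof cases
    case 1 then show ?thesis using assms by (simp add: add_nonneg_nonneg)
  next
    case 2
    then have "x * p + y * q \<le> 0" using assms by (intro add_nonpos_nonpos mult_nonpos_nonneg) auto
    then show ?thesis using 2 by simp
  qed
qed

lemma same_sign_ge:
  fixes x y :: int and p q :: real
  assumes "0 \<le> x * y" "x \<noteq> 0" "0 \<le> p" "0 \<le> q"
  shows "p \<le> \<bar>x * p + y * q\<bar>"
proof -
  have "1 * p \<le> \<bar>x\<bar> * p" using assms by (intro mult_right_mono) auto
  then show ?thesis using abs_same_sign[OF assms(1,3,4)] assms by (simp add: add_increasing2)
qed

text \<open>One of the pairs \<open>(x, y)\<close> and \<open>(y, -x)\<close> consists of numbers of the same sign and starts with a nonzero number;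
  for that pair there is no cancellation.\<close>

lemma rotated_lattice_norm:
  fixes x y :: int and p q q' :: real
  assumes "x \<noteq> 0 \<or> y \<noteq> 0" and "0 \<le> p" "0 \<le> q" "0 \<le> q'"
  shows "p \<le> \<bar>x * p + y * q\<bar> \<or> p \<le> \<bar>y * p - x * q'\<bar>"
proof (cases "0 \<le> x * y \<and> x \<noteq> 0")
  case True
  then have "p \<le> \<bar>x * p + y * q\<bar>" using assms by (intro same_sign_ge) auto
  then show ?thesis by blast
next
  case False
  then have "0 \<le> y * (- x)" "y \<noteq> 0" using assms(1) by (auto simp: zero_le_mult_iff mult_le_0_iff not_le)
  from same_sign_ge[OF this assms(2,4)] show ?thesis by simp
qed

text \<open>The two affine functions on the left belong to \<open>(x, y) = (0, 1)\<close> and \<open>(x, y) = (1, 0)\<close>, and they cross at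
  \<open>s = l\<close>. With \<open>A\<close> and \<open>B\<close> the two numbers inside the absolute values (the first scaled by \<open>s\<close>), the bound at
  \<open>s = 1\<close> comes from \<open>A + B\<close> unless \<open>x = 0\<close>, the one at \<open>s = l\<^sup>2\<close> from \<open>A - B\<close> unless \<open>y = 0\<close>, and the one at \<open>s = l\<close> from whichever
  of the two is free of cancellation.\<close>

lemma lower_bound_metallic:
  fixes x y :: int and l s :: real
  assumes l: "l > 1" and xy: "x \<noteq> 0 \<or> y \<noteq> 0" and s: "1 \<le> s" "s \<le> l\<^sup>2"
  shows "min (s + 1) (s / l + l) \<le> \<bar>x / l + y\<bar> * s + \<bar>l * x - y\<bar>"
proof -
  have at_l: "l + 1 \<le> \<bar>x / l + y\<bar> * l + \<bar>l * x - y\<bar>"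
  proof -
    have 1: "\<bar>x / l + y\<bar> * l = \<bar>x + y * l\<bar>"
      using l by (intro abs_scale) (auto simp: field_simps)
    have "l + 1 \<le> \<bar>x * (l + 1) + y * (l - 1)\<bar> \<or> l + 1 \<le> \<bar>y * (l + 1) - x * (l - 1)\<bar>"
      by (rule rotated_lattice_norm) (use l xy in auto)
    moreover have "x * (l + 1) + y * (l - 1) = (x + y * l) + (l * x - y)"
       "y * (l + 1) - x * (l - 1) = (x + y * l) - (l * x - y)" by (auto simp: algebra_simps)
    ultimately show ?thesis unfolding 1
      using abs_add_ge_add[of "x + y * l" "l * x - y"] abs_add_ge_diff[of "x + y * l" "l * x - y"] by argo
  qed
  show ?thesis
  proof (cases "s \<le> l")
    case True
    have "1 * 1 + 1 \<le> \<bar>x / l + y\<bar> * 1 + \<bar>l * x - y\<bar>"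
    proof (cases "x = 0")
      case True
      then show ?thesis using xy abs_int_ge_1[of y] by simp
    next
      case False
      have "0 \<le> (l - 1)\<^sup>2 / l" using l by simp
      also have "\<dots> = l + 1 / l - 2" using l by (simp add: field_simps power2_eq_square)
      finally have "2 \<le> l + 1 / l" by simp
      moreover have "l + 1 / l \<le> \<bar>x * (l + 1 / l)\<bar>" using False l by (intro abs_mult_int_ge) auto
      moreover have "x * (l + 1 / l) = (x / l + y) + (l * x - y)" by (simp add: algebra_simps)
      ultimately show ?thesis using abs_add_ge_add[of "x / l + y" "l * x - y"] by simp
    qed
    then have "1 * s + 1 \<le> \<bar>x / l + y\<bar> * s + \<bar>l * x - y\<bar>"
      by (rule affine_le_between[OF s(1) True]) (use at_l in simp)
    then show ?thesis by simp
  next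
    case False
    have "1 / l * l\<^sup>2 + l \<le> \<bar>x / l + y\<bar> * l\<^sup>2 + \<bar>l * x - y\<bar>"
    proof -
      have 1: "\<bar>x / l + y\<bar> * l\<^sup>2 = \<bar>x * l + y * l\<^sup>2\<bar>"
        using l by (intro abs_scale) (auto simp: field_simps power2_eq_square)
      have "2 * l \<le> l\<^sup>2 + 1" using zero_le_power2[of "l - 1"] by (simp add: power2_diff)
      show ?thesis
      proof (cases "y = 0")
        case True
        then have "2 * l \<le> 2 * \<bar>x * l\<bar>" using abs_mult_int_ge[of x l] xy l by simp
        then show ?thesis using l unfolding 1 by (simp add: True power2_eq_square mult.commute)
      next
        case False
        then have "l\<^sup>2 + 1 \<le> \<bar>y * (l\<^sup>2 + 1)\<bar>" by (intro abs_mult_int_ge) auto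
        moreover have "y * (l\<^sup>2 + 1) = (x * l + y * l\<^sup>2) - (l * x - y)" by (simp add: algebra_simps)
        ultimately have "2 * l \<le> \<bar>x * l + y * l\<^sup>2\<bar> + \<bar>l * x - y\<bar>"
          using abs_add_ge_diff[of "x * l + y * l\<^sup>2" "l * x - y"] \<open>2 * l \<le> l\<^sup>2 + 1\<close> by simp
        then show ?thesis using l unfolding 1 by (simp add: power2_eq_square)
      qed
    qed
    then have "1 / l * s + l \<le> \<bar>x / l + y\<bar> * s + \<bar>l * x - y\<bar>"
      using at_l l s False by (intro affine_le_between[of l s "l\<^sup>2"]) auto
    then show ?thesis by simp
  qed
qed

text \<open>The exclusion of \<open>x = 0\<close> removes the multiples of the vector that realises the first minimum for \<open>s \<le> l\<close>. The
  two affine functions belong to \<open>(x, y) = (1, 0)\<close> and \<open>(x, y) = (1, -1)\<close>. The bound is delicate at \<open>s = 1\<close>,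
  where it is attained by all vectors \<open>(1, -j)\<close> with \<open>1 / l \<le> j \<le> l\<close>.\<close>

lemma second_bound_golden:
  fixes x y :: int and l s :: real
  assumes l: "l > 3" and x: "x \<noteq> 0" and s: "1 \<le> s" "s \<le> l"
  shows "min (1 / l * s + l) ((1 - 1 / l) * s + (l - 1)) \<le> \<bar>x / l + y\<bar> * s + \<bar>l * x + y\<bar>"
    (is "_ \<le> ?A * s + ?B")
proof -
  have at1: "l - 1 / l \<le> ?A * 1 + ?B"
  proof -
    have "1 / l < l" using l by (simp add: field_simps less_1_mult)
    then have "l - 1 / l \<le> \<bar>x * (l - 1 / l)\<bar>" using x by (intro abs_mult_int_ge) auto
    moreover have "x * (l - 1 / l) = (l * x + y) - (x / l + y)" by (simp add: algebra_simps)
    ultimately show ?thesis using abs_add_ge_diff[of "l * x + y" "x / l + y"] by simp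
  qed
  have atl: "1 + l \<le> ?A * l + ?B"
  proof -
    have 1: "\<bar>x / l + y\<bar> * l = \<bar>x + y * l\<bar>"
      using l by (intro abs_scale) (auto simp: field_simps)
    show ?thesis
    proof (cases "0 \<le> x * y")
      case True
      have "(x + y * l) + (l * x + y) = (l + 1) * (x + y)" by (simp add: algebra_simps)
      then have "(l + 1) * \<bar>x + y\<bar> \<le> \<bar>x + y * l\<bar> + \<bar>l * x + y\<bar>"
        using abs_add_ge_add[of "x + y * l" "l * x + y"] l by (simp add: abs_mult)
      moreover have "1 \<le> \<bar>x + y\<bar>" using True x by (auto simp: zero_le_mult_iff)
      then have "(l + 1) * 1 \<le> (l + 1) * \<bar>x + y\<bar>" using l by (intro mult_left_mono) auto
      ultimately show ?thesis unfolding 1 by simp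
    next
      case False
      have "(l * x + y) - (x + y * l) = (l - 1) * (x - y)" by (simp add: algebra_simps)
      then have "(l - 1) * \<bar>x - y\<bar> \<le> \<bar>x + y * l\<bar> + \<bar>l * x + y\<bar>"
        using abs_add_ge_diff[of "l * x + y" "x + y * l"] l by (simp add: abs_mult)
      moreover have "2 \<le> \<bar>x - y\<bar>" using False by (auto simp: mult_less_0_iff not_le)
      then have "(l - 1) * 2 \<le> (l - 1) * \<bar>x - y\<bar>" using l by (intro mult_left_mono) auto
      ultimately show ?thesis unfolding 1 using l by simp
    qed
  qed
  \<comment> \<open>The crossing point of the two affine functions in the bound.\<close>
  define s0 where "s0 = l / (l - 2)"
  have s0: "1 \<le> s0" "s0 \<le> l" using l by (auto simp: s0_def field_simps)
  have s0eq: "s0 * (l - 2) = l" using l by (simp add: s0_def)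
  have at0: "1 / l * s0 + l \<le> ?A * s0 + ?B"
  proof -
    let ?P = "x + y * l" and ?Q = "(l - 2) * (l * x + y)"
    have pos: "0 \<le> l * l - 2 * l - 1" using mult_mono[of 3 l 1 "l - 2"] l by (simp add: algebra_simps)
    have "(l - 1)\<^sup>2 \<le> \<bar>?P\<bar> + \<bar>?Q\<bar>"
    proof (cases "0 \<le> x * y")
      case True
      then have "(l - 1)\<^sup>2 \<le> \<bar>x * (l - 1)\<^sup>2 + y * (2 * l - 2)\<bar>"
        using x l same_sign_ge[of x y "(l - 1)\<^sup>2" "2 * l - 2"] by simp
      moreover have "x * (l - 1)\<^sup>2 + y * (2 * l - 2) = ?P + ?Q" by (simp add: algebra_simps power2_eq_square)
      ultimately show ?thesis using abs_add_ge_add[of ?P ?Q] by simp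
    next
      case False
      then have xy': "0 \<le> x * (- y)" by simp
      have "\<bar>x * (l * l - 2 * l - 1) + (- y) * 2\<bar> = \<bar>x\<bar> * (l * l - 2 * l - 1) + \<bar>- y\<bar> * 2"
        using abs_same_sign[OF xy' pos, of 2] by simp
      moreover have "1 * (l * l - 2 * l - 1) \<le> \<bar>x\<bar> * (l * l - 2 * l - 1)"
        using x pos by (intro mult_right_mono) auto
      moreover have "1 \<le> \<bar>real_of_int (- y)\<bar>" using False by (intro abs_int_ge_1) auto
      moreover have "x * (l * l - 2 * l - 1) + (- y) * 2 = ?Q - ?P" by (simp add: algebra_simps)
      moreover have "(l - 1)\<^sup>2 = l * l - 2 * l - 1 + 2" by (simp add: algebra_simps power2_eq_square)
      moreover have "\<bar>?Q - ?P\<bar> \<le> \<bar>?P\<bar> + \<bar>?Q\<bar>" using abs_add_ge_diff[of ?Q ?P] by linarith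
      ultimately show ?thesis by simp
    qed
    then have "(1 / l * s0 + l) * (l - 2) \<le> (?A * s0 + ?B) * (l - 2)"
    proof -
      have "(1 / l * s0 + l) * (l - 2) = (s0 * (l - 2)) / l + l * (l - 2)" by (simp add: distrib_right)
      then have "(1 / l * s0 + l) * (l - 2) = (l - 1)\<^sup>2"
        using l unfolding s0eq by (simp add: algebra_simps power2_eq_square)
      moreover have "(?A * s0 + ?B) * (l - 2) = ?A * (s0 * (l - 2)) + ?B * (l - 2)" by (simp add: algebra_simps)
      moreover have "?A * l = \<bar>?P\<bar>"
        using l by (intro abs_scale) (auto simp: field_simps)
      moreover have "?B * (l - 2) = \<bar>?Q\<bar>" using l by (simp add: abs_mult)
      ultimately show ?thesis using \<open>(l - 1)\<^sup>2 \<le> _\<close> unfolding s0eq by simp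
    qed
    then show ?thesis using l by simp
  qed
  show ?thesis
  proof (cases "s \<le> s0")
    case True
    have eq: "(1 - 1 / l) * s0 + (l - 1) = 1 / l * s0 + l"
    proof -
      have "(1 - 2 / l) * s0 = 1" using l by (simp add: s0_def field_simps)
      then show ?thesis by (simp add: algebra_simps)
    qed
    have "(1 - 1 / l) * s + (l - 1) \<le> ?A * s + ?B"
      using at0 at1 by (intro affine_le_between[OF s(1) True]) (auto simp: eq)
    then show ?thesis by simp
  next
    case False
    then have "1 / l * s + l \<le> ?A * s + ?B"
      using at0 atl l s by (intro affine_le_between[of s0 s l]) auto
    then show ?thesis by simp
  qed
qed

text \<open>Here \<open>k = x k' + y k\<^sub>1\<close> where \<open>k'\<close> has coordinates \<open>(c, -d)\<close> and \<open>k\<^sub>1\<close> has coordinates \<open>(1, 1)\<close>. The condition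
  \<open>c \<le> 1/2\<close> prevents cancellation in \<open>A + B\<close> at the crossing point of the two affine functions.\<close>

lemma lower_bound_metallic_colored:
  fixes x y :: int and c d l s :: real
  assumes c: "0 < c" "c \<le> 1/2" and d: "1 < d" and cd: "c + d \<ge> 2" and l: "d = l * c"  "2 * d \<le> 1 + l"
    and xy: "x \<noteq> 0 \<or> y \<noteq> 0" and s: "1 \<le> s" "s \<le> l"
  shows "min (s + 1) (c * s + d) \<le> \<bar>x * c + y\<bar> * s + \<bar>y - x * d\<bar>"
    (is "_ \<le> ?A * s + ?B")
proof -
  have at1: "2 \<le> ?A * 1 + ?B"
  proof (cases "x = 0")
    case True
    then show ?thesis using xy abs_int_ge_1[of y] by simp
  next
    case False
    then have "c + d \<le> \<bar>x * (c + d)\<bar>" using c d by (intro abs_mult_int_ge) auto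
    moreover have "x * (c + d) = (x * c + y) - (y - x * d)" by (simp add: algebra_simps)
    ultimately show ?thesis using abs_add_ge_diff[of "x * c + y" "y - x * d"] cd by simp
  qed
  have l1: "l > 1" using s d l c by (smt (verit) mult_right_le_one_le)
  have atl: "2 * d \<le> ?A * l + ?B"
  proof -
    have 1: "?A * l = \<bar>x * d + y * l\<bar>"
      using l1 by (intro abs_scale) (auto simp: l algebra_simps)
    show ?thesis
    proof (cases "y = 0")
      case True
      then have "d \<le> \<bar>x * d\<bar>" using xy d by (intro abs_mult_int_ge) auto
      then show ?thesis unfolding 1 unfolding True by simp
    next
      case False
      then have "1 + l \<le> \<bar>y * (1 + l)\<bar>" using l1 by (intro abs_mult_int_ge) auto
      moreover have "y * (1 + l) = (x * d + y * l) + (y - x * d)" by (simp add: algebra_simps)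
      ultimately show ?thesis unfolding 1
        using abs_add_ge_add[of "x * d + y * l" "y - x * d"] l by simp
    qed
  qed
  \<comment> \<open>The crossing point of the two affine functions in the bound.\<close>
  define s1 where "s1 = (d - 1) / (1 - c)"
  have eq: "c * s1 + d = s1 + 1" using c by (simp add: s1_def field_simps)
  have s1: "1 \<le> s1" "s1 \<le> l" using c cd l by (auto simp: s1_def field_simps)
  have at_s1: "s1 + 1 \<le> ?A * s1 + ?B"
  proof -
    have 1: "?A * s1 = \<bar>x * (c * s1) + y * s1\<bar>"
      using s1 by (intro abs_scale) (auto simp: algebra_simps)
    define P Q where "P = x * (c * s1) + y * s1" and "Q = y - x * d"
    have d_eq: "d = s1 + 1 - c * s1" using eq by simp
    have "s1 + 1 \<le> \<bar>x * (s1 + 1) + y * (s1 - 1)\<bar> \<or> s1 + 1 \<le> \<bar>y * (s1 + 1) - x * (s1 + 1 - 2 * (c * s1))\<bar>"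
    proof (rule rotated_lattice_norm[OF xy])
      have "c * s1 \<le> 1/2 * s1" using c s1 by (intro mult_right_mono) auto
      then show "0 \<le> s1 + 1 - 2 * (c * s1)" by simp
    qed (use s1 in auto)
    moreover have "x * (s1 + 1) + y * (s1 - 1) = P - Q"
      "y * (s1 + 1) - x * (s1 + 1 - 2 * (c * s1)) = P + Q"
      unfolding P_def Q_def d_eq by (simp_all add: algebra_simps)
    ultimately have "s1 + 1 \<le> \<bar>P - Q\<bar> \<or> s1 + 1 \<le> \<bar>P + Q\<bar>" by simp
    then have "s1 + 1 \<le> \<bar>P\<bar> + \<bar>Q\<bar>" by linarith
    then show ?thesis unfolding 1 by (simp add: P_def Q_def)
  qed
  show ?thesis
  proof (cases "s \<le> s1")
    case True
    have "1 * s + 1 \<le> ?A * s + ?B"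
      using at_s1 at1 by (intro affine_le_between[OF s(1) True]) auto
    then show ?thesis by simp
  next
    case False
    then have "c * s + d \<le> ?A * s + ?B"
      using at_s1 atl l s eq by (intro affine_le_between[of s1 s l]) (auto simp: algebra_simps)
    then show ?thesis by simp
  qed
qed

section \<open>Resonances as a lattice with an expanding unimodular map\<close>

text \<open>The entries of \<open>T\<close> are kept as parameters so that the resonant sequences can be analysed once for all periods.
  What matters is that \<open>T\<close> is unimodular with nonnegative entries and that \<open>\<omega>\<close> is an eigenvector.\<close>

locale resonant_lattice =
  fixes \<Omega> :: real and as :: "nat list" and t1 t2 t3 t4 :: int
  assumes Omega: "0 < \<Omega>" "\<Omega> < 1" "\<Omega> \<notin> \<rat>"
    and T: "T_mat as = vector [vector [t1, t2], vector [t3, t4]]"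
    and entries: "t1 \<ge> 1" "t2 \<ge> 1" "t3 \<ge> 1" "t4 \<ge> 0"
    and det: "\<bar>t1 * t4 - t2 * t3\<bar> = 1"
    and eigen: "t1 + t2 * \<Omega> = lam \<Omega> as" "t3 + t4 * \<Omega> = lam \<Omega> as * \<Omega>"
begin

abbreviation "l \<equiv> lam \<Omega> as"
definition \<sigma> :: int where "\<sigma> = t1 * t4 - t2 * t3"

text \<open>The forms \<open>u\<close> and \<open>v\<close> are the two eigenforms of \<open>U\<close>; on a vector \<open>k\<^sup>0(q)\<close> they are \<open>r\<^sub>q\<close> and \<open>z\<^sub>q\<close>.\<close>

definition u :: "int^2 \<Rightarrow> real" where "u k = of_int (k $ 2) * \<Omega> + of_int (k $ 1)"
definition v :: "int^2 \<Rightarrow> real" where "v k = of_int t3 * of_int (k $ 2) - of_int t2 * \<Omega> * of_int (k $ 1)"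
definition U :: "int^2 \<Rightarrow> int^2" where "U k = U_mat as *v k"
definition U' :: "int^2 \<Rightarrow> int^2" where "U' k = matrix_inv (U_mat as) *v k"

lemma l_gt_1: "l > 1"
proof -
  have "1 * \<Omega> \<le> t2 * \<Omega>" using Omega entries by (intro mult_right_mono) auto
  then show ?thesis using eigen(1) entries Omega by linarith
qed

lemma sigma_squared: "of_int \<sigma> * of_int \<sigma> = (1 :: real)" "\<sigma> * \<sigma> = 1" "\<bar>of_int \<sigma> :: real\<bar> = 1"
proof -
  have "\<sigma> = 1 \<or> \<sigma> = -1" using det unfolding \<sigma>_def by linarith
  then show "of_int \<sigma> * of_int \<sigma> = (1 :: real)" "\<sigma> * \<sigma> = 1" "\<bar>of_int \<sigma> :: real\<bar> = 1" by auto
qed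

lemma U_nth [simp]:
  "U k $ 1 = t4 * k $ 1 - t3 * k $ 2" "U k $ 2 = - t2 * k $ 1 + t1 * k $ 2"
  by (simp_all add: U_def U_mat_def T matrix_vector_mult_def sum_2)

lemma invertible_U_mat: "invertible (U_mat as)"
proof -
  define B :: "int^2^2" where "B = vector [vector [\<sigma> * t1, \<sigma> * t3], vector [\<sigma> * t2, \<sigma> * t4]]"
  have "\<sigma> * (t4 * t1 - t3 * t2) = 1" "\<sigma> * (t1 * t4 - t2 * t3) = 1"
    using sigma_squared(2) by (simp_all add: \<sigma>_def mult.commute)
  then have "U_mat as ** B = mat 1" "B ** U_mat as = mat 1"
    by (simp_all add: B_def U_mat_def T vec_eq_iff forall_2 matrix_matrix_mult_def sum_2 mat_def algebra_simps)
  then show ?thesis unfolding invertible_def by blast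
qed

lemma U_U' [simp]: "U (U' k) = k" and U'_U [simp]: "U' (U k) = k"
proof -
  have "U_mat as ** matrix_inv (U_mat as) = mat 1 \<and> matrix_inv (U_mat as) ** U_mat as = mat 1"
    using invertible_U_mat unfolding invertible_def matrix_inv_def by (rule someI_ex)
  then show "U (U' k) = k" "U' (U k) = k"
    by (simp_all add: U_def U'_def matrix_vector_mul_assoc)
qed

lemma U_funpow_U' [simp]: "(U ^^ n) ((U' ^^ n) k) = k"
  by (induction n arbitrary: k) (simp_all add: funpow_swap1)

lemma u_U: "u (U k) = of_int \<sigma> * u k / l"
proof -
  have 1: "l * (t4 - t2 * \<Omega>) = \<sigma>" "l * (t1 * \<Omega> - t3) = \<sigma> * \<Omega>"
  proof -
    have "(t1 + t2 * \<Omega>) * t4 - t2 * (t3 + t4 * \<Omega>) = \<sigma>"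
      "t1 * (t3 + t4 * \<Omega>) - t3 * (t1 + t2 * \<Omega>) = \<sigma> * \<Omega>"
      by (simp_all add: \<sigma>_def algebra_simps)
    then show "l * (t4 - t2 * \<Omega>) = \<sigma>" "l * (t1 * \<Omega> - t3) = \<sigma> * \<Omega>"
      unfolding eigen by (simp_all add: algebra_simps)
  qed
  have "l * u (U k) = l * (t4 - t2 * \<Omega>) * k $ 1 + l * (t1 * \<Omega> - t3) * k $ 2"
    by (simp add: u_def algebra_simps)
  also have "\<dots> = \<sigma> * u k" unfolding 1 by (simp add: u_def algebra_simps)
  finally show ?thesis using l_gt_1 by (simp add: field_simps)
qed

lemma v_U: "v (U k) = l * v k"
proof -
  have "v (U k) = t3 * (t1 + t2 * \<Omega>) * k $ 2 - t2 * (t3 + t4 * \<Omega>) * k $ 1"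
    by (simp add: v_def algebra_simps)
  also have "\<dots> = l * v k" unfolding eigen by (simp add: v_def algebra_simps)
  finally show ?thesis .
qed

lemma abs_u_funpow: "\<bar>u ((U ^^ n) k)\<bar> = \<bar>u k\<bar> / l ^ n"
  using l_gt_1 by (induction n) (simp_all add: u_U abs_mult sigma_squared(3))

lemma v_funpow: "v ((U ^^ n) k) = l ^ n * v k"
  by (induction n) (simp_all add: v_U)

lemma abs_u_U': "\<bar>u (U' k)\<bar> = l * \<bar>u k\<bar>"
  using abs_u_funpow[of 1 "U' k"] l_gt_1 by simp

lemma u_eq_0_iff: "u k = 0 \<longleftrightarrow> k = 0"
proof
  assume *: "u k = 0"
  have "k $ 2 = 0"
  proof (rule ccontr)
    assume "k $ 2 \<noteq> 0"
    then have "\<Omega> = of_int (- k $ 1) / of_int (k $ 2)" using * by (simp add: u_def field_simps)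
    also have "\<dots> \<in> \<rat>" by (intro Rats_divide Rats_of_int)
    finally show False using Omega by simp
  qed
  with * show "k = 0" by (simp add: u_def vec_eq_iff forall_2)
qed (simp add: u_def)

text \<open>The integer nearest to \<open>q\<Omega>\<close> is the only one at distance less than \<open>1/2\<close>; distance exactly \<open>1/2\<close> would make
  \<open>\<Omega>\<close> rational.\<close>

lemma quasi_resonances_iff: "k \<in> quasi_resonances \<Omega> \<longleftrightarrow> k $ 2 \<ge> 1 \<and> \<bar>u k\<bar> < 1/2"
proof
  assume "k \<in> quasi_resonances \<Omega>"
  then obtain q where q: "q \<ge> 1" "k = k0 \<Omega> q" unfolding quasi_resonances_def by blast
  have u: "u k = of_int q * \<Omega> - of_int (round (of_int q * \<Omega>))" by (simp add: u_def q k0_def p0_def)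
  have "\<bar>u k\<bar> \<noteq> 1/2"
  proof
    assume "\<bar>u k\<bar> = 1/2"
    then have "u k \<in> \<rat>" by (metis Rats_abs_iff Rats_1 Rats_divide Rats_number_of)
    then have "of_int q * \<Omega> \<in> \<rat>" using u Rats_add[of "u k" "of_int (round (of_int q * \<Omega>))"] by simp
    then have "of_int q * \<Omega> / of_int q \<in> \<rat>" by (intro Rats_divide Rats_of_int)
    then show False using q Omega by simp
  qed
  then show "k $ 2 \<ge> 1 \<and> \<bar>u k\<bar> < 1/2"
    using of_int_round_abs_le[of "of_int q * \<Omega>"] q u by (simp add: k0_def abs_minus_commute)
next
  assume *: "k $ 2 \<ge> 1 \<and> \<bar>u k\<bar> < 1/2"
  then have "round (of_int (k $ 2) * \<Omega>) = - k $ 1"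
    by (intro round_unique') (simp add: u_def)
  then have "k = k0 \<Omega> (k $ 2)" by (simp add: k0_def p0_def vec_eq_iff forall_2)
  then show "k \<in> quasi_resonances \<Omega>" using * unfolding quasi_resonances_def by blast
qed

lemma k0_snd: "k0 \<Omega> q $ 2 = q"
  by (simp add: k0_def)

lemma quasi_resonance_eq_k0: "k \<in> quasi_resonances \<Omega> \<Longrightarrow> k = k0 \<Omega> (k $ 2)"
  by (auto simp: quasi_resonances_def k0_snd)

lemma quasi_resonance_fst: "k \<in> quasi_resonances \<Omega> \<Longrightarrow> k $ 1 \<le> 0"
proof -
  assume "k \<in> quasi_resonances \<Omega>"
  then have *: "k $ 2 \<ge> 1" "\<bar>u k\<bar> < 1/2" by (auto simp: quasi_resonances_iff)
  have "0 < of_int (k $ 2) * \<Omega>" using * Omega by simp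
  then have "of_int (k $ 1) < (1::real)" using *(2) unfolding u_def by linarith
  then show ?thesis by simp
qed

text \<open>By the signs of its entries \<open>U\<close> maps the closed quadrant that contains all quasi-resonances into itself, and
  after one step the second component is positive.\<close>

lemma U_quadrant:
  assumes "k $ 1 \<le> 0" "k $ 2 \<ge> 0" "k \<noteq> 0"
  shows "U k $ 1 \<le> 0 \<and> U k $ 2 \<ge> 1"
proof -
  have nz: "k $ 1 \<noteq> 0 \<or> k $ 2 \<noteq> 0" using assms(3) by (auto simp: vec_eq_iff forall_2)
  have "t4 * k $ 1 \<le> 0" "t3 * k $ 2 \<ge> 0" using assms entries by (auto simp: mult_le_0_iff)
  moreover have "- t2 * k $ 1 \<ge> 0" "t1 * k $ 2 \<ge> 0" "- t2 * k $ 1 \<noteq> 0 \<or> t1 * k $ 2 \<noteq> 0"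
    using assms entries nz by (auto simp: mult_le_0_iff)
  then have "- t2 * k $ 1 + t1 * k $ 2 \<ge> 1" by linarith
  ultimately show ?thesis by simp
qed

lemma U_funpow_quadrant:
  assumes "k $ 1 \<le> 0" "k $ 2 \<ge> 0" "k \<noteq> 0"
  shows "(U ^^ Suc n) k $ 1 \<le> 0 \<and> (U ^^ Suc n) k $ 2 \<ge> 1"
proof (induction n)
  case 0 then show ?case using U_quadrant[OF assms] by simp
next
  case (Suc n)
  have "(U ^^ Suc n) k \<noteq> 0" using Suc by (auto simp del: funpow.simps)
  then show ?case using U_quadrant[of "(U ^^ Suc n) k"] Suc by (simp del: U_nth)
qed

lemma U_funpow_quasi_resonance:
  assumes "k $ 1 \<le> 0" "k $ 2 \<ge> 0" "k \<noteq> 0" "\<bar>u k\<bar> / l ^ Suc n < 1/2"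
  shows "(U ^^ Suc n) k \<in> quasi_resonances \<Omega>"
  using U_funpow_quadrant[OF assms(1-3), of n] assms(4)
  unfolding quasi_resonances_iff abs_u_funpow by blast

lemma U_quasi_resonance: "k \<in> quasi_resonances \<Omega> \<Longrightarrow> U k \<in> quasi_resonances \<Omega>"
proof -
  assume k: "k \<in> quasi_resonances \<Omega>"
  then have *: "k $ 2 \<ge> 1" "\<bar>u k\<bar> < 1/2" by (auto simp: quasi_resonances_iff)
  have nz: "k \<noteq> 0" using * by auto
  have "\<bar>u k\<bar> / l \<le> \<bar>u k\<bar>" using l_gt_1 mult_right_mono[of 1 l "\<bar>u k\<bar>"] by (simp add: field_simps)
  then have "\<bar>u k\<bar> / l < 1/2" using * by linarith
  then show ?thesis
    using U_funpow_quasi_resonance[OF quasi_resonance_fst[OF k] _ nz, of 0] * by simp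
qed

lemma U_funpow_quasi: "k \<in> quasi_resonances \<Omega> \<Longrightarrow> (U ^^ n) k \<in> quasi_resonances \<Omega>"
  by (induction n) (simp_all add: U_quasi_resonance)

lemma res_seq_eq: "res_seq \<Omega> as q n = (U ^^ n) (k0 \<Omega> q)"
  by (simp add: res_seq_def U_def[abs_def])

lemma primitives_iff: "q \<in> primitives \<Omega> as \<longleftrightarrow> q \<ge> 1 \<and> U' (k0 \<Omega> q) \<notin> quasi_resonances \<Omega>"
  by (simp add: primitives_def U'_def)

lemma k0_quasi: "q \<ge> 1 \<Longrightarrow> k0 \<Omega> q \<in> quasi_resonances \<Omega>"
  unfolding quasi_resonances_def by blast

lemma primitive_quasi: "q \<in> primitives \<Omega> as \<Longrightarrow> k0 \<Omega> q \<in> quasi_resonances \<Omega>"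
  by (simp add: k0_quasi primitives_iff)

text \<open>Going backwards along a resonant sequence multiplies \<open>|u|\<close> by \<open>\<lambda>\<close>, so the bound \<open>|u| < 1/2\<close> forces the
  sequence to leave the quasi-resonances after finitely many steps, and the last vector is primitive.\<close>

lemma res_seq_exists:
  assumes "k \<in> quasi_resonances \<Omega>"
  shows "\<exists>q\<in>primitives \<Omega> as. \<exists>n. res_seq \<Omega> as q n = k"
proof -
  have "u k \<noteq> 0" using assms u_eq_0_iff quasi_resonances_iff by fastforce
  then obtain m where "1/2 / \<bar>u k\<bar> < l ^ m" using real_arch_pow[OF l_gt_1] by blast
  then have "1/2 \<le> \<bar>u k\<bar> * l ^ m" using \<open>u k \<noteq> 0\<close> by (simp add: field_simps)
  with assms show ?thesis
  proof (induction m arbitrary: k)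
    case 0
    then show ?case by (simp add: quasi_resonances_iff)
  next
    case (Suc m)
    have k: "k = k0 \<Omega> (k $ 2)" "k $ 2 \<ge> 1"
      using Suc.prems quasi_resonance_eq_k0 quasi_resonances_iff by auto
    show ?case
    proof (cases "U' k \<in> quasi_resonances \<Omega>")
      case False
      then have "k $ 2 \<in> primitives \<Omega> as" using k by (simp add: primitives_iff)
      moreover have "res_seq \<Omega> as (k $ 2) 0 = k" using k by (simp add: res_seq_eq)
      ultimately show ?thesis by blast
    next
      case True
      have "1/2 \<le> \<bar>u (U' k)\<bar> * l ^ m" using Suc.prems(2) by (simp add: abs_u_U' mult_ac)
      from Suc.IH[OF True this] obtain q n where q: "q \<in> primitives \<Omega> as" "res_seq \<Omega> as q n = U' k" by blast
      then have "res_seq \<Omega> as q (Suc n) = k" by (simp add: res_seq_eq)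
      then show ?thesis using q by blast
    qed
  qed
qed

text \<open>If the levels differed, cancelling the smaller power of the injective map \<open>U\<close> would exhibit the predecessor of
  a primitive vector as a quasi-resonance.\<close>

lemma res_seq_unique:
  assumes q: "q \<in> primitives \<Omega> as" "q' \<in> primitives \<Omega> as"
    and eq: "res_seq \<Omega> as q n = res_seq \<Omega> as q' m"
  shows "q = q' \<and> n = m"
proof -
  have inj: "inj U" by (metis U'_U injI)
  have *: False if "q \<in> primitives \<Omega> as" "q' \<in> primitives \<Omega> as"
      "(U ^^ n) (k0 \<Omega> q) = (U ^^ (n + Suc j)) (k0 \<Omega> q')" for q q' n j
  proof -
    have "(U ^^ n) (k0 \<Omega> q) = (U ^^ n) (U ((U ^^ j) (k0 \<Omega> q')))"
      using that(3) by (simp add: funpow_add funpow_swap1)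
    then have "k0 \<Omega> q = U ((U ^^ j) (k0 \<Omega> q'))" by (rule injD[OF inj_fn[OF inj]])
    then have "U' (k0 \<Omega> q) = (U ^^ j) (k0 \<Omega> q')" by simp
    then show False using that(1,2) U_funpow_quasi primitive_quasi by (simp add: primitives_iff)
  qed
  have nm: "n = m"
  proof (cases n m rule: linorder_cases)
    case less
    then obtain j where "m = n + Suc j" by (metis add_Suc_right less_imp_Suc_add)
    then show ?thesis using *[OF q] eq by (simp add: res_seq_eq)
  next
    case greater
    then obtain j where "n = m + Suc j" by (metis add_Suc_right less_imp_Suc_add)
    then show ?thesis using *[OF q(2,1)] eq by (metis res_seq_eq)
  qed
  then have "k0 \<Omega> q = k0 \<Omega> q'" using eq injD[OF inj_fn[OF inj]] by (simp add: res_seq_eq)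
  then show ?thesis using nm k0_snd by metis
qed

lemma res_index_res_seq: "q \<in> primitives \<Omega> as \<Longrightarrow> res_index \<Omega> as (res_seq \<Omega> as q n) = (q, n)"
  unfolding res_index_def using res_seq_unique by (intro the_equality) (auto split: prod.splits)

text \<open>The factor that turns \<open>|v|\<close> into the asymptotic size \<open>K\<^sub>q\<close>.\<close>

definition \<kappa> :: real where "\<kappa> = (1 + \<Omega>) / \<bar>t3 + t2 * \<Omega>\<^sup>2\<bar>"

lemma kappa_pos: "\<kappa> > 0"
proof -
  have "t3 + t2 * \<Omega>\<^sup>2 > 0" using entries Omega by (intro add_pos_nonneg) auto
  then show ?thesis using Omega by (simp add: \<kappa>_def)
qed

lemma v_pos: "k \<in> quasi_resonances \<Omega> \<Longrightarrow> v k > 0"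
proof -
  assume k: "k \<in> quasi_resonances \<Omega>"
  have "of_int t2 * \<Omega> * of_int (k $ 1) \<le> 0"
    using quasi_resonance_fst[OF k] entries Omega by (intro mult_nonneg_nonpos) auto
  moreover have "real_of_int t3 * of_int (k $ 2) > 0" using k entries by (simp add: quasi_resonances_iff)
  ultimately show ?thesis by (simp add: v_def)
qed

lemma r_fun_eq: "r_fun \<Omega> q = u (k0 \<Omega> q)"
  by (simp add: r_fun_def u_def k0_def)

lemma K_fun_eq: "K_fun \<Omega> as q = \<kappa> * \<bar>v (k0 \<Omega> q)\<bar>"
  by (simp add: K_fun_def z_fun_def v_def k0_def T \<kappa>_def mult_ac)

lemma gam_eq: "gam \<Omega> as q = \<kappa> * \<bar>u (k0 \<Omega> q) * v (k0 \<Omega> q)\<bar>"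
  by (simp add: gam_def r_fun_eq K_fun_eq abs_mult)

lemma abs_u_v_funpow: "\<bar>u ((U ^^ n) k) * v ((U ^^ n) k)\<bar> = \<bar>u k * v k\<bar>"
  using l_gt_1 by (simp add: abs_mult abs_u_funpow v_funpow)

text \<open>Since \<open>|u v|\<close> is constant along resonant sequences, minimising over primitive vectors is the same as minimising
  over all quasi-resonances.\<close>

lemma gam_min_eq:
  assumes low: "\<And>k. k \<in> quasi_resonances \<Omega> \<Longrightarrow> \<mu> \<le> \<bar>u k * v k\<bar>"
    and k: "k \<in> quasi_resonances \<Omega>" "\<bar>u k * v k\<bar> = \<mu>"
  shows "gam_min \<Omega> as = \<kappa> * \<mu>"
  unfolding gam_min_def
proof (rule cInf_eq_minimum)
  obtain q n where q: "q \<in> primitives \<Omega> as" "res_seq \<Omega> as q n = k" using res_seq_exists k by blast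
  then have "gam \<Omega> as q = \<kappa> * \<mu>"
    using abs_u_v_funpow[of n "k0 \<Omega> q"] k by (simp add: gam_eq res_seq_eq)
  then show "\<kappa> * \<mu> \<in> gam \<Omega> as ` primitives \<Omega> as" using q by (metis imageI)
next
  fix x assume "x \<in> gam \<Omega> as ` primitives \<Omega> as"
  then show "\<kappa> * \<mu> \<le> x" using low primitive_quasi kappa_pos by (auto simp: gam_eq)
qed

text \<open>The fourth root of \<open>\<epsilon> / \<epsilon>\<^sup>*\<^sub>k\<close> is \<open>(\<epsilon> / D\<^sub>0)\<^sup>1\<^sup>/\<^sup>4 K\<^sub>q \<lambda>\<^sup>n / \<surd>Y\<close> with \<open>Y\<close> the normalised \<open>\<gamma>\<^sup>*\<^sub>q\<close>. Its product with
  \<open>\<surd>Y\<close> is linear in \<open>|v(k)|\<close>, and \<open>\<surd>Y\<close> divided by it is linear in \<open>|u(k)|\<close>. Thus \<open>g\<^sup>*\<^sub>k\<close> depends on \<open>k\<close>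
  only through the absolute values of the eigenforms.\<close>

lemma g_star_eq:
  assumes rho: "\<rho> > 0" and gpos: "gam_min \<Omega> as > 0" and e: "\<epsilon> > 0" and k: "k \<in> quasi_resonances \<Omega>"
  shows "g_star \<Omega> as \<rho> k \<epsilon> =
     hyp_arc (\<kappa> * \<bar>v k\<bar>) (\<bar>u k\<bar> / gam_min \<Omega> as) ((\<epsilon> / D0 \<Omega> as \<rho>) powr (1/4))"
proof -
  obtain q n where q: "q \<in> primitives \<Omega> as" "res_seq \<Omega> as q n = k" using res_seq_exists k by blast
  define g where "g = gam_min \<Omega> as"
  define D where "D = D0 \<Omega> as \<rho>"
  define d where "d = (\<epsilon> / D) powr (1/4)"
  define K where "K = K_fun \<Omega> as q"
  define Y where "Y = gam_rel \<Omega> as q"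
  define w where "w = K * l ^ n"
  define X where "X = eps_center \<Omega> as \<rho> q n"
  have kq: "k0 \<Omega> q \<in> quasi_resonances \<Omega>" using primitive_quasi q by simp
  have D: "D > 0" using rho gpos by (simp add: D_def D0_def)
  have d: "d > 0" "\<epsilon> / D = d ^ 4" using D e by (auto simp: d_def simp flip: powr_realpow simp: powr_powr)
  have K: "K > 0" using v_pos[OF kq] kappa_pos by (simp add: K_def K_fun_eq)
  have w: "w > 0" using K l_gt_1 by (simp add: w_def)
  have r: "r_fun \<Omega> q \<noteq> 0" unfolding r_fun_eq u_eq_0_iff using kq quasi_resonances_iff by fastforce
  have Y: "Y > 0" using r K gpos by (simp add: Y_def gam_rel_def gam_def K_def)
  have X: "X = D * Y\<^sup>2 / w ^ 4" by (simp add: X_def eps_center_def D_def Y_def w_def K_def power_mult_distrib power_mult mult.commute)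
  have X0: "X > 0" using X D Y w by simp
  have root: "(a ^ 4) powr (1/4) = a" if "a > 0" for a :: real
    using that powr_powr[of a 4 "1/4"] by simp
  have sq4: "sqrt Y ^ 4 = Y\<^sup>2" using Y by (simp add: power4_eq_xxxx power2_eq_square)
  have "\<epsilon> / X = (d * w / sqrt Y) ^ 4"
    using d(2) D Y w e by (simp add: X power_divide power_mult_distrib sq4 field_simps)
  then have 1: "(\<epsilon> / X) powr (1/4) = d * w / sqrt Y" using d w Y root by simp
  have "X / \<epsilon> = (sqrt Y / (d * w)) ^ 4"
    using \<open>\<epsilon> / X = _\<close> X0 e d w Y by (simp add: field_simps power_divide power_mult_distrib)
  then have 2: "(X / \<epsilon>) powr (1/4) = sqrt Y / (d * w)" using d w Y root by simp
  have "g_star \<Omega> as \<rho> k \<epsilon> = G_fun \<epsilon> X Y"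
    using res_index_res_seq[OF q(1), of n] unfolding q(2) by (simp add: g_star_def X_def Y_def)
  also have "\<dots> = sqrt Y / 2 * (d * w / sqrt Y + sqrt Y / (d * w))"
    unfolding G_fun_def 1 2 using Y by (simp add: powr_half_sqrt)
  also have "\<dots> = (w * d + Y / w / d) / 2"
    using Y d w by (simp add: distrib_left mult.commute add_divide_distrib)
  also have "Y / w = \<bar>u k\<bar> / g"
    using K l_gt_1 gpos q(2) abs_u_funpow[of n "k0 \<Omega> q"]
    by (simp add: Y_def gam_rel_def gam_def w_def K_def r_fun_eq res_seq_eq g_def field_simps)
  also have "w = \<kappa> * \<bar>v k\<bar>"
    using q(2) l_gt_1 by (auto simp: w_def K_def K_fun_eq res_seq_eq v_funpow abs_mult)
  finally show ?thesis by (simp add: hyp_arc_def g_def d_def D_def)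
qed

end

context resonant_lattice
begin

lemma essential_resonances_iff:
  "k \<in> essential_resonances \<Omega> \<longleftrightarrow> k \<in> quasi_resonances \<Omega> \<and> (\<forall>c v. k = c *s v \<longrightarrow> \<bar>c\<bar> = 1)"
  unfolding essential_resonances_def by blast

text \<open>The inverse of \<open>U\<close> is an integer matrix too, so divisibility of a vector is the same before and after \<open>U\<close>.\<close>

lemma U_funpow_not_multiple:
  assumes "\<And>c w. k = c *s w \<Longrightarrow> \<bar>c\<bar> = 1" and "(U ^^ n) k = c *s w"
  shows "\<bar>c\<bar> = 1"
  using assms
proof (induction n arbitrary: c w)
  case (Suc n)
  have "(U ^^ n) k = U' (U ((U ^^ n) k))" by simp
  also have "\<dots> = U' (c *s w)" using Suc.prems(2) by simp
  also have "\<dots> = c *s U' w"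
    by (simp add: U'_def vec_eq_iff forall_2 matrix_vector_mult_def sum_2 algebra_simps)
  finally show ?case using Suc by blast
qed simp

lemma essential_orbit:
  assumes "k $ 1 \<le> 0" "k $ 2 \<ge> 0" "k \<noteq> 0" "\<bar>u k\<bar> / l ^ Suc n < 1/2" "\<And>c w. k = c *s w \<Longrightarrow> \<bar>c\<bar> = 1"
  shows "(U ^^ Suc n) k \<in> essential_resonances \<Omega>"
  unfolding essential_resonances_iff
proof (intro conjI allI impI)
  show "(U ^^ Suc n) k \<in> quasi_resonances \<Omega>" by (rule U_funpow_quasi_resonance[OF assms(1-4)])
  show "\<bar>c\<bar> = 1" if "(U ^^ Suc n) k = c *s w" for c w
    by (rule U_funpow_not_multiple[OF _ that]) (rule assms(5))
qed

lemma u_add: "u (x *s k + y *s k') = of_int x * u k + of_int y * u k'"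
  and v_add: "v (x *s k + y *s k') = of_int x * v k + of_int y * v k'"
  by (simp_all add: u_def v_def algebra_simps)

lemma h1_eq_minimum:
  assumes "k \<in> essential_resonances \<Omega>" "\<And>k'. k' \<in> essential_resonances \<Omega> \<Longrightarrow> g_star \<Omega> as \<rho> k \<epsilon> \<le> g_star \<Omega> as \<rho> k' \<epsilon>"
  shows "h1 \<Omega> as \<rho> \<epsilon> = g_star \<Omega> as \<rho> k \<epsilon>"
  unfolding h1_def by (rule cInf_eq_minimum) (use assms in auto)

text \<open>The vector \<open>S1\<close> may differ from \<open>k\<close> when the first minimum is attained more than once. In that case
  both the first and the second minimum have the same value, and the infimum without \<open>S1\<close> still attains it.\<close>

lemma h2_eq_second_minimum:
  assumes k: "k \<in> essential_resonances \<Omega>" "k' \<in> essential_resonances \<Omega>" "k' \<noteq> k"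
    and min1: "\<And>j. j \<in> essential_resonances \<Omega> \<Longrightarrow> g_star \<Omega> as \<rho> k \<epsilon> \<le> g_star \<Omega> as \<rho> j \<epsilon>"
    and min2: "\<And>j. j \<in> essential_resonances \<Omega> \<Longrightarrow> j \<noteq> k \<Longrightarrow> g_star \<Omega> as \<rho> k' \<epsilon> \<le> g_star \<Omega> as \<rho> j \<epsilon>"
  shows "h2 \<Omega> as \<rho> \<epsilon> = g_star \<Omega> as \<rho> k' \<epsilon>"
proof -
  let ?g = "\<lambda>k. g_star \<Omega> as \<rho> k \<epsilon>" and ?E = "essential_resonances \<Omega>"
  define s where "s = S1 \<Omega> as \<rho> \<epsilon>"
  have "is_arg_min ?g (\<lambda>j. j \<in> ?E) k" unfolding is_arg_min_linorder using k min1 by blast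
  then have "is_arg_min ?g (\<lambda>j. j \<in> ?E) s"
    unfolding s_def S1_def arg_min_on_def arg_min_def by (rule someI)
  then have s: "s \<in> ?E" "?g s \<le> ?g j" if "j \<in> ?E" for j
    using that by (auto simp: is_arg_min_linorder)
  have "Inf (?g ` (?E - {s})) = ?g k'"
  proof (cases "s = k")
    case True
    then show ?thesis by (intro cInf_eq_minimum) (use k min2 in auto)
  next
    case False
    have "?g k' = ?g k" using s(2)[OF k(1)] min1[OF k(2)] min2[OF s(1)[OF k(1)] False] by simp
    moreover have "?g k \<in> ?g ` (?E - {s})" using k(1) False by auto
    ultimately show ?thesis using min1 by (intro cInf_eq_minimum) auto
  qed
  then show ?thesis by (simp add: h2_def s_def)
qed

end

text \<open>The vector \<open>kb\<close> starts an orbit on which \<open>|u v|\<close> is minimal. Its quadrant ensures that its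
  images under high powers of \<open>U\<close> are quasi-resonances.\<close>

locale resonant_orbit = resonant_lattice +
  fixes kb :: "int^2" and \<rho> :: real
  assumes kb: "kb $ 1 \<le> 0" "kb $ 2 \<ge> 0" "kb \<noteq> 0"
    and norm_min: "\<And>k. k \<in> quasi_resonances \<Omega> \<Longrightarrow> \<bar>u kb * v kb\<bar> \<le> \<bar>u k * v k\<bar>"
    and rho: "\<rho> > 0"
begin

definition us :: real where "us = \<bar>u kb\<bar>"
definition vs :: real where "vs = v kb"
text \<open>The phase \<open>C \<epsilon>\<^sup>1\<^sup>/\<^sup>4 l\<^sup>n\<close> is \<open>1\<close> exactly at the center of \<open>U\<^sup>n kb\<close>.\<close>

definition C :: real where "C = \<kappa> * vs / D0 \<Omega> as \<rho> powr (1/4)"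

lemma us_pos: "us > 0"
  using kb(3) u_eq_0_iff by (simp add: us_def)

lemma vs_pos: "vs > 0"
proof -
  have nz: "kb $ 1 \<noteq> 0 \<or> kb $ 2 \<noteq> 0" using kb(3) by (auto simp: vec_eq_iff forall_2)
  have "of_int t2 * \<Omega> * of_int (kb $ 1) \<le> 0" "real_of_int t3 * of_int (kb $ 2) \<ge> 0"
    using kb entries Omega by (auto intro!: mult_nonneg_nonpos)
  moreover have "of_int t2 * \<Omega> * of_int (kb $ 1) \<noteq> 0 \<or> real_of_int t3 * of_int (kb $ 2) \<noteq> 0"
    using nz entries Omega by auto
  ultimately show ?thesis unfolding vs_def v_def by linarith
qed

lemma power_small: "\<exists>N. \<forall>n\<ge>N. x / l ^ n < (1/2 :: real)"
proof -
  obtain N where N: "2 * x < l ^ N" using real_arch_pow[OF l_gt_1] by blast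
  have "x / l ^ n < 1/2" if "N \<le> n" for n
    using order_less_le_trans[OF N power_increasing[OF that]] l_gt_1 by (simp add: field_simps)
  then show ?thesis by blast
qed

lemma gam_min: "gam_min \<Omega> as = \<kappa> * (us * vs)"
proof -
  obtain n where n: "\<bar>u kb\<bar> / l ^ Suc n < 1/2" using power_small[of "\<bar>u kb\<bar>"] by (meson le_SucI order_refl)
  have "\<bar>u ((U ^^ Suc n) kb) * v ((U ^^ Suc n) kb)\<bar> = us * vs"
    unfolding abs_u_v_funpow using vs_pos by (simp add: us_def vs_def abs_mult)
  moreover have "us * vs = \<bar>u kb * v kb\<bar>" using vs_pos by (simp add: us_def vs_def abs_mult)
  ultimately show ?thesis
    using gam_min_eq[OF _ U_funpow_quasi_resonance[OF kb n]] norm_min by metis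
qed

lemma gam_min_pos: "gam_min \<Omega> as > 0"
  using gam_min kappa_pos us_pos vs_pos by simp

lemma D0_pos: "D0 \<Omega> as \<rho> > 0"
  using gam_min_pos rho by (simp add: D0_def)

lemma C_pos: "C > 0"
  using kappa_pos vs_pos D0_pos by (simp add: C_def)

text \<open>Coordinates normalised so that \<open>U kb\<close> has both coordinates \<open>1\<close>, which places \<open>U kb\<close> and \<open>kb\<close> with their
  centers at the two ends \<open>1\<close> and \<open>l\<close> of the window.\<close>

definition V :: "int^2 \<Rightarrow> real" where "V k = \<bar>v k\<bar> / (vs * l)"
definition W :: "int^2 \<Rightarrow> real" where "W k = l * \<bar>u k\<bar> / us"

lemma g_star_level:
  assumes k: "(U ^^ m) k \<in> quasi_resonances \<Omega>" and e: "\<epsilon> > 0"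
  shows "g_star \<Omega> as \<rho> ((U ^^ m) k) \<epsilon> = hyp_arc (V k) (W k) (C * \<epsilon> powr (1/4) * l ^ Suc m)"
proof -
  let ?d = "(\<epsilon> / D0 \<Omega> as \<rho>) powr (1/4)"
  have d: "C * \<epsilon> powr (1/4) = \<kappa> * vs * ?d"
    using e D0_pos by (simp add: C_def powr_divide)
  have c: "\<kappa> * vs * l ^ Suc m > 0" using kappa_pos vs_pos l_gt_1 by simp
  have 1: "\<kappa> * \<bar>v ((U ^^ m) k)\<bar> = V k * (\<kappa> * vs * l ^ Suc m)"
    using vs_pos l_gt_1 by (simp add: V_def v_funpow abs_mult)
  have 2: "\<bar>u ((U ^^ m) k)\<bar> / gam_min \<Omega> as = W k / (\<kappa> * vs * l ^ Suc m)"
    using us_pos l_gt_1 by (simp add: W_def abs_u_funpow gam_min mult_ac)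
  have "g_star \<Omega> as \<rho> ((U ^^ m) k) \<epsilon> = hyp_arc (V k * (\<kappa> * vs * l ^ Suc m)) (W k / (\<kappa> * vs * l ^ Suc m)) ?d"
    unfolding g_star_eq[OF rho gam_min_pos e k] 1 2 ..
  also have "\<dots> = hyp_arc (V k) (W k) (\<kappa> * vs * l ^ Suc m * ?d)"
    by (rule hyp_arc_rescale[OF c])
  finally show ?thesis unfolding d by (simp add: mult_ac)
qed

lemma V_kb: "V kb = 1 / l" "W kb = l" "V (U kb) = 1" "W (U kb) = 1"
  using us_pos vs_pos l_gt_1 sigma_squared(3)
  by (simp_all add: V_def W_def v_U u_U abs_mult flip: us_def vs_def)

lemma V_comb: "V (x *s kb + y *s U kb) = \<bar>x / l + y\<bar>"
proof -
  have "v (x *s kb + y *s U kb) = (x / l + y) * (vs * l)"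
    using l_gt_1 by (simp add: v_add v_U vs_def algebra_simps)
  then show ?thesis using vs_pos l_gt_1 by (simp add: V_def abs_mult)
qed

lemma W_comb: "W (x *s kb + y *s U kb) = \<bar>l * x + \<sigma> * y\<bar>"
proof -
  have "l * u (x *s kb + y *s U kb) = (l * x + \<sigma> * y) * u kb"
    using l_gt_1 by (simp add: u_add u_U algebra_simps)
  then have "l * \<bar>u (x *s kb + y *s U kb)\<bar> = \<bar>l * x + \<sigma> * y\<bar> * us"
    using l_gt_1 by (metis abs_mult abs_of_pos less_trans us_def zero_less_one)
  then show ?thesis using us_pos by (simp add: W_def)
qed

text \<open>Taking \<open>\<epsilon>0\<close> small makes every level that occurs large, so a description of \<open>h\<close> that is valid from some level
  on is valid on all of \<open>(0, \<epsilon>0)\<close>.\<close>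

lemma log_scaling_exists:
  assumes h: "\<And>m \<epsilon>. m \<ge> N \<Longrightarrow> \<epsilon> > 0 \<Longrightarrow> 1 \<le> C * \<epsilon> powr (1/4) * l ^ Suc m \<Longrightarrow> C * \<epsilon> powr (1/4) * l ^ Suc m \<le> l
    \<Longrightarrow> h \<epsilon> = F (C * \<epsilon> powr (1/4) * l ^ Suc m)"
  shows "\<exists>\<epsilon>0. log_scaling C l \<epsilon>0 h F"
proof -
  define \<epsilon>0 where "\<epsilon>0 = (1 / (C * l ^ N)) powr 4"
  have l: "l ^ N \<ge> 1" "l > 0" using l_gt_1 by simp_all
  have e0: "\<epsilon>0 > 0" "C * \<epsilon>0 powr (1/4) = 1 / l ^ N"
    using C_pos l_gt_1 by (simp_all add: \<epsilon>0_def powr_powr del: powr_numeral)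
  have "h \<epsilon> = F (C * \<epsilon> powr (1/4) * l ^ n)"
    if e: "0 < \<epsilon>" "\<epsilon> < \<epsilon>0" and t: "1 \<le> C * \<epsilon> powr (1/4) * l ^ n" "C * \<epsilon> powr (1/4) * l ^ n \<le> l" for \<epsilon> n
  proof -
    have "C * \<epsilon> powr (1/4) < 1 / l ^ N"
      unfolding e0(2)[symmetric] using e C_pos by (simp add: powr_less_mono2)
    then have "C * \<epsilon> powr (1/4) * l ^ n < 1 / l ^ N * l ^ n"
      using l by (intro mult_strict_right_mono) auto
    then have "1 < l ^ n / l ^ N" using t(1) by simp
    then have "l ^ N < l ^ n" using l by (simp add: field_simps)
    then have "N < n" using power_less_imp_less_exp[OF l_gt_1] by blast
    then obtain m where "n = Suc m" "N \<le> m" by (cases n) auto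
    then show ?thesis using h e t by blast
  qed
  moreover have "C * \<epsilon>0 powr (1/4) \<le> 1" unfolding e0(2) using l by simp
  ultimately have "log_scaling C l \<epsilon>0 h F"
    using C_pos l_gt_1 e0(1) by unfold_locales auto
  then show ?thesis by blast
qed

end

context resonant_orbit
begin

lemma essential_eventually:
  assumes "k $ 1 \<le> 0" "k $ 2 \<ge> 0" "k \<noteq> 0" "\<And>c w. k = c *s w \<Longrightarrow> \<bar>c\<bar> = 1"
  shows "\<exists>N. \<forall>m\<ge>N. (U ^^ m) k \<in> essential_resonances \<Omega>"
proof -
  obtain N where N: "\<forall>n\<ge>N. \<bar>u k\<bar> / l ^ n < 1/2" using power_small by blast
  have "(U ^^ m) k \<in> essential_resonances \<Omega>" if m: "m \<ge> Suc N" for m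
  proof -
    obtain m' where m': "m = Suc m'" using m by (cases m) auto
    have "\<bar>u k\<bar> / l ^ Suc m' < 1/2" using N[rule_format, of "Suc m'"] m unfolding m' by (simp del: power_Suc)
    then show ?thesis unfolding m' by (rule essential_orbit[OF assms(1-3) _ assms(4)])
  qed
  then show ?thesis by blast
qed

lemma U_funpow_scale: "(U ^^ m) (c *s k) = c *s (U ^^ m) k"
  by (induction m) (simp_all add: vec_eq_iff forall_2 algebra_simps)

lemma essential_preimage:
  assumes "j \<in> essential_resonances \<Omega>"
  obtains k where "j = (U ^^ m) k" "k \<noteq> 0" "j \<in> quasi_resonances \<Omega>"
proof
  show "j = (U ^^ m) ((U' ^^ m) j)" by simp
  show q: "j \<in> quasi_resonances \<Omega>" using assms essential_resonances_iff by blast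
  show "(U' ^^ m) j \<noteq> 0"
  proof
    assume "(U' ^^ m) j = 0"
    then have "j = (U ^^ m) (0 *s 0)" by (metis U_funpow_U' scaleR_zero_left vector_smult_lzero)
    then have "j = 0" unfolding U_funpow_scale by simp
    then show False using q quasi_resonances_iff by fastforce
  qed
qed

text \<open>Pulling back by \<open>U\<^sup>m\<close> moves the problem into the window \<open>[1, l]\<close>. It is enough to bound all nonzero lattice
  vectors from below, whereas only the minimiser has to be an essential resonance.\<close>

lemma h1_level:
  assumes e: "\<epsilon> > 0" and t: "t = C * \<epsilon> powr (1/4) * l ^ Suc m"
    and kc: "(U ^^ m) kc \<in> essential_resonances \<Omega>"
    and least: "\<And>k. k \<noteq> 0 \<Longrightarrow> V kc * t\<^sup>2 + W kc \<le> V k * t\<^sup>2 + W k"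
  shows "h1 \<Omega> as \<rho> \<epsilon> = hyp_arc (V kc) (W kc) t"
proof -
  have t0: "t > 0" using t C_pos e l_gt_1 by simp
  have g: "g_star \<Omega> as \<rho> ((U ^^ m) k) \<epsilon> = hyp_arc (V k) (W k) t" if "(U ^^ m) k \<in> quasi_resonances \<Omega>" for k
    unfolding t by (rule g_star_level[OF that e])
  have gkc: "g_star \<Omega> as \<rho> ((U ^^ m) kc) \<epsilon> = hyp_arc (V kc) (W kc) t"
    using g kc essential_resonances_iff by blast
  have "h1 \<Omega> as \<rho> \<epsilon> = g_star \<Omega> as \<rho> ((U ^^ m) kc) \<epsilon>"
  proof (rule h1_eq_minimum[OF kc])
    fix j assume "j \<in> essential_resonances \<Omega>"
    then obtain k where k: "j = (U ^^ m) k" "k \<noteq> 0" "j \<in> quasi_resonances \<Omega>" by (rule essential_preimage)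
    show "g_star \<Omega> as \<rho> ((U ^^ m) kc) \<epsilon> \<le> g_star \<Omega> as \<rho> j \<epsilon>"
      using least[OF k(2)] k(3) t0 unfolding gkc k(1) by (simp add: g hyp_arc_le_iff)
  qed
  then show ?thesis using gkc by simp
qed

text \<open>An essential resonance other than \<open>U\<^sup>m k1\<close> cannot be a multiple of it: the factor would be \<open>-1\<close>, but
  quasi-resonances have positive second component.\<close>

lemma h2_level:
  assumes e: "\<epsilon> > 0" and t: "t = C * \<epsilon> powr (1/4) * l ^ Suc m"
    and k1: "(U ^^ m) k1 \<in> essential_resonances \<Omega>" and k2: "(U ^^ m) k2 \<in> essential_resonances \<Omega>"
    and indep: "\<And>c. k2 \<noteq> c *s k1"
    and least: "\<And>k. k \<noteq> 0 \<Longrightarrow> V k1 * t\<^sup>2 + W k1 \<le> V k * t\<^sup>2 + W k"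
    and second: "\<And>k. (\<And>c. k \<noteq> c *s k1) \<Longrightarrow> V k2 * t\<^sup>2 + W k2 \<le> V k * t\<^sup>2 + W k"
  shows "h2 \<Omega> as \<rho> \<epsilon> = hyp_arc (V k2) (W k2) t"
proof -
  have t0: "t > 0" using t C_pos e l_gt_1 by simp
  have g: "g_star \<Omega> as \<rho> ((U ^^ m) k) \<epsilon> = hyp_arc (V k) (W k) t" if "(U ^^ m) k \<in> quasi_resonances \<Omega>" for k
    unfolding t by (rule g_star_level[OF that e])
  have q: "(U ^^ m) k1 \<in> quasi_resonances \<Omega>" "(U ^^ m) k2 \<in> quasi_resonances \<Omega>"
    using k1 k2 essential_resonances_iff by blast+
  have "h2 \<Omega> as \<rho> \<epsilon> = g_star \<Omega> as \<rho> ((U ^^ m) k2) \<epsilon>"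
  proof (rule h2_eq_second_minimum[OF k1 k2])
    show "(U ^^ m) k2 \<noteq> (U ^^ m) k1"
    proof
      assume *: "(U ^^ m) k2 = (U ^^ m) k1"
      have "inj U" by (metis U'_U injI)
      then have "k2 = k1" using * injD[OF inj_fn] by metis
      then show False using indep[of 1] by simp
    qed
  next
    fix j assume "j \<in> essential_resonances \<Omega>"
    then obtain k where k: "j = (U ^^ m) k" "k \<noteq> 0" "j \<in> quasi_resonances \<Omega>" by (rule essential_preimage)
    show "g_star \<Omega> as \<rho> ((U ^^ m) k1) \<epsilon> \<le> g_star \<Omega> as \<rho> j \<epsilon>"
      using least[OF k(2)] k(3) t0 unfolding k(1) by (simp add: g q hyp_arc_le_iff)
  next
    fix j assume j: "j \<in> essential_resonances \<Omega>" "j \<noteq> (U ^^ m) k1"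
    then obtain k where k: "j = (U ^^ m) k" "k \<noteq> 0" "j \<in> quasi_resonances \<Omega>" using essential_preimage by blast
    have "k \<noteq> c *s k1" for c
    proof
      assume "k = c *s k1"
      then have jc: "j = c *s (U ^^ m) k1" using k(1) by (simp add: U_funpow_scale)
      then have "\<bar>c\<bar> = 1" using j(1) essential_resonances_iff by blast
      moreover have "c \<noteq> 1" using jc j(2) by auto
      ultimately have "c = - 1" by linarith
      then show False using jc k(3) q(1) by (simp add: quasi_resonances_iff)
    qed
    from second[OF this] show "g_star \<Omega> as \<rho> ((U ^^ m) k2) \<epsilon> \<le> g_star \<Omega> as \<rho> j \<epsilon>"
      using k(3) t0 unfolding k(1) by (simp add: g q hyp_arc_le_iff)
  qed
  then show ?thesis using g q(2) by simp
qed

end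

section \<open>Continued fractions of period one and two\<close>

text \<open>Shifting the convergents by one period gives a fixed-point equation for the limit.\<close>

lemma periodic_cfrac_one:
  assumes "has_periodic_cfrac \<Omega> [a]" "0 < \<Omega>"
  shows "\<Omega> * (a + \<Omega>) = 1"
proof -
  define c where "c n = cfrac (map (\<lambda>i. [a] ! (i mod length [a])) [0..<n])" for n
  have c: "c \<longlonglongrightarrow> \<Omega>" using assms(1) by (simp add: has_periodic_cfrac_def c_def[abs_def])
  have "c (Suc n) = 1 / (real a + c n)" for n
    unfolding c_def map_upt_Suc by simp
  moreover have "(\<lambda>n. 1 / (real a + c n)) \<longlonglongrightarrow> 1 / (real a + \<Omega>)"
    using assms(2) by (intro tendsto_intros c) auto
  ultimately have "(\<lambda>n. c (Suc n)) \<longlonglongrightarrow> 1 / (real a + \<Omega>)" by simp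
  with LIMSEQ_Suc[OF c] have "\<Omega> = 1 / (real a + \<Omega>)" by (rule LIMSEQ_unique)
  then show ?thesis using assms(2) by (simp add: field_simps)
qed

lemma periodic_cfrac_two:
  assumes "has_periodic_cfrac \<Omega> [a, b]" "0 < \<Omega>"
  shows "\<Omega> * (a + 1 / (b + \<Omega>)) = 1"
proof -
  define f where "f i = [a, b] ! (i mod length [a, b])" for i
  define c where "c n = cfrac (map f [0..<n])" for n
  have c: "c \<longlonglongrightarrow> \<Omega>" using assms(1) by (simp add: has_periodic_cfrac_def c_def[abs_def] f_def[abs_def])
  have f: "f 0 = a" "f (Suc 0) = b" "f (Suc (Suc i)) = f i" for i
    by (simp_all add: f_def flip: numeral_2_eq_2)
  have "c (Suc (Suc n)) = 1 / (real a + 1 / (real b + c n))" for n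
    unfolding c_def map_upt_Suc by (simp add: f)
  moreover have pos: "real a + 1 / (real b + \<Omega>) > 0" using assms(2) by (simp add: add_nonneg_pos)
  then have "(\<lambda>n. 1 / (real a + 1 / (real b + c n))) \<longlonglongrightarrow> 1 / (real a + 1 / (real b + \<Omega>))"
    using assms(2) by (intro tendsto_intros c) auto
  ultimately have "(\<lambda>n. c (Suc (Suc n))) \<longlonglongrightarrow> 1 / (real a + 1 / (real b + \<Omega>))" by simp
  with LIMSEQ_Suc[OF LIMSEQ_Suc[OF c]] have eq: "\<Omega> = 1 / (real a + 1 / (real b + \<Omega>))"
    by (rule LIMSEQ_unique)
  have "z * X = 1" if "z = 1 / X" "X > 0" for z X :: real using that by simp
  from this[OF eq pos] show ?thesis .
qed

lemma lam_one: "lam \<Omega> [a] = 1 / \<Omega>"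
  by (simp add: lam_def)

lemma T_mat_one: "T_mat [a] = vector [vector [int a, 1], vector [1, 0]]"
  by (simp add: T_mat_def)

lemma T_mat_two: "T_mat [a, b] = vector [vector [int a * int b + 1, int a], vector [int b, 1]]"
  by (simp add: T_mat_def vec_eq_iff forall_2 matrix_matrix_mult_def sum_2 mat_def)

lemma resonant_lattice_one:
  assumes "has_periodic_cfrac \<Omega> [a]" "a \<ge> 1" "0 < \<Omega>" "\<Omega> < 1" "\<Omega> \<notin> \<rat>"
  shows "resonant_lattice \<Omega> [a] (int a) 1 1 0"
proof
  have "\<Omega> * (a + \<Omega>) = 1" by (rule periodic_cfrac_one) fact+
  then show "real_of_int (int a) + real_of_int 1 * \<Omega> = lam \<Omega> [a]"
    using assms(3) by (simp add: lam_one field_simps)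
qed (use assms in \<open>auto simp: T_mat_one lam_one\<close>)

lemma lam_two:
  assumes "has_periodic_cfrac \<Omega> [a, b]" "b \<ge> 1" "0 < \<Omega>"
  shows "lam \<Omega> [a, b] = a * (b + \<Omega>) + 1" "lam \<Omega> [a, b] * \<Omega> = b + \<Omega>"
proof -
  have eq: "\<Omega> * (a + 1 / (b + \<Omega>)) = 1" by (rule periodic_cfrac_two) fact+
  have "1 / (b + \<Omega>) < 1" "0 < 1 / (b + \<Omega>)" using assms by (auto simp: field_simps)
  moreover have "1 / \<Omega> = of_int (int a) + 1 / (b + \<Omega>)" using eq assms by (simp add: field_simps)
  ultimately have "frac (1 / \<Omega>) = 1 / (b + \<Omega>)" by (simp add: frac_unique_iff)
  then have lam: "lam \<Omega> [a, b] = (b + \<Omega>) / \<Omega>"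
    by (simp add: lam_def numeral_2_eq_2)
  then show "lam \<Omega> [a, b] * \<Omega> = b + \<Omega>" using assms by simp
  have "b + \<Omega> \<noteq> 0" using assms by simp
  then have "a * (b + \<Omega>) + 1 = (b + \<Omega>) * (a + 1 / (b + \<Omega>))" by (simp add: distrib_left mult.commute)
  then have "\<Omega> * (a * (b + \<Omega>) + 1) = (b + \<Omega>) * (\<Omega> * (a + 1 / (b + \<Omega>)))" by simp
  also have "\<dots> = b + \<Omega>" unfolding eq by simp
  finally have "\<Omega> * (a * (b + \<Omega>) + 1) = b + \<Omega>" .
  then show "lam \<Omega> [a, b] = a * (b + \<Omega>) + 1" using assms by (simp add: lam field_simps)
qed

lemma resonant_lattice_two:
  assumes "has_periodic_cfrac \<Omega> [a, b]" "a \<ge> 1" "b \<ge> 1" "0 < \<Omega>" "\<Omega> < 1" "\<Omega> \<notin> \<rat>"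
  shows "resonant_lattice \<Omega> [a, b] (int a * int b + 1) (int a) (int b) 1"
proof
  show "real_of_int (int a * int b + 1) + real_of_int (int a) * \<Omega> = lam \<Omega> [a, b]"
    "real_of_int (int b) + real_of_int 1 * \<Omega> = lam \<Omega> [a, b] * \<Omega>"
    using lam_two[OF assms(1,3,4)] by (simp_all add: algebra_simps)
qed (use assms in \<open>auto simp: T_mat_two\<close>)

text \<open>Descent along the continued fraction: if \<open>0 < q - a p\<close> and \<open>0 < p - b (q - a p)\<close>, then replacing \<open>(q, p)\<close> by
  these two numbers leaves the form unchanged and decreases \<open>q\<close>. When the descent stops, the two remaining
  parts of the form have the same sign, and one of them is at least \<open>a\<close> in absolute value.\<close>

lemma colored_form_ge:
  fixes a b :: int
  assumes ab: "1 \<le> a" "a \<le> b"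
  shows "0 \<le> p \<Longrightarrow> 0 \<le> q \<Longrightarrow> p \<noteq> 0 \<or> q \<noteq> 0 \<Longrightarrow> a \<le> \<bar>b * q * q - a * b * p * q - a * p * p\<bar>"
proof (induction "nat q" arbitrary: p q rule: less_induct)
  case less
  have sq: "1 \<le> x * x" if "x \<noteq> 0" for x :: int
    using that by (metis int_one_le_iff_zero_less not_square_less_zero linorder_neqE_linordered_idom mult_eq_0_iff)
  define r where "r = q - a * p"
  have Q: "b * q * q - a * b * p * q - a * p * p = b * q * r - a * (p * p)"
    by (simp add: r_def algebra_simps)
  have asq: "a \<le> a * (x * x)" if "x \<noteq> 0" for x
    using mult_left_mono[OF sq[OF that], of a] ab by simp
  show ?case
  proof (cases "p = 0")
    case True
    then have "b * 1 \<le> b * (q * q)" using sq[of q] less.prems ab by (intro mult_left_mono) auto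
    then have "a \<le> b * (q * q)" using ab by linarith
    then show ?thesis using True by (simp add: mult.assoc)
  next
    case False
    show ?thesis
    proof (cases "r \<le> 0")
      case True
      have "b * q * r \<le> 0" using True less.prems ab by (intro mult_nonneg_nonpos) auto
      then show ?thesis unfolding Q using asq[OF False] by linarith
    next
      case r: False
      have q: "q = r + a * p" by (simp add: r_def)
      have Q': "b * q * q - a * b * p * q - a * p * p = b * r * r + a * p * (b * r - p)"
        unfolding q by (simp add: algebra_simps)
      show ?thesis
      proof (cases "p \<le> b * r")
        case True
        then have "0 \<le> a * p * (b * r - p)" using less.prems ab by simp
        moreover have "b * 1 \<le> b * r * r" unfolding mult.assoc using sq[of r] r ab by (intro mult_left_mono) auto
        ultimately show ?thesis unfolding Q' using ab by linarith
      next
        case False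
        define p' where "p' = p - b * r"
        have p: "p = b * r + p'" "p' > 0" using False by (auto simp: p'_def)
        have "r < q" using ab \<open>p \<noteq> 0\<close> less.prems by (simp add: r_def)
        then have "nat r < nat q" using r by simp
        from less.hyps[OF this, of p'] have "a \<le> \<bar>b * r * r - a * b * p' * r - a * p' * p'\<bar>"
          using p r by simp
        also have "b * r * r - a * b * p' * r - a * p' * p' = b * r * r + a * p * (b * r - p)"
          unfolding p(1) by (simp add: algebra_simps)
        finally show ?thesis unfolding Q' .
      qed
    qed
  qed
qed

text \<open>The product \<open>u v\<close> is \<open>\<Omega>\<close> times the integral form of \<open>colored_form_ge\<close>, whose smallest absolute value \<open>a\<close> is
  attained at \<open>(-1, 0)\<close>.\<close>

lemma resonant_orbit_two:
  assumes cf: "has_periodic_cfrac \<Omega> [a, b]" and ab: "1 \<le> a" "a \<le> b"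
    and Om: "0 < \<Omega>" "\<Omega> < 1" "\<Omega> \<notin> \<rat>" and rho: "\<rho> > 0"
  shows "resonant_orbit \<Omega> [a, b] (int a * int b + 1) (int a) (int b) 1 (vector [-1, 0]) \<rho>"
proof -
  have b: "1 \<le> b" using ab by simp
  interpret resonant_lattice \<Omega> "[a, b]" "int a * int b + 1" "int a" "int b" 1
    by (rule resonant_lattice_two) fact+
  have Oeq: "a * (\<Omega> * \<Omega>) = b - a * b * \<Omega>"
    using lam_two[OF cf b Om(1)] by (simp add: algebra_simps)
  have uv: "u k * v k = \<Omega> * of_int (int b * k $ 2 * k $ 2 - int a * int b * (- k $ 1) * k $ 2 - int a * (- k $ 1) * (- k $ 1))" for k
  proof -
    have "u k * v k = \<Omega> * (b * of_int (k $ 2) * of_int (k $ 2) - a * of_int (k $ 1) * of_int (k $ 1)) + (b - a * (\<Omega> * \<Omega>)) * (of_int (k $ 1) * of_int (k $ 2))"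
      by (simp add: u_def v_def algebra_simps)
    then show ?thesis unfolding Oeq by (simp add: algebra_simps)
  qed
  show ?thesis
  proof
    show "(vector [-1, 0] :: int^2) $ 1 \<le> 0" "(vector [-1, 0] :: int^2) $ 2 \<ge> 0" "(vector [-1, 0] :: int^2) \<noteq> 0"
      by (simp_all add: vec_eq_iff forall_2)
    fix k assume k: "k \<in> quasi_resonances \<Omega>"
    define Q where "Q = int b * k $ 2 * k $ 2 - int a * int b * (- k $ 1) * k $ 2 - int a * (- k $ 1) * (- k $ 1)"
    have "int a \<le> \<bar>Q\<bar>" unfolding Q_def
      using k quasi_resonance_fst[OF k] ab by (intro colored_form_ge) (auto simp: quasi_resonances_iff)
    then have "\<Omega> * real_of_int (int a) \<le> \<Omega> * real_of_int \<bar>Q\<bar>" using Om by (intro mult_left_mono) (simp_all only: of_int_le_iff less_imp_le)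
    moreover have "\<bar>u k * v k\<bar> = \<Omega> * real_of_int \<bar>Q\<bar>" unfolding uv Q_def[symmetric] using Om by (simp add: abs_mult)
    ultimately show "\<bar>u (vector [-1, 0]) * v (vector [-1, 0])\<bar> \<le> \<bar>u k * v k\<bar>"
      using Om by (simp add: u_def v_def mult.commute)
  qed fact
qed

section \<open>The three families of frequencies\<close>

lemma primitive_vector:
  fixes k w :: "int^2"
  assumes "k $ 1 = - 1 \<or> k $ 2 = 1" "k = c *s w"
  shows "\<bar>c\<bar> = 1"
proof -
  have "c * w $ 1 = - 1 \<or> c * w $ 2 = 1" using assms by auto
  then have "c dvd - 1 \<or> c dvd 1" by (metis dvd_triv_left)
  then show ?thesis by auto
qed

lemma square_le_iff_le_sqrt: "t \<ge> 0 \<Longrightarrow> x \<ge> 0 \<Longrightarrow> t \<le> sqrt x \<longleftrightarrow> t\<^sup>2 \<le> x"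
  using real_sqrt_le_iff[of "t\<^sup>2" x] by simp

lemma le_div_sqrt_iff:
  assumes "t \<ge> 0" "x > 0" "l > 0"
  shows "t \<le> l / sqrt x \<longleftrightarrow> t\<^sup>2 \<le> l\<^sup>2 / x"
proof -
  have "l / sqrt x = sqrt (l\<^sup>2 / x)" using assms by (simp add: real_sqrt_divide)
  then show ?thesis using square_le_iff_le_sqrt[of t "l\<^sup>2 / x"] assms by simp
qed

text \<open>Here \<open>u v\<close> is \<open>\<Omega>\<close> times a nonvanishing integral form that takes the value \<open>1\<close> at \<open>(0, 1)\<close>. The vectors
  \<open>kb\<close> and \<open>U kb\<close> form a basis of the lattice, and the determinant \<open>-1\<close> enters as the sign in
  \<open>lower_bound_metallic\<close>.\<close>

lemma metallic_h1:
  assumes cf: "has_periodic_cfrac \<Omega> [a]" and a: "a \<ge> 1" and Om: "0 < \<Omega>" "\<Omega> < 1" "\<Omega> \<notin> \<rat>" and rho: "\<rho> > 0"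
  defines "h \<equiv> h1 \<Omega> [a] \<rho>" and "L \<equiv> lam \<Omega> [a]"
  shows "\<exists>\<epsilon>0>0. log_periodic_on h (L ^ 4) \<epsilon>0 \<and>
          (\<forall>I\<in>log_periods (L ^ 4) \<epsilon>0. \<exists>\<epsilon>c.
             {\<epsilon>\<in>I. corner h \<epsilon>} = {\<epsilon>c} \<and> h \<epsilon>c = J1 L \<and> maximum_on h I (J1 L)) \<and>
          (\<forall>x y. 0 < x \<and> x < y \<and> y < \<epsilon>0 \<and> corner h x \<and> corner h y \<and>
                 \<not> (\<exists>w\<in>{x<..<y}. corner h w) \<longrightarrow> ln y - ln x = 4 * ln L)"
proof -
  interpret resonant_lattice \<Omega> "[a]" "int a" 1 1 0
    by (rule resonant_lattice_one) fact+
  define kb :: "int^2" where "kb = vector [0, 1]"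
  have Oeq: "\<Omega> * \<Omega> = 1 - a * \<Omega>" using periodic_cfrac_one[OF cf Om(1)] by (simp add: algebra_simps)
  have uv: "u k * v k = \<Omega> * of_int (k $ 2 * k $ 2 + a * k $ 1 * k $ 2 - k $ 1 * k $ 1)" for k
  proof -
    have "u k * v k = \<Omega> * (of_int (k $ 2) * of_int (k $ 2) - of_int (k $ 1) * of_int (k $ 1)) + (1 - \<Omega> * \<Omega>) * (of_int (k $ 1) * of_int (k $ 2))"
      by (simp add: u_def v_def algebra_simps)
    then show ?thesis unfolding Oeq by (simp add: algebra_simps)
  qed
  interpret resonant_orbit \<Omega> "[a]" "int a" 1 1 0 kb \<rho>
  proof
    show "kb $ 1 \<le> 0" "kb $ 2 \<ge> 0" "kb \<noteq> 0" by (simp_all add: kb_def vec_eq_iff forall_2)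
    fix k assume k: "k \<in> quasi_resonances \<Omega>"
    have "u k \<noteq> 0" using k u_eq_0_iff quasi_resonances_iff by fastforce
    then have "u k * v k \<noteq> 0" using v_pos[OF k] by simp
    then have "k $ 2 * k $ 2 + a * k $ 1 * k $ 2 - k $ 1 * k $ 1 \<noteq> 0"
      unfolding uv by (metis mult_zero_right of_int_0)
    from abs_mult_int_ge[OF this, of \<Omega>] show "\<bar>u kb * v kb\<bar> \<le> \<bar>u k * v k\<bar>"
      unfolding uv using Om by (simp add: kb_def mult.commute)
  qed fact
  have sg: "\<sigma> = - 1" by (simp add: \<sigma>_def)
  have low: "min (s + 1) (s / l + l) \<le> V k * s + W k" if "k \<noteq> 0" "1 \<le> s" "s \<le> l\<^sup>2" for k s
  proof -
    define x y where "x = k $ 2 + a * k $ 1" and "y = - k $ 1"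
    have k: "k = x *s kb + y *s U kb" by (simp add: kb_def vec_eq_iff forall_2 x_def y_def)
    have "x \<noteq> 0 \<or> y \<noteq> 0" using that(1) k by auto
    from lower_bound_metallic[OF l_gt_1 this that(2,3)] show ?thesis
      unfolding k V_comb W_comb sg by simp
  qed
  define F where "F t = (if t \<le> sqrt l then hyp_arc 1 1 t else hyp_arc (1 / l) l t)" for t
  obtain N where N: "\<forall>m\<ge>N. (U ^^ m) kb \<in> essential_resonances \<Omega>"
    using essential_eventually[OF kb] primitive_vector[of kb] by (auto simp: kb_def)
  have "h \<epsilon> = F t" if m: "m \<ge> N" and e: "\<epsilon> > 0" and t: "t = C * \<epsilon> powr (1/4) * l ^ Suc m" "1 \<le> t" "t \<le> l" for m \<epsilon> t
  proof -
    have "(U ^^ Suc m) kb \<in> essential_resonances \<Omega>" using N[rule_format, of "Suc m"] m by (simp only: le_SucI)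
    then have E: "(U ^^ m) kb \<in> essential_resonances \<Omega>" "(U ^^ m) (U kb) \<in> essential_resonances \<Omega>"
      using N m by (simp_all add: funpow_swap1)
    have t2: "1 \<le> t\<^sup>2" "t\<^sup>2 \<le> l\<^sup>2" using t(2,3) by (auto simp: power_mono)
    have sq: "t \<le> sqrt l \<longleftrightarrow> t\<^sup>2 \<le> l" using t(2) l_gt_1 by (intro square_le_iff_le_sqrt) auto
    show ?thesis
    proof (cases "t \<le> sqrt l")
      case True
      have "t\<^sup>2 * (l - 1) \<le> l * (l - 1)" using True sq l_gt_1 by (intro mult_right_mono) auto
      then have "t\<^sup>2 + 1 \<le> t\<^sup>2 / l + l" using l_gt_1 by (simp add: field_simps power2_eq_square)
      then have "h \<epsilon> = hyp_arc (V (U kb)) (W (U kb)) t" unfolding h_def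
        using low[OF _ t2] by (intro h1_level[OF e t(1) E(2)]) (simp add: V_kb)
      then show ?thesis using True by (simp add: F_def V_kb)
    next
      case False
      have "l * (l - 1) \<le> t\<^sup>2 * (l - 1)" using False sq l_gt_1 by (intro mult_right_mono) auto
      then have "t\<^sup>2 / l + l \<le> t\<^sup>2 + 1" using l_gt_1 by (simp add: field_simps power2_eq_square)
      then have "h \<epsilon> = hyp_arc (V kb) (W kb) t" unfolding h_def
        using low[OF _ t2] by (intro h1_level[OF e t(1) E(1)]) (simp add: V_kb)
      then show ?thesis using False by (simp add: F_def V_kb)
    qed
  qed
  then obtain \<epsilon>0 where "log_scaling C l \<epsilon>0 h F" using log_scaling_exists[of N h F] by blast
  then interpret log_scaling C l \<epsilon>0 h F .
  show ?thesis unfolding L_def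
    using pos0 log_periodic metallic_profile[OF F_def] by blast
qed
text \<open>The vectors \<open>kb\<close> and \<open>U kb\<close> form a basis and \<open>k' = U kb - kb\<close>. For \<open>t \<le> \<surd>l\<close> the first minimum is at \<open>U kb\<close>
  and the second at \<open>k'\<close> or \<open>kb\<close>; for \<open>t \<ge> \<surd>l\<close> the roles of \<open>kb\<close> and \<open>U kb\<close> are exchanged.\<close>

lemma golden_colored_h2:
  assumes cf: "has_periodic_cfrac \<Omega> [1, b]" and b: "b \<ge> 2" and Om: "0 < \<Omega>" "\<Omega> < 1" "\<Omega> \<notin> \<rat>" and rho: "\<rho> > 0"
  defines "h \<equiv> h2 \<Omega> [1, b] \<rho>" and "L \<equiv> lam \<Omega> [1, b]"
  shows "\<exists>\<epsilon>0>0. log_periodic_on h (L ^ 4) \<epsilon>0 \<and>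
          (\<forall>I\<in>log_periods (L ^ 4) \<epsilon>0.
             (\<exists>C \<subseteq> {\<epsilon>\<in>I. corner h \<epsilon>}. card C = 3) \<and>
             minimum_on h I (J1 L) \<and> (\<exists>M. maximum_on h I M \<and> M < J2 L))"
proof -
  \<comment> \<open>Keeps the period in the form \<open>[1, b]\<close>, on which the constants of the interpreted locale depend.\<close>
  note [simp del] = One_nat_def
  define kb :: "int^2" where "kb = vector [-1, 0]"
  define k' :: "int^2" where "k' = vector [0, 1]"
  interpret resonant_orbit \<Omega> "[1, b]" "int b + 1" 1 "int b" 1 kb \<rho>
    unfolding kb_def using resonant_orbit_two[of \<Omega> 1 b \<rho>] assms by simp
  have b1: "1 \<le> b" using b by simp
  have lam: "l = b + \<Omega> + 1" "l * \<Omega> = b + \<Omega>" using lam_two[OF cf b1 Om(1)] by simp_all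
  have l3: "l > 3" using lam Om b by simp
  have sg: "\<sigma> = 1" unfolding \<sigma>_def by simp
  define c d where "c = 1 - 1 / l" and "d = l - 1"
  define xx yy where "xx k = - k $ 1 - k $ 2" and "yy k = k $ 2" for k :: "int^2"
  have k: "k = xx k *s kb + yy k *s U kb" for k :: "int^2"
    by (simp add: kb_def vec_eq_iff forall_2 xx_def yy_def)
  have VW: "V k = \<bar>xx k / l + yy k\<bar>" "W k = \<bar>l * xx k + yy k\<bar>" for k
    using V_comb[of "xx k" "yy k"] W_comb[of "xx k" "yy k"] k[of k] by (simp_all add: sg)
  have VW': "V k' = c" "W k' = d"
    unfolding VW using l3 by (simp_all add: k'_def xx_def yy_def c_def d_def)
  have second1: "min (s / l + l) (c * s + d) \<le> V k * s + W k" if "xx k \<noteq> 0" "1 \<le> s" "s \<le> l" for k s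
    using second_bound_golden[OF l3 that] unfolding VW c_def d_def by simp
  \<comment> \<open>The reflection \<open>s \<mapsto> l\<^sup>2 / s\<close> exchanges the basis vectors; the bound is multiplied by \<open>s / l\<close>.\<close>
  have second2: "min (s + 1) (c * s + d) \<le> V k * s + W k" if y: "yy k \<noteq> 0" and s: "l \<le> s" "s \<le> l\<^sup>2" for k s
  proof -
    have s0: "s > 0" using s l3 by simp
    have s': "1 \<le> l\<^sup>2 / s" "l\<^sup>2 / s \<le> l" using s s0 l3 by (auto simp: field_simps power2_eq_square)
    have mul: "s / l * (A * (l\<^sup>2 / s) + B) = B / l * s + A * l" for A B
      using s0 l3 by (simp add: field_simps power2_eq_square)
    have "min (1 / l * (l\<^sup>2 / s) + l) ((1 - 1 / l) * (l\<^sup>2 / s) + (l - 1)) \<le> \<bar>yy k / l + xx k\<bar> * (l\<^sup>2 / s) + \<bar>l * yy k + xx k\<bar>"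
      by (rule second_bound_golden[OF l3 y s'])
    then have "s / l * min (1 / l * (l\<^sup>2 / s) + l) ((1 - 1 / l) * (l\<^sup>2 / s) + (l - 1))
       \<le> s / l * (\<bar>yy k / l + xx k\<bar> * (l\<^sup>2 / s) + \<bar>l * yy k + xx k\<bar>)"
      using s0 l3 by (intro mult_left_mono) auto
    then have main: "min (l / l * s + 1 / l * l) ((l - 1) / l * s + (1 - 1 / l) * l)
      \<le> \<bar>l * yy k + xx k\<bar> / l * s + \<bar>yy k / l + xx k\<bar> * l"
      unfolding mul min_mult_distrib_left using s0 l3 by (simp add: mul)
    have 1: "\<bar>l * yy k + xx k\<bar> / l = V k"
    proof -
      have "(l * yy k + xx k) / l = xx k / l + yy k" using l3 by (simp add: add_divide_distrib)
      then show ?thesis unfolding VW using l3 by (metis abs_divide abs_of_pos l_gt_1 less_trans zero_less_one)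
    qed
    have 2: "\<bar>yy k / l + xx k\<bar> * l = W k"
      unfolding VW using l3 by (intro abs_scale) (simp_all add: algebra_simps)
    have 3: "(l - 1) / l = c" "(1 - 1 / l) * l = d" using l3 by (simp_all add: c_def d_def field_simps)
    show ?thesis using main l3 unfolding 1 2 3 by simp
  qed
  have first1: "s + 1 \<le> V k * s + W k" if "k \<noteq> 0" "1 \<le> s" "s \<le> l" for k s
  proof (cases "xx k = 0")
    case True
    then have "yy k \<noteq> 0" using that(1) k[of k] by auto
    then have "1 \<le> \<bar>real_of_int (yy k)\<bar>" by (rule abs_int_ge_1)
    then have "1 * (s + 1) \<le> \<bar>real_of_int (yy k)\<bar> * (s + 1)" using that by (intro mult_right_mono) auto
    then show ?thesis unfolding VW True by (simp add: algebra_simps)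
  next
    case False
    have "s * (l - 1) \<le> l * (l - 1)" using that l3 by (intro mult_right_mono) auto
    then have "s + 1 \<le> s / l + l" using l3 by (simp add: field_simps)
    moreover have "s / l \<le> 1" using that l3 by simp
    moreover have "c * s + d = s - s / l + l - 1" by (simp add: c_def d_def algebra_simps)
    ultimately have "s + 1 \<le> s / l + l" "s + 1 \<le> c * s + d" using l3 by linarith+
    then show ?thesis using second1[OF False that(2,3)] by simp
  qed
  have first2: "s / l + l \<le> V k * s + W k" if "k \<noteq> 0" "l \<le> s" "s \<le> l\<^sup>2" for k s
  proof (cases "yy k = 0")
    case True
    then have "xx k \<noteq> 0" using that(1) k[of k] by auto
    then have "1 \<le> \<bar>real_of_int (xx k)\<bar>" by (rule abs_int_ge_1)
    then have "1 * (s / l + l) \<le> \<bar>real_of_int (xx k)\<bar> * (s / l + l)" using that l3 by (intro mult_right_mono) auto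
    then show ?thesis unfolding VW True using l3 by (simp add: algebra_simps abs_mult)
  next
    case False
    have "l * (l - 1) \<le> s * (l - 1)" using that l3 by (intro mult_right_mono) auto
    then have "s / l + l \<le> s + 1" using l3 by (simp add: field_simps)
    moreover have "1 \<le> s * (1 - 2 / l)"
    proof -
      have "l * (1 - 2 / l) \<le> s * (1 - 2 / l)" using that l3 by (intro mult_right_mono) auto
      moreover have "l * (1 - 2 / l) = l - 2" using l3 by (simp add: field_simps)
      ultimately show ?thesis using l3 by simp
    qed
    then have "s / l + l \<le> c * s + d" by (simp add: c_def d_def algebra_simps)
    ultimately show ?thesis using second2[OF False that(2,3)] by simp
  qed
  define b1 where "b1 = sqrt (l / (l - 2))"
  define F where "F t = (if t \<le> b1 then hyp_arc c d t else if t \<le> sqrt l then hyp_arc (1 / l) l t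
     else if t \<le> l / b1 then hyp_arc 1 1 t else hyp_arc c d t)" for t
  obtain N1 where N1: "\<forall>m\<ge>N1. (U ^^ m) kb \<in> essential_resonances \<Omega>"
    using essential_eventually[OF kb] primitive_vector[of kb] by (auto simp: kb_def)
  have "\<exists>N. \<forall>m\<ge>N. (U ^^ m) k' \<in> essential_resonances \<Omega>"
    by (rule essential_eventually) (use primitive_vector[of k'] in \<open>auto simp: k'_def vec_eq_iff forall_2\<close>)
  then obtain N2 where N2: "\<forall>m\<ge>N2. (U ^^ m) k' \<in> essential_resonances \<Omega>" by blast
  have indep: "kb \<noteq> c *s U kb" "U kb \<noteq> c *s kb" "k' \<noteq> c *s U kb" "k' \<noteq> c *s kb" for c
    by (auto simp: kb_def k'_def vec_eq_iff forall_2)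
  have x0: "xx k \<noteq> 0" if "\<And>c. k \<noteq> c *s U kb" for k using k[of k] that by force
  have y0: "yy k \<noteq> 0" if "\<And>c. k \<noteq> c *s kb" for k using k[of k] that by force
  have "h \<epsilon> = F t" if m: "m \<ge> max N1 N2" and e: "\<epsilon> > 0" and t: "t = C * \<epsilon> powr (1/4) * l ^ Suc m" "1 \<le> t" "t \<le> l" for m \<epsilon> t
  proof -
    have "(U ^^ Suc m) kb \<in> essential_resonances \<Omega>"
      using N1[rule_format, of "Suc m"] m by (simp only: le_SucI max.bounded_iff)
    then have E: "(U ^^ m) kb \<in> essential_resonances \<Omega>" "(U ^^ m) (U kb) \<in> essential_resonances \<Omega>"
       "(U ^^ m) k' \<in> essential_resonances \<Omega>"
      using N1 N2 m by (simp_all add: funpow_swap1)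
    have t2: "1 \<le> t\<^sup>2" "t\<^sup>2 \<le> l\<^sup>2" using t(2,3) by (auto simp: power_mono)
    have sq: "t \<le> sqrt l \<longleftrightarrow> t\<^sup>2 \<le> l" using t(2) l3 by (intro square_le_iff_le_sqrt) auto
    have sq1: "t \<le> b1 \<longleftrightarrow> t\<^sup>2 \<le> l / (l - 2)" unfolding b1_def using t(2) l3 by (intro square_le_iff_le_sqrt) auto
    have sq3: "t \<le> l / b1 \<longleftrightarrow> t\<^sup>2 \<le> l * (l - 2)"
      unfolding b1_def using t(2) l3 by (subst le_div_sqrt_iff) (auto simp: power2_eq_square)
    have cmp1: "t \<le> b1 \<longleftrightarrow> c * t\<^sup>2 + d \<le> t\<^sup>2 / l + l"
    proof -
      have "t \<le> b1 \<longleftrightarrow> t\<^sup>2 * (l - 2) \<le> l" unfolding sq1 using l3 by (simp add: pos_le_divide_eq)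
      also have "\<dots> \<longleftrightarrow> t\<^sup>2 * (l - 2) / l \<le> 1" using l3 by simp
      also have "t\<^sup>2 * (l - 2) / l = c * t\<^sup>2 + d - (t\<^sup>2 / l + l) + 1"
        using l3 by (simp add: c_def d_def field_simps)
      finally show ?thesis by linarith
    qed
    have cmp3: "t \<le> l / b1 \<longleftrightarrow> t\<^sup>2 + 1 \<le> c * t\<^sup>2 + d"
    proof -
      have "t \<le> l / b1 \<longleftrightarrow> t\<^sup>2 / l \<le> l - 2" unfolding sq3 using l3 by (simp add: pos_divide_le_eq mult.commute)
      also have "t\<^sup>2 / l = t\<^sup>2 + 1 - (c * t\<^sup>2 + d) + (l - 2)" by (simp add: c_def d_def algebra_simps)
      finally show ?thesis by linarith
    qed
    have "l / (l - 2) \<le> l" "l \<le> l * (l - 2)" using l3 by (auto simp: field_simps)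
    then have ord: "t \<le> b1 \<Longrightarrow> t \<le> sqrt l" "t \<le> sqrt l \<Longrightarrow> t \<le> l / b1" unfolding sq sq1 sq3 by linarith+
    show ?thesis
    proof (cases "t \<le> sqrt l")
      case True
      then have tl: "t\<^sup>2 \<le> l" using sq by simp
      show ?thesis
      proof (cases "t \<le> b1")
        case True
        have "h \<epsilon> = hyp_arc (V k') (W k') t" unfolding h_def
        proof (rule h2_level[OF e t(1) E(2,3) indep(3)])
          show "V (U kb) * t\<^sup>2 + W (U kb) \<le> V k * t\<^sup>2 + W k" if "k \<noteq> 0" for k
            using first1[OF that t2(1) tl] by (simp add: V_kb)
          show "V k' * t\<^sup>2 + W k' \<le> V k * t\<^sup>2 + W k" if "\<And>c. k \<noteq> c *s U kb" for k
            using second1[OF x0[OF that] t2(1) tl] True cmp1 unfolding VW' by simp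
        qed
        then show ?thesis using True by (simp add: F_def VW')
      next
        case False
        have "h \<epsilon> = hyp_arc (V kb) (W kb) t" unfolding h_def
        proof (rule h2_level[OF e t(1) E(2,1) indep(1)])
          show "V (U kb) * t\<^sup>2 + W (U kb) \<le> V k * t\<^sup>2 + W k" if "k \<noteq> 0" for k
            using first1[OF that t2(1) tl] by (simp add: V_kb)
          show "V kb * t\<^sup>2 + W kb \<le> V k * t\<^sup>2 + W k" if "\<And>c. k \<noteq> c *s U kb" for k
            using second1[OF x0[OF that] t2(1) tl] False cmp1 by (simp add: V_kb)
        qed
        then show ?thesis using False True by (simp add: F_def V_kb)
      qed
    next
      case nle: False
      then have tl: "l \<le> t\<^sup>2" using sq by simp
      have nb1: "\<not> t \<le> b1" using nle ord by blast
      show ?thesis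
      proof (cases "t \<le> l / b1")
        case True
        have "h \<epsilon> = hyp_arc (V (U kb)) (W (U kb)) t" unfolding h_def
        proof (rule h2_level[OF e t(1) E(1,2) indep(2)])
          show "V kb * t\<^sup>2 + W kb \<le> V k * t\<^sup>2 + W k" if "k \<noteq> 0" for k
            using first2[OF that tl t2(2)] by (simp add: V_kb)
          show "V (U kb) * t\<^sup>2 + W (U kb) \<le> V k * t\<^sup>2 + W k" if "\<And>c. k \<noteq> c *s kb" for k
            using second2[OF y0[OF that] tl t2(2)] True cmp3 by (simp add: V_kb)
        qed
        then show ?thesis using True nle nb1 by (simp add: F_def V_kb)
      next
        case False
        have "h \<epsilon> = hyp_arc (V k') (W k') t" unfolding h_def
        proof (rule h2_level[OF e t(1) E(1,3) indep(4)])
          show "V kb * t\<^sup>2 + W kb \<le> V k * t\<^sup>2 + W k" if "k \<noteq> 0" for k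
            using first2[OF that tl t2(2)] by (simp add: V_kb)
          show "V k' * t\<^sup>2 + W k' \<le> V k * t\<^sup>2 + W k" if "\<And>c. k \<noteq> c *s kb" for k
            using second2[OF y0[OF that] tl t2(2)] False cmp3 unfolding VW' by simp
        qed
        then show ?thesis using False nle nb1 by (simp add: F_def VW')
      qed
    qed
  qed
  then obtain \<epsilon>0 where "log_scaling C l \<epsilon>0 h F" using log_scaling_exists[of "max N1 N2" h F] by blast
  then interpret log_scaling C l \<epsilon>0 h F .
  show ?thesis unfolding L_def
    using pos0 log_periodic golden_colored_profile[OF l3 c_def d_def b1_def F_def] by blast
qed

text \<open>Now \<open>a k' = U kb - kb\<close>, so \<open>kb\<close> and \<open>U kb\<close> span a sublattice of index \<open>a\<close> only, and \<open>k'\<close> is taken as a basis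
  vector together with \<open>U kb\<close> for \<open>s \<le> l\<close> and together with \<open>kb\<close> for \<open>s \<ge> l\<close>.\<close>

lemma metallic_colored_h1:
  assumes cf: "has_periodic_cfrac \<Omega> [a, b]" and ab: "2 \<le> a" "a < b" and Om: "0 < \<Omega>" "\<Omega> < 1" "\<Omega> \<notin> \<rat>" and rho: "\<rho> > 0"
  defines "h \<equiv> h1 \<Omega> [a, b] \<rho>" and "L \<equiv> lam \<Omega> [a, b]"
  shows "\<exists>\<epsilon>0>0. log_periodic_on h (L ^ 4) \<epsilon>0 \<and>
          (\<forall>I\<in>log_periods (L ^ 4) \<epsilon>0.
             (\<exists>C \<subseteq> {\<epsilon>\<in>I. corner h \<epsilon>}. card C = 2) \<and> (\<exists>M. maximum_on h I M \<and> M < J1 L))"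
proof -
  define kb :: "int^2" where "kb = vector [-1, 0]"
  define k' :: "int^2" where "k' = vector [0, 1]"
  interpret resonant_orbit \<Omega> "[a, b]" "int a * int b + 1" "int a" "int b" 1 kb \<rho>
    unfolding kb_def by (rule resonant_orbit_two) (use assms in auto)
  have b1: "1 \<le> b" using ab by simp
  have lam: "l = a * (b + \<Omega>) + 1" "l * \<Omega> = b + \<Omega>" using lam_two[OF cf b1 Om(1)] by simp_all
  have sg: "\<sigma> = 1" unfolding \<sigma>_def by simp
  define c d where "c = \<Omega>" and "d = l * \<Omega>"
  have uv': "u kb = - 1" "v kb = a * \<Omega>" "u k' = \<Omega>" "v k' = b"
    by (simp_all add: kb_def k'_def u_def v_def)
  have usvs: "us = 1" "vs = a * \<Omega>" using uv' by (simp_all add: us_def vs_def)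
  have vk': "v k' = c * (vs * l)"
  proof -
    have "c * (vs * l) = \<Omega> * (a * (b + \<Omega>))" using lam(2) by (simp add: c_def usvs mult_ac)
    also have "\<dots> = \<Omega> * l - \<Omega>" unfolding lam(1) by (simp add: algebra_simps)
    also have "\<dots> = b" using lam(2) by (simp add: mult.commute)
    finally show ?thesis using uv' by simp
  qed
  have lpos: "l > 0" "vs > 0" using l_gt_1 vs_pos by auto
  define xx yy where "xx k = k $ 2 + a * k $ 1" and "yy k = - k $ 1" for k :: "int^2"
  have V1: "V k = \<bar>xx k * c + yy k\<bar>" "W k = \<bar>yy k - xx k * d\<bar>" for k
  proof -
    have k: "k = xx k *s k' + yy k *s U kb"
      by (simp add: kb_def k'_def vec_eq_iff forall_2 xx_def yy_def)
    have "v k = (xx k * c + yy k) * (vs * l)"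
      using arg_cong[OF k, of v] unfolding v_add vk' v_U vs_def[symmetric] by (simp add: algebra_simps)
    then show "V k = \<bar>xx k * c + yy k\<bar>" using lpos by (simp add: V_def abs_mult)
    have "l * u k = xx k * d - yy k"
      using arg_cong[OF k, of u] lpos unfolding u_add u_U uv' sg d_def by (simp add: field_simps)
    then have "l * \<bar>u k\<bar> = \<bar>xx k * d - yy k\<bar>" using lpos by (metis abs_mult abs_of_pos)
    then show "W k = \<bar>yy k - xx k * d\<bar>" by (simp add: W_def usvs abs_minus_commute)
  qed
  have VW': "V k' = c" "W k' = d"
    unfolding V1 using lpos Om by (simp_all add: k'_def xx_def yy_def c_def d_def abs_mult)
  have V2: "V k = \<bar>k $ 2 * c + yy k / l\<bar>" "W k = \<bar>l * yy k - k $ 2 * d\<bar>" for k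
  proof -
    have k: "k = k $ 2 *s k' + yy k *s kb"
      by (simp add: kb_def k'_def vec_eq_iff forall_2 yy_def)
    have "v k = (k $ 2 * c + yy k / l) * (vs * l)"
      using arg_cong[OF k, of v] lpos unfolding v_add vk' vs_def[symmetric] by (simp add: algebra_simps)
    then show "V k = \<bar>k $ 2 * c + yy k / l\<bar>" using lpos by (simp add: V_def abs_mult)
    have u: "u k = k $ 2 * \<Omega> - yy k"
      using arg_cong[OF k, of u] unfolding u_add uv' by simp
    have "l * u k = k $ 2 * d - l * yy k" unfolding u by (simp add: d_def algebra_simps)
    then have "l * \<bar>u k\<bar> = \<bar>k $ 2 * d - l * yy k\<bar>" using lpos by (metis abs_mult abs_of_pos)
    then show "W k = \<bar>l * yy k - k $ 2 * d\<bar>" by (simp add: W_def usvs abs_minus_commute)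
  qed
  have c: "0 < c" "c \<le> 1/2"
  proof -
    show "0 < c" using Om by (simp add: c_def)
    have "2 * (b + \<Omega>) \<le> a * (b + \<Omega>)" using ab Om by (intro mult_right_mono) auto
    then have "2 * (l * \<Omega>) \<le> l * 1" using lam by simp
    then have "2 * \<Omega> \<le> 1" using lpos by (simp add: mult.left_commute)
    then show "c \<le> 1/2" by (simp add: c_def)
  qed
  have d: "d = l * c" "c + d > 2" "2 * d < l + 1" "1 < d" "2 * d \<le> 1 + l"
  proof -
    show "d = l * c" by (simp add: c_def d_def)
    show "c + d > 2" "1 < d" using lam(2) ab Om by (simp_all add: c_def d_def)
    have "2 * (b + \<Omega>) \<le> a * (b + \<Omega>)" using ab Om by (intro mult_right_mono) auto
    then show "2 * d < l + 1" "2 * d \<le> 1 + l" using lam by (simp_all add: d_def)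
  qed
  have low1: "min (s + 1) (c * s + d) \<le> V k * s + W k" if "k \<noteq> 0" "1 \<le> s" "s \<le> l" for k s
  proof -
    have "xx k \<noteq> 0 \<or> yy k \<noteq> 0" using that(1) by (auto simp: xx_def yy_def vec_eq_iff forall_2)
    then show ?thesis unfolding V1
      using d(2) by (intro lower_bound_metallic_colored[OF c d(4) _ d(1,5)]) (use that in auto)
  qed
  \<comment> \<open>The reflection \<open>s \<mapsto> l\<^sup>2 / s\<close> exchanges \<open>kb\<close> with \<open>U kb\<close> and reverses the sign of \<open>k'\<close>; the bound
    is multiplied by \<open>s / l\<close>.\<close>
  have low2: "min (s / l + l) (c * s + d) \<le> V k * s + W k" if k: "k \<noteq> 0" and s: "l \<le> s" "s \<le> l\<^sup>2" for k s
  proof -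
    have s0: "s > 0" using s lpos by simp
    have s': "1 \<le> l\<^sup>2 / s" "l\<^sup>2 / s \<le> l" using s s0 lpos by (auto simp: field_simps power2_eq_square)
    have mul: "s / l * (A * (l\<^sup>2 / s) + B) = B / l * s + A * l" for A B
      using s0 lpos by (simp add: field_simps power2_eq_square)
    have "- (k $ 2) \<noteq> 0 \<or> yy k \<noteq> 0" using k by (auto simp: yy_def vec_eq_iff forall_2)
    then have "min (l\<^sup>2 / s + 1) (c * (l\<^sup>2 / s) + d) \<le> \<bar>real_of_int (- (k $ 2)) * c + yy k\<bar> * (l\<^sup>2 / s) + \<bar>yy k - real_of_int (- (k $ 2)) * d\<bar>"
      using d(2) by (intro lower_bound_metallic_colored[OF c d(4) _ d(1,5)]) (use s' in auto)
    then have "s / l * min (1 * (l\<^sup>2 / s) + 1) (c * (l\<^sup>2 / s) + d)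
       \<le> s / l * (\<bar>real_of_int (- (k $ 2)) * c + yy k\<bar> * (l\<^sup>2 / s) + \<bar>yy k - real_of_int (- (k $ 2)) * d\<bar>)"
      using s0 lpos by (intro mult_left_mono) auto
    then have main: "min (1 / l * s + 1 * l) (d / l * s + c * l)
      \<le> \<bar>yy k - real_of_int (- (k $ 2)) * d\<bar> / l * s + \<bar>real_of_int (- (k $ 2)) * c + yy k\<bar> * l"
      unfolding mul min_mult_distrib_left using s0 lpos by (simp add: mul)
    have 1: "\<bar>yy k - real_of_int (- (k $ 2)) * d\<bar> / l = V k"
    proof -
      have "(yy k - real_of_int (- (k $ 2)) * d) / l = k $ 2 * c + yy k / l"
        using lpos by (simp add: d(1) field_simps)
      then show ?thesis unfolding V2 using lpos by (metis abs_divide abs_of_pos)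
    qed
    have 2: "\<bar>real_of_int (- (k $ 2)) * c + yy k\<bar> * l = W k"
      unfolding V2 using lpos by (intro abs_scale) (simp_all add: d(1) algebra_simps)
    have 3: "d / l = c" "c * l = d" using lpos by (simp_all add: d(1))
    show ?thesis using main unfolding 1 2 3 by simp
  qed
  define s1 where "s1 = (d - 1) / (1 - c)"
  define b1 where "b1 = sqrt ((d - 1) / (1 - c))"
  have s1: "1 < s1" "s1 < l" using c d by (auto simp: s1_def field_simps)
  define F where "F t = (if t \<le> b1 then hyp_arc 1 1 t
        else if t \<le> l / b1 then hyp_arc c d t else hyp_arc (1 / l) l t)" for t
  obtain N1 where N1: "\<forall>m\<ge>N1. (U ^^ m) kb \<in> essential_resonances \<Omega>"
    using essential_eventually[OF kb] primitive_vector[of kb] by (auto simp: kb_def)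
  have "\<exists>N. \<forall>m\<ge>N. (U ^^ m) k' \<in> essential_resonances \<Omega>"
    by (rule essential_eventually) (use primitive_vector[of k'] in \<open>auto simp: k'_def vec_eq_iff forall_2\<close>)
  then obtain N2 where N2: "\<forall>m\<ge>N2. (U ^^ m) k' \<in> essential_resonances \<Omega>" by blast
  have "h \<epsilon> = F t" if m: "m \<ge> max N1 N2" and e: "\<epsilon> > 0" and t: "t = C * \<epsilon> powr (1/4) * l ^ Suc m" "1 \<le> t" "t \<le> l" for m \<epsilon> t
  proof -
    have "(U ^^ Suc m) kb \<in> essential_resonances \<Omega>"
      using N1[rule_format, of "Suc m"] m by (simp only: le_SucI max.bounded_iff)
    then have E: "(U ^^ m) kb \<in> essential_resonances \<Omega>" "(U ^^ m) (U kb) \<in> essential_resonances \<Omega>"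
       "(U ^^ m) k' \<in> essential_resonances \<Omega>"
      using N1 N2 m by (simp_all add: funpow_swap1)
    have t2: "1 \<le> t\<^sup>2" "t\<^sup>2 \<le> l\<^sup>2" using t(2,3) by (auto simp: power_mono)
    have sq1: "t \<le> b1 \<longleftrightarrow> t\<^sup>2 \<le> s1"
      unfolding b1_def s1_def[symmetric] using t(2) s1 by (intro square_le_iff_le_sqrt) auto
    have sq2: "t \<le> l / b1 \<longleftrightarrow> t\<^sup>2 \<le> l\<^sup>2 / s1"
      unfolding b1_def s1_def[symmetric] using t(2) s1 lpos by (intro le_div_sqrt_iff) auto
    have cmp1: "t \<le> b1 \<longleftrightarrow> t\<^sup>2 + 1 \<le> c * t\<^sup>2 + d"
      unfolding sq1 s1_def using c by (simp add: field_simps)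
    have "1 - c > 0" "d - 1 > 0" using c d lpos by auto
    have cmp2: "t \<le> l / b1 \<longleftrightarrow> c * t\<^sup>2 + d \<le> t\<^sup>2 / l + l"
    proof -
      have "t \<le> l / b1 \<longleftrightarrow> t\<^sup>2 * (d - 1) \<le> l * l * (1 - c)"
        unfolding sq2 s1_def using \<open>1 - c > 0\<close> \<open>d - 1 > 0\<close> by (simp add: field_simps power2_eq_square)
      also have "\<dots> \<longleftrightarrow> c * t\<^sup>2 + d \<le> t\<^sup>2 / l + l"
        using lpos by (simp add: d(1) field_simps)
      finally show ?thesis .
    qed
    have ord: "s1 \<le> l" "l \<le> l\<^sup>2 / s1" using s1 lpos by (auto simp: field_simps power2_eq_square)
    show ?thesis
    proof (cases "t \<le> b1")
      case True
      then have tl: "t\<^sup>2 \<le> l" using sq1 ord by linarith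
      have "h \<epsilon> = hyp_arc (V (U kb)) (W (U kb)) t" unfolding h_def
        using low1[OF _ t2(1) tl] True cmp1 by (intro h1_level[OF e t(1) E(2)]) (simp add: V_kb)
      then show ?thesis using True by (simp add: F_def V_kb)
    next
      case nb1: False
      show ?thesis
      proof (cases "t \<le> l / b1")
        case True
        have "h \<epsilon> = hyp_arc (V k') (W k') t" unfolding h_def
        proof (rule h1_level[OF e t(1) E(3)])
          fix k :: "int^2" assume k: "k \<noteq> 0"
          show "V k' * t\<^sup>2 + W k' \<le> V k * t\<^sup>2 + W k"
          proof (cases "t\<^sup>2 \<le> l")
            case True
            then show ?thesis using low1[OF k t2(1) True] nb1 cmp1 unfolding VW' by simp
          next
            case False
            then show ?thesis using low2[OF k _ t2(2)] True cmp2 unfolding VW' by simp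
          qed
        qed
        then show ?thesis using True nb1 by (simp add: F_def VW')
      next
        case False
        then have tl: "l \<le> t\<^sup>2" using sq2 ord by linarith
        have "h \<epsilon> = hyp_arc (V kb) (W kb) t" unfolding h_def
          using low2[OF _ tl t2(2)] False cmp2 by (intro h1_level[OF e t(1) E(1)]) (simp add: V_kb)
        then show ?thesis using False nb1 by (simp add: F_def V_kb)
      qed
    qed
  qed
  then obtain \<epsilon>0 where "log_scaling C l \<epsilon>0 h F" using log_scaling_exists[of "max N1 N2" h F] by blast
  then interpret log_scaling C l \<epsilon>0 h F .
  show ?thesis unfolding L_def
    using pos0 log_periodic metallic_colored_profile[OF c d(1-3) b1_def F_def] by blast
qed

theorem theorem2:
  fixes \<rho> \<Omega> :: real
  assumes "\<rho> > 0" and "0 < \<Omega>" and "\<Omega> < 1" and "quadratic_irrational \<Omega>"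
  shows
    "(\<forall>a\<ge>1. has_periodic_cfrac \<Omega> [a] \<longrightarrow>
       (let l = lam \<Omega> [a]; h = h1 \<Omega> [a] \<rho> in
        \<exists>\<epsilon>0>0. log_periodic_on h (l ^ 4) \<epsilon>0 \<and>
          (\<forall>I\<in>log_periods (l ^ 4) \<epsilon>0. \<exists>\<epsilon>c.
             {\<epsilon>\<in>I. corner h \<epsilon>} = {\<epsilon>c} \<and> h \<epsilon>c = J1 l \<and> maximum_on h I (J1 l)) \<and>
          (\<forall>x y. 0 < x \<and> x < y \<and> y < \<epsilon>0 \<and> corner h x \<and> corner h y \<and>
                 \<not> (\<exists>w\<in>{x<..<y}. corner h w) \<longrightarrow> ln y - ln x = 4 * ln l)))
   \<and> (\<forall>b\<ge>2. has_periodic_cfrac \<Omega> [1, b] \<longrightarrow>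
       (let l = lam \<Omega> [1, b]; h = h2 \<Omega> [1, b] \<rho> in
        \<exists>\<epsilon>0>0. log_periodic_on h (l ^ 4) \<epsilon>0 \<and>
          (\<forall>I\<in>log_periods (l ^ 4) \<epsilon>0.
             (\<exists>C \<subseteq> {\<epsilon>\<in>I. corner h \<epsilon>}. card C = 3) \<and>
             minimum_on h I (J1 l) \<and> (\<exists>M. maximum_on h I M \<and> M < J2 l))))
   \<and> (\<forall>a b. 2 \<le> a \<and> a < b \<and> has_periodic_cfrac \<Omega> [a, b] \<longrightarrow>
       (let l = lam \<Omega> [a, b]; h = h1 \<Omega> [a, b] \<rho> in
        \<exists>\<epsilon>0>0. log_periodic_on h (l ^ 4) \<epsilon>0 \<and>
          (\<forall>I\<in>log_periods (l ^ 4) \<epsilon>0.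
             (\<exists>C \<subseteq> {\<epsilon>\<in>I. corner h \<epsilon>}. card C = 2) \<and>
             (\<exists>M. maximum_on h I M \<and> M < J1 l))))"
proof -
  have irr: "\<Omega> \<notin> \<rat>" using assms(4) by (simp add: quadratic_irrational_def)
  show ?thesis
    unfolding Let_def
  proof (intro conjI allI impI, goal_cases)
    case (1 a)
    show ?case by (rule metallic_h1[OF 1(2,1) assms(2,3) irr assms(1)])
  next
    case (2 b)
    show ?case by (rule golden_colored_h2[OF 2(2,1) assms(2,3) irr assms(1)])
  next
    case (3 a b)
    show ?case
      by (rule metallic_colored_h1[OF _ _ _ assms(2,3) irr assms(1)]) (use 3 in blast)+
  qed
qed

end
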